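(* Let $A$ be a unital associative algebra over $\mathbb K$ and let $M$ be a unital $A$-bimodule. For $\bullet\ge1$, $$\mathrm H^\bullet_{u\mathcal As}(A,M)\cong\mathrm{HH}^{\bullet+1}(A,M),$$ where the left-hand side is the André–Quillen cohomology of $A$ as a unital associative algebra and the right-hand side is Hochschild cohomology.
   Context: $\mathbb K$ is a field of characteristic $0$. $u\mathcal As=\mathcal F(V)/(R)$ is the operad of unital associative algebras ($V$ spanned by a nullary $\bullet$ and a binary $\mu$ without symmetry; $R$ spanned by associativity of $\mu$ and $\mu\circ(\bullet,\mathrm{id})-|$, $\mu\circ(\mathrm{id},\bullet)-|$). Its Koszul dual curved cooperad is $u\mathcal As^{\text{!`}}=(\mathcal C(sV,s^2\mathrm qR),0,\theta)$: $\mathrm qR$ is the projection of $R$ on the two-vertex part $\mathcal F(V)^{(2)}$; $\mathcal C(sV,s^2\mathrm qR)$ is the largest sub-cooperad of the cofree conilpotent cooperad $\mathcal F^c(sV)$ whose projection to $\mathcal F^c(sV)^{(2)}/s^2\mathrm qR$ vanishes; $\theta$ has degree $-2$, takes values in the unit operad $I$, factors through $s^2\mathrm qR$, and sends $s^2(\mu\circ(\bullet,\mathrm{id}))$, $s^2(\mu\circ(\mathrm{id},\bullet))$ to $-|$ and associativity to $0$. Let $\kappa:u\mathcal As^{\text{!`}}\twoheadrightarrow sV\cong V\rightarrowtail u\mathcal As$. For a $u\mathcal As$-algebra $A$ let $Q=\Omega_\kappa\mathrm B_\kappa A\to A$ be the bar-cobar resolution: a cofibrant resolution of $A$ in dg unital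 associative algebras, whose underlying algebra is the free unital associative algebra on $u\mathcal As^{\text{!`}}(A)=\bigoplus_nu\mathcal As^{\text{!`}}(n)\otimes_{\mathbb S_n}A^{\otimes n}$. Explicitly, $\mathrm B_\kappa A=(u\mathcal As^{\text{!`}}(A),d_1+d_2)$ with $d_1$ induced by $d_A$ and $d_2$ given by the infinitesimal decomposition of $u\mathcal As^{\text{!`}}$, followed by $\kappa$ on the upper factor and the action on $A$; $\Omega_\kappa C=(u\mathcal As(C),d_1-d_2)$ with $d_1$ induced by $d_C$ and $d_2$ given by applying the coaction $\Delta_C:C\to u\mathcal As^{\text{!`}}(C)$ to one factor, then $\kappa$, then composing in $u\mathcal As$. The map $Q\to A$ projects $u\mathcal As^{\text{!`}}(A)$ onto $I(A)=A$ and uses the action on $A$. The cotangent complex is $A\otimes^{u\mathcal As}u\mathcal As^{\text{!`}}(A):=A\otimes_Q\Omega_{u\mathcal As}(Q)\otimes_QA$, where $\Omega_{u\mathcal As}(Q)$ is the $Q$-bimodule of noncommutative Kähler differentials (representing derivations); its underlying bimodule is $A\otimes u\mathcal As^{\text{!`}}(A)\otimes A$ and its differential is denoted $d_\varphi$. For a unital $A$-bimodule $M$, $$\mathrm H^\bullet_{u\mathcal As}(A,M):=\mathrm H^\bullet\big(\mathrm{Hom}_{A\text{-bimod}}(A\otimes^{u\mathcal As}u\mathcal As^{\text{!`}}(A),M),\ \partial f=d_M\circ f-(-1)^{|f|}f\circ d_\varphi\big),$$ where $A$-bimod is the category of unital $A$-bimodules; equivalently, the cohomology of the complex of derivations $\mathrm{Der}(Q,M)$.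 Homological degree $-k$ is cohomological degree $k$. *)

theory Defs
  imports Complex_Main "HOL-Library.Poly_Mapping" "HOL-Library.Function_Algebras"
begin

section \<open>Free vector spaces\<close>

text \<open>
  The type \<open>'x \<Rightarrow>\<^sub>0 'k\<close> of finitely supported functions is the vector space with
  basis \<open>'x\<close>; the basis vector of \<open>x\<close> is \<open>Poly_Mapping.single x 1\<close>.
\<close>

definition fscale :: "'k::field \<Rightarrow> ('x \<Rightarrow>\<^sub>0 'k) \<Rightarrow> ('x \<Rightarrow>\<^sub>0 'k)" where
  "fscale c p = Poly_Mapping.map (\<lambda>y. c * y) p"

lemma lookup_fscale: "Poly_Mapping.lookup (fscale c p) x = c * Poly_Mapping.lookup p x"
  by (simp add: fscale_def Poly_Mapping.map.rep_eq when_def)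

interpretation fvs: vector_space "fscale :: 'k::field \<Rightarrow> ('x \<Rightarrow>\<^sub>0 'k) \<Rightarrow> ('x \<Rightarrow>\<^sub>0 'k)"
  by unfold_locales
     (auto intro!: poly_mapping_eqI simp: lookup_fscale lookup_add algebra_simps)

definition lin :: "('x \<Rightarrow> ('y \<Rightarrow>\<^sub>0 'k::field)) \<Rightarrow> ('x \<Rightarrow>\<^sub>0 'k) \<Rightarrow> ('y \<Rightarrow>\<^sub>0 'k)" where
  "lin f p = (\<Sum>x\<in>Poly_Mapping.keys p. fscale (Poly_Mapping.lookup p x) (f x))"

definition bilin ::
  "('x \<Rightarrow> 'y \<Rightarrow> ('z \<Rightarrow>\<^sub>0 'k::field)) \<Rightarrow> ('x \<Rightarrow>\<^sub>0 'k) \<Rightarrow> ('y \<Rightarrow>\<^sub>0 'k) \<Rightarrow> ('z \<Rightarrow>\<^sub>0 'k)" where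
  "bilin f p q = lin (\<lambda>x. lin (f x) q) p"

text \<open>
  \<open>'x list \<Rightarrow>\<^sub>0 'k\<close> is the tensor algebra of \<open>'x \<Rightarrow>\<^sub>0 'k\<close>: \<open>wmult\<close> is its product and
  \<open>ftensor [p1, ..., pn]\<close> is the tensor \<open>p1 \<otimes> ... \<otimes> pn\<close>.
\<close>

definition wmult :: "('x list \<Rightarrow>\<^sub>0 'k::field) \<Rightarrow> ('x list \<Rightarrow>\<^sub>0 'k) \<Rightarrow> ('x list \<Rightarrow>\<^sub>0 'k)" where
  "wmult = bilin (\<lambda>u v. Poly_Mapping.single (u @ v) 1)"

fun ftensor :: "('x \<Rightarrow>\<^sub>0 'k::field) list \<Rightarrow> ('x list \<Rightarrow>\<^sub>0 'k)" where
  "ftensor [] = Poly_Mapping.single [] 1"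
| "ftensor (p # ps) = bilin (\<lambda>x xs. Poly_Mapping.single (x # xs) 1) p (ftensor ps)"


section \<open>Vector spaces with a carrier, quotients and complexes\<close>

record ('k, 'v) vs =
  vcar :: "'v set"
  vadd :: "'v \<Rightarrow> 'v \<Rightarrow> 'v"
  vsmul :: "'k \<Rightarrow> 'v \<Rightarrow> 'v"

text \<open>\<open>hcomp V n\<close> is the homogeneous component of homological degree \<open>n\<close>.\<close>

record ('k, 'v) dgvs = "('k, 'v) vs" +
  hcomp :: "nat \<Rightarrow> 'v set"
  vdiff :: "'v \<Rightarrow> 'v"

text \<open>\<open>ainv\<close> is the grading involution \<open>x \<mapsto> (-1)^|x| x\<close>; it encodes Koszul signs.\<close>

record ('k, 'v) dga = "('k, 'v) dgvs" +
  amult :: "'v \<Rightarrow> 'v \<Rightarrow> 'v"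
  aone :: 'v
  ainv :: "'v \<Rightarrow> 'v"

record ('k, 'r, 'v) dgbimod = "('k, 'v) dgvs" +
  lact :: "'r \<Rightarrow> 'v \<Rightarrow> 'v"
  ract :: "'v \<Rightarrow> 'r \<Rightarrow> 'v"

definition vs_isomorphic :: "('k, 'v, 'e) vs_scheme \<Rightarrow> ('k, 'w, 'f) vs_scheme \<Rightarrow> bool" where
  "vs_isomorphic V W \<longleftrightarrow> (\<exists>\<Phi>. bij_betw \<Phi> (vcar V) (vcar W) \<and>
     (\<forall>x\<in>vcar V. \<forall>y\<in>vcar V. \<Phi> (vadd V x y) = vadd W (\<Phi> x) (\<Phi> y)) \<and>
     (\<forall>c. \<forall>x\<in>vcar V. \<Phi> (vsmul V c x) = vsmul W c (\<Phi> x)))"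

definition cls :: "'v::ab_group_add set \<Rightarrow> 'v \<Rightarrow> 'v set" where
  "cls N x = {y. y - x \<in> N}"

text \<open>
  Maps induced on cosets. For a map compatible with \<open>N\<close> the union below is a
  union of equal cosets.
\<close>

definition qlift :: "'w::ab_group_add set \<Rightarrow> ('v \<Rightarrow> 'w) \<Rightarrow> 'v set \<Rightarrow> 'w set" where
  "qlift N f X = (\<Union>x\<in>X. cls N (f x))"

definition qlift2 ::
  "'w::ab_group_add set \<Rightarrow> ('u \<Rightarrow> 'v \<Rightarrow> 'w) \<Rightarrow> 'u set \<Rightarrow> 'v set \<Rightarrow> 'w set" where
  "qlift2 N f X Y = (\<Union>x\<in>X. \<Union>y\<in>Y. cls N (f x y))"

text \<open>The image of the subspace \<open>U\<close> in the quotient by the subspace \<open>N\<close>.\<close>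

definition quotient_vs ::
  "('k \<Rightarrow> 'v \<Rightarrow> 'v) \<Rightarrow> 'v::ab_group_add set \<Rightarrow> 'v set \<Rightarrow> ('k, 'v set) vs" where
  "quotient_vs s U N =
     \<lparr>vcar = cls N ` U, vadd = qlift2 N (+), vsmul = (\<lambda>c. qlift N (s c))\<rparr>"

definition quotient_dgvs ::
  "('x \<Rightarrow>\<^sub>0 'k::field) set \<Rightarrow> ('x \<Rightarrow>\<^sub>0 'k) set \<Rightarrow> (nat \<Rightarrow> ('x \<Rightarrow>\<^sub>0 'k) set) \<Rightarrow>
   (('x \<Rightarrow>\<^sub>0 'k) \<Rightarrow> ('x \<Rightarrow>\<^sub>0 'k)) \<Rightarrow> ('k, ('x \<Rightarrow>\<^sub>0 'k) set) dgvs" where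
  "quotient_dgvs U N H d = vs.extend (quotient_vs fscale U N)
     \<lparr>hcomp = (\<lambda>n. cls N ` H n), vdiff = qlift N d\<rparr>"

definition cohomology ::
  "('k \<Rightarrow> 'v \<Rightarrow> 'v) \<Rightarrow> (nat \<Rightarrow> 'v::ab_group_add set) \<Rightarrow> (nat \<Rightarrow> 'v \<Rightarrow> 'v) \<Rightarrow> nat \<Rightarrow>
   ('k, 'v set) vs" where
  "cohomology s C d k = quotient_vs s {f \<in> C k. d k f = 0}
     (case k of 0 \<Rightarrow> {0} | Suc j \<Rightarrow> d j ` C j)"


section \<open>Unital associative algebras, bimodules and Hochschild cohomology\<close>

text \<open>The sort \<open>{ring, monoid_mult}\<close> is that of unital rings, the zero ring included.\<close>

locale unital_algebra = vector_space scale
  for scale :: "'k::field \<Rightarrow> 'a::{ring,monoid_mult} \<Rightarrow> 'a" +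
  assumes scale_mult_left: "scale c x * y = scale c (x * y)"
    and scale_mult_right: "x * scale c y = scale c (x * y)"

locale unital_bimodule = A: unital_algebra scaleA + M: vector_space scaleM
  for scaleA :: "'k::field \<Rightarrow> 'a::{ring,monoid_mult} \<Rightarrow> 'a"
    and scaleM :: "'k \<Rightarrow> 'm::ab_group_add \<Rightarrow> 'm" +
  fixes l :: "'a \<Rightarrow> 'm \<Rightarrow> 'm" and r :: "'m \<Rightarrow> 'a \<Rightarrow> 'm"
  assumes l_add: "l (a + b) x = l a x + l b x" "l a (x + y) = l a x + l a y"
    and r_add: "r (x + y) a = r x a + r y a" "r x (a + b) = r x a + r x b"
    and l_scale: "l (scaleA c a) x = scaleM c (l a x)" "l a (scaleM c x) = scaleM c (l a x)"
    and r_scale: "r (scaleM c x) a = scaleM c (r x a)" "r x (scaleA c a) = scaleM c (r x a)"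
    and l_mult: "l (a * b) x = l a (l b x)"
    and r_mult: "r x (a * b) = r (r x a) b"
    and l_r: "r (l a x) b = l a (r x b)"
    and l_one: "l 1 x = x"
    and r_one: "r x 1 = x"

text \<open>
  A Hochschild \<open>n\<close>-cochain is an \<open>n\<close>-linear map, written as a function on lists
  that vanishes on lists of length other than \<open>n\<close>.
\<close>

definition hochschild_cochains ::
  "('k \<Rightarrow> 'a \<Rightarrow> 'a) \<Rightarrow> ('k \<Rightarrow> 'm \<Rightarrow> 'm) \<Rightarrow> nat \<Rightarrow> ('a::plus list \<Rightarrow> 'm::ab_group_add) set" where
  "hochschild_cochains scaleA scaleM n = {f.
     (\<forall>as. length as \<noteq> n \<longrightarrow> f as = 0) \<and>
     (\<forall>us a b vs. length us + 1 + length vs = n \<longrightarrow>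
        f (us @ [a + b] @ vs) = f (us @ [a] @ vs) + f (us @ [b] @ vs)) \<and>
     (\<forall>us c a vs. length us + 1 + length vs = n \<longrightarrow>
        f (us @ [scaleA c a] @ vs) = scaleM c (f (us @ [a] @ vs)))}"

definition hochschild_diff ::
  "('k::field \<Rightarrow> 'm \<Rightarrow> 'm) \<Rightarrow> ('a \<Rightarrow> 'm \<Rightarrow> 'm) \<Rightarrow> ('m \<Rightarrow> 'a \<Rightarrow> 'm) \<Rightarrow> nat \<Rightarrow>
   ('a::times list \<Rightarrow> 'm::ab_group_add) \<Rightarrow> 'a list \<Rightarrow> 'm" where
  "hochschild_diff scaleM l r n f as = (if length as = Suc n then
       l (hd as) (f (tl as))
       + (\<Sum>i<n. scaleM ((-1) ^ Suc i) (f (take i as @ [as ! i * as ! Suc i] @ drop (i + 2) as)))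
       + scaleM ((-1) ^ Suc n) (r (f (butlast as)) (last as))
     else 0)"

definition hochschild_cohomology ::
  "('k::field \<Rightarrow> 'a::{ring,monoid_mult} \<Rightarrow> 'a) \<Rightarrow> ('k \<Rightarrow> 'm::ab_group_add \<Rightarrow> 'm) \<Rightarrow>
   ('a \<Rightarrow> 'm \<Rightarrow> 'm) \<Rightarrow> ('m \<Rightarrow> 'a \<Rightarrow> 'm) \<Rightarrow> nat \<Rightarrow> ('k, ('a list \<Rightarrow> 'm) set) vs" where
  "hochschild_cohomology scaleA scaleM l r n =
     cohomology (\<lambda>c f x. scaleM c (f x))
       (hochschild_cochains scaleA scaleM) (hochschild_diff scaleM l r) n"


section \<open>Trees and the cofree conilpotent cooperad\<close>

text \<open>
  The generators carry no symmetry, so all symmetric collections involved are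
  regular and are handled through their nonsymmetric (planar) parts; thus
  \<open>P(n) \<otimes>\<^bsub>S_n\<^esub> X^(\<otimes>n)\<close> becomes \<open>P_n \<otimes> X^(\<otimes>n)\<close>.

  \<open>Bullet\<close> is the nullary generator, \<open>Mu\<close> the binary one, and \<open>Leaf b\<close> is a leaf
  labelled by \<open>b\<close>. A \<open>unit tree\<close> is a basis element of the nonsymmetric part of both
  \<open>F(V)\<close> and \<open>F^c(sV)\<close>; in the second reading each vertex has degree 1 and
  the tree stands for the product of its vertices in prefix order. Trees labelled in
  \<open>'b\<close> span the value of the Schur functor on \<open>'b \<Rightarrow>\<^sub>0 'k\<close>, so that \<open>unit tree tree\<close>
  is a basis of \<open>F^c(sV) \<circ> F^c(sV)\<close>.
\<close>

datatype 'b tree = Leaf 'b | Bullet | Mu "'b tree" "'b tree"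

fun leaves :: "'b tree \<Rightarrow> 'b list" where
  "leaves (Leaf b) = [b]"
| "leaves Bullet = []"
| "leaves (Mu s t) = leaves s @ leaves t"

definition arity :: "'b tree \<Rightarrow> nat" where
  "arity t = length (leaves t)"

fun weight :: "'b tree \<Rightarrow> nat" where
  "weight (Leaf b) = 0"
| "weight Bullet = 1"
| "weight (Mu s t) = Suc (weight s + weight t)"

fun decorate :: "'c tree \<Rightarrow> 'b list \<Rightarrow> 'b tree" where
  "decorate (Leaf _) bs = Leaf (hd bs)"
| "decorate Bullet bs = Bullet"
| "decorate (Mu s t) bs = Mu (decorate s (take (arity s) bs)) (decorate t (drop (arity s) bs))"

text \<open>
  The decomposition map of the cofree conilpotent cooperad: the sum over all cuts of
  a tree into a lower part and upper trees grafted on its leaves. The vertices of the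
  result are ordered as (lower part, first upper tree, second upper tree, ...); moving
  the lower vertices lying in \<open>t\<close> past the upper vertices lying in \<open>s\<close> produces the sign.
\<close>

definition inner_weight :: "'b tree tree \<Rightarrow> nat" where
  "inner_weight x = sum_list (map weight (leaves x))"

fun decomp :: "'b tree \<Rightarrow> ('b tree tree \<Rightarrow>\<^sub>0 'k::field)" where
  "decomp (Leaf b) = Poly_Mapping.single (Leaf (Leaf b)) 1"
| "decomp Bullet = Poly_Mapping.single (Leaf Bullet) 1 + Poly_Mapping.single Bullet 1"
| "decomp (Mu s t) = Poly_Mapping.single (Leaf (Mu s t)) 1 +
     bilin (\<lambda>x y. Poly_Mapping.single (Mu x y) ((-1) ^ (inner_weight x * weight y)))
       (decomp s) (decomp t)"

definition homog_part :: "nat \<Rightarrow> nat \<Rightarrow> ('b tree \<Rightarrow>\<^sub>0 'k::field) \<Rightarrow> ('b tree \<Rightarrow>\<^sub>0 'k)" where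
  "homog_part n w = lin (\<lambda>t. if arity t = n \<and> weight t = w then Poly_Mapping.single t 1 else 0)"

definition weight_part :: "nat \<Rightarrow> ('b tree \<Rightarrow>\<^sub>0 'k::field) \<Rightarrow> ('b tree \<Rightarrow>\<^sub>0 'k)" where
  "weight_part w = lin (\<lambda>t. if weight t = w then Poly_Mapping.single t 1 else 0)"

definition of_arity :: "nat \<Rightarrow> ('b tree \<Rightarrow>\<^sub>0 'k::zero) set" where
  "of_arity n = {c. \<forall>t\<in>Poly_Mapping.keys c. arity t = n}"

text \<open>The subspace \<open>D \<circ> D\<close> of \<open>F^c(sV) \<circ> F^c(sV)\<close>.\<close>

definition comp_square :: "(unit tree \<Rightarrow>\<^sub>0 'k::field) set \<Rightarrow> (unit tree tree \<Rightarrow>\<^sub>0 'k) set" where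
  "comp_square D = fvs.span
     {bilin (\<lambda>t ts. Poly_Mapping.single (decorate t ts) 1) c (ftensor ys) | n c ys.
        c \<in> D \<inter> of_arity n \<and> length ys = n \<and> set ys \<subseteq> D}"

definition subcooperad :: "(unit tree \<Rightarrow>\<^sub>0 'k::field) set \<Rightarrow> bool" where
  "subcooperad D \<longleftrightarrow> fvs.subspace D \<and>
     (\<forall>x\<in>D. \<forall>n w. homog_part n w x \<in> D) \<and>
     (\<forall>x\<in>D. lin decomp x \<in> comp_square D)"


section \<open>The Koszul dual cooperad of the operad of unital associative algebras\<close>

abbreviation (input) lf :: "unit tree" where "lf \<equiv> Leaf ()"

definition uAs_relations :: "(unit tree \<Rightarrow>\<^sub>0 'k::field) set" where
  "uAs_relations = fvs.span
     {Poly_Mapping.single (Mu (Mu lf lf) lf) 1 - Poly_Mapping.single (Mu lf (Mu lf lf)) 1,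
      Poly_Mapping.single (Mu Bullet lf) 1 - Poly_Mapping.single lf 1,
      Poly_Mapping.single (Mu lf Bullet) 1 - Poly_Mapping.single lf 1}"

text \<open>
  \<open>q R\<close>. Since the generators have degree 0, the double suspension carries a
  two-vertex tree to the same tree with its vertices in prefix order, without sign.
\<close>

definition uAs_quadratic_relations :: "(unit tree \<Rightarrow>\<^sub>0 'k::field) set" where
  "uAs_quadratic_relations = weight_part 2 ` uAs_relations"

text \<open>
  The largest sub-cooperad whose projection to two-vertex trees modulo \<open>s^2 q R\<close>
  vanishes, as the sum of all such sub-cooperads.
\<close>

definition uAs_dual :: "(unit tree \<Rightarrow>\<^sub>0 'k::field) set" where
  "uAs_dual = fvs.span (\<Union>{D. subcooperad D \<and>
     (\<forall>x\<in>D. weight_part 2 x \<in> uAs_quadratic_relations)})"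

text \<open>
  The map \<open>\<kappa>\<close> followed by the action of \<open>uAs\<close> on a unital monoid with unit \<open>e\<close>
  and product \<open>m\<close>: \<open>None\<close> stands for the value zero.
\<close>

fun kappa_act :: "'b \<Rightarrow> ('b \<Rightarrow> 'b \<Rightarrow> 'b) \<Rightarrow> 'b tree \<Rightarrow> 'b option" where
  "kappa_act e m Bullet = Some e"
| "kappa_act e m (Mu (Leaf x) (Leaf y)) = Some (m x y)"
| "kappa_act e m _ = None"


section \<open>The bar-cobar resolution\<close>

text \<open>
  Trees labelled by \<open>'a\<close> span \<open>F^c(sV)\<close> evaluated on the free vector space on \<open>'a\<close>;
  the following relations make it \<open>F^c(sV)(A)\<close>.
\<close>

definition multilin_rels :: "('k::field \<Rightarrow> 'a::plus \<Rightarrow> 'a) \<Rightarrow> ('a tree \<Rightarrow>\<^sub>0 'k) set" where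
  "multilin_rels scaleA =
     {Poly_Mapping.single (decorate t (us @ [a + b] @ vs)) 1
        - Poly_Mapping.single (decorate t (us @ [a] @ vs)) 1
        - Poly_Mapping.single (decorate t (us @ [b] @ vs)) 1
      | (t :: unit tree) us a b vs. length us + 1 + length vs = arity t}
   \<union> {Poly_Mapping.single (decorate t (us @ [scaleA c a] @ vs)) 1
        - fscale c (Poly_Mapping.single (decorate t (us @ [a] @ vs)) 1)
      | (t :: unit tree) us c a vs. length us + 1 + length vs = arity t}"

text \<open>
  Representatives of the elements of the bar construction, that is of the value of the
  Koszul dual cooperad on \<open>A\<close>, inside those of \<open>F^c(sV)(A)\<close>.
\<close>

definition bar_gens :: "('a tree \<Rightarrow>\<^sub>0 'k::field) set" where
  "bar_gens = fvs.span
     {lin (\<lambda>t. Poly_Mapping.single (decorate t as) 1) c | n c as.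
        c \<in> uAs_dual \<inter> of_arity n \<and> length as = n}"

text \<open>
  The differential \<open>d_2\<close> of the bar construction. The infinitesimal decomposition keeps the terms
  of \<open>decomp\<close> with exactly one upper tree other than a leaf (terms with only leaves above
  are killed by \<open>\<kappa>\<close>). Moving \<open>\<kappa>\<close>, which has degree -1, past the lower tree
  gives the sign. As \<open>A\<close> sits in degree 0, the part \<open>d_1\<close> vanishes.
\<close>

definition bar_term ::
  "'a::{ring,monoid_mult} tree tree \<Rightarrow> ('a tree \<Rightarrow>\<^sub>0 'k::field)" where
  "bar_term x =
     (case filter (\<lambda>u. weight u \<noteq> 0) (leaves x) of
        [u] \<Rightarrow> (case kappa_act 1 (*) u of
                 None \<Rightarrow> 0
               | Some b \<Rightarrow> Poly_Mapping.single
                   (map_tree (\<lambda>v. case v of Leaf a \<Rightarrow> a | _ \<Rightarrow> b) x) ((-1) ^ weight x))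
      | _ \<Rightarrow> 0)"

definition bar_diff :: "'a::{ring,monoid_mult} tree \<Rightarrow> ('a tree \<Rightarrow>\<^sub>0 'k::field)" where
  "bar_diff t = lin bar_term (decomp t)"

text \<open>
  The differential \<open>d_2\<close> of the cobar construction on a generator: the coaction, then
  \<open>\<kappa>\<close> on the lower tree, then the product of words.
\<close>

definition cobar_diff :: "'a tree \<Rightarrow> ('a tree list \<Rightarrow>\<^sub>0 'k::field)" where
  "cobar_diff t = lin (\<lambda>x. case kappa_act [] (@) (map_tree (\<lambda>u. [u]) x) of
     None \<Rightarrow> 0 | Some w \<Rightarrow> Poly_Mapping.single w 1) (decomp t)"

text \<open>
  \<open>Q\<close> is the tensor algebra on the value of the Koszul dual cooperad on \<open>A\<close>. It is realised
  inside the tensor algebra on \<open>F^c(sV)(A)\<close>, which is the algebra of words in trees modulo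
  the ideal \<open>word_ideal\<close>. Its differential \<open>d_1 - d_2\<close> is extended from generators as a
  derivation of degree -1.
\<close>

definition word_ideal :: "('k::field \<Rightarrow> 'a::plus \<Rightarrow> 'a) \<Rightarrow> ('a tree list \<Rightarrow>\<^sub>0 'k) set" where
  "word_ideal scaleA = fvs.span {ftensor (us @ [p] @ vs) | us p vs. p \<in> multilin_rels scaleA}"

definition word_degree :: "'b tree list \<Rightarrow> nat" where
  "word_degree w = sum_list (map weight w)"

fun word_diff :: "'a::{ring,monoid_mult} tree list \<Rightarrow> ('a tree list \<Rightarrow>\<^sub>0 'k::field)" where
  "word_diff [] = 0"
| "word_diff (t # w) =
     wmult (lin (\<lambda>u. Poly_Mapping.single [u] 1) (bar_diff t) - cobar_diff t)
       (Poly_Mapping.single w 1)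
     + fscale ((-1) ^ weight t) (wmult (Poly_Mapping.single [t] 1) (word_diff w))"

definition resolution_words :: "('a tree list \<Rightarrow>\<^sub>0 'k::field) set" where
  "resolution_words = fvs.span {ftensor ps | ps. set ps \<subseteq> bar_gens}"

definition resolution ::
  "('k::field \<Rightarrow> 'a::{ring,monoid_mult} \<Rightarrow> 'a) \<Rightarrow> ('k, ('a tree list \<Rightarrow>\<^sub>0 'k) set) dga" where
  "resolution scaleA = dgvs.extend
     (quotient_dgvs resolution_words (word_ideal scaleA)
       (\<lambda>n. {p \<in> resolution_words. \<forall>w\<in>Poly_Mapping.keys p. word_degree w = n})
       (lin word_diff))
     \<lparr>amult = qlift2 (word_ideal scaleA) wmult,
      aone = cls (word_ideal scaleA) (Poly_Mapping.single [] 1),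
      ainv = qlift (word_ideal scaleA) (lin (\<lambda>w. Poly_Mapping.single w ((-1) ^ word_degree w)))\<rparr>"

text \<open>
  The map \<open>Q \<rightarrow> A\<close> projects trees onto \<open>I(A) = A\<close> and multiplies out words. It is constant
  on cosets of \<open>word_ideal\<close>, so its value is the only element of the image of a coset.
\<close>

fun word_aug :: "'a::{ring,monoid_mult} tree list \<Rightarrow> 'a" where
  "word_aug [] = 1"
| "word_aug (t # w) = (case t of Leaf a \<Rightarrow> a | _ \<Rightarrow> 0) * word_aug w"

definition resolution_aug ::
  "('k::field \<Rightarrow> 'a::{ring,monoid_mult} \<Rightarrow> 'a) \<Rightarrow> ('a tree list \<Rightarrow>\<^sub>0 'k) set \<Rightarrow> 'a" where
  "resolution_aug scaleA X = the_elem
     ((\<lambda>p. \<Sum>w\<in>Poly_Mapping.keys p. scaleA (Poly_Mapping.lookup p w) (word_aug w)) ` X)"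


section \<open>Noncommutative Kaehler differentials and the cotangent complex\<close>

abbreviation (input) triple :: "'x \<Rightarrow> 'y \<Rightarrow> 'z \<Rightarrow> ('x \<times> 'y \<times> 'z \<Rightarrow>\<^sub>0 'k::field)" where
  "triple x y z \<equiv> Poly_Mapping.single (x, y, z) 1"

definition trilin_rels ::
  "('k::field, 'x, 'e) vs_scheme \<Rightarrow> ('k, 'y, 'f) vs_scheme \<Rightarrow> ('k, 'z, 'g) vs_scheme \<Rightarrow>
   ('x \<times> 'y \<times> 'z \<Rightarrow>\<^sub>0 'k) set" where
  "trilin_rels X Y Z =
     {triple (vadd X x x') y z - triple x y z - triple x' y z | x x' y z.
        x \<in> vcar X \<and> x' \<in> vcar X \<and> y \<in> vcar Y \<and> z \<in> vcar Z}
   \<union> {triple x (vadd Y y y') z - triple x y z - triple x y' z | x y y' z.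
        x \<in> vcar X \<and> y \<in> vcar Y \<and> y' \<in> vcar Y \<and> z \<in> vcar Z}
   \<union> {triple x y (vadd Z z z') - triple x y z - triple x y z' | x y z z'.
        x \<in> vcar X \<and> y \<in> vcar Y \<and> z \<in> vcar Z \<and> z' \<in> vcar Z}
   \<union> {triple (vsmul X c x) y z - fscale c (triple x y z) | c x y z.
        x \<in> vcar X \<and> y \<in> vcar Y \<and> z \<in> vcar Z}
   \<union> {triple x (vsmul Y c y) z - fscale c (triple x y z) | c x y z.
        x \<in> vcar X \<and> y \<in> vcar Y \<and> z \<in> vcar Z}
   \<union> {triple x y (vsmul Z c z) - fscale c (triple x y z) | c x y z.
        x \<in> vcar X \<and> y \<in> vcar Y \<and> z \<in> vcar Z}"

text \<open>
  The bimodule of noncommutative Kaehler differentials of a dg algebra \<open>Q\<close>: the triple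
  \<open>(x, y, z)\<close> stands for \<open>x dy z\<close>, and the relations are trilinearity and
  \<open>x d(y y') z = x dy (y' z) + (x y) dy' z\<close>.
\<close>

definition kaehler_rels :: "('k::field, 'q) dga \<Rightarrow> ('q \<times> 'q \<times> 'q \<Rightarrow>\<^sub>0 'k) set" where
  "kaehler_rels Q = fvs.span (trilin_rels Q Q Q
     \<union> {triple x (amult Q y y') z - triple x y (amult Q y' z) - triple (amult Q x y) y' z
        | x y y' z. x \<in> vcar Q \<and> y \<in> vcar Q \<and> y' \<in> vcar Q \<and> z \<in> vcar Q})"

definition kaehler :: "('k::field, 'q) dga \<Rightarrow> ('k, 'q, ('q \<times> 'q \<times> 'q \<Rightarrow>\<^sub>0 'k) set) dgbimod" where
  "kaehler Q = dgvs.extend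
     (quotient_dgvs
       (fvs.span {triple x y z | x y z. x \<in> vcar Q \<and> y \<in> vcar Q \<and> z \<in> vcar Q})
       (kaehler_rels Q)
       (\<lambda>n. fvs.span {triple x y z | x y z i j k.
          x \<in> hcomp Q i \<and> y \<in> hcomp Q j \<and> z \<in> hcomp Q k \<and> i + j + k = n})
       (lin (\<lambda>(x, y, z). triple (vdiff Q x) y z + triple (ainv Q x) (vdiff Q y) z
          + triple (ainv Q x) (ainv Q y) (vdiff Q z))))
     \<lparr>lact = (\<lambda>q. qlift (kaehler_rels Q) (lin (\<lambda>(x, y, z). triple (amult Q q x) y z))),
      ract = (\<lambda>\<omega> q. qlift (kaehler_rels Q) (lin (\<lambda>(x, y, z). triple x y (amult Q z q))) \<omega>)\<rparr>"

text \<open>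
  The base change \<open>A \<otimes>\<^bsub>Q\<^esub> W \<otimes>\<^bsub>Q\<^esub> A\<close> of a dg \<open>Q\<close>-bimodule \<open>W\<close> along \<open>\<epsilon> : Q \<rightarrow> A\<close>,
  for \<open>A\<close> concentrated in degree 0.
\<close>

definition base_change_rels ::
  "('k::field \<Rightarrow> 'a::{ring,monoid_mult} \<Rightarrow> 'a) \<Rightarrow> ('k, 'q) dga \<Rightarrow> ('q \<Rightarrow> 'a) \<Rightarrow>
   ('k, 'q, 'w) dgbimod \<Rightarrow> ('a \<times> 'w \<times> 'a \<Rightarrow>\<^sub>0 'k) set" where
  "base_change_rels scaleA Q \<epsilon> W =
     (let A = \<lparr>vcar = UNIV, vadd = (+), vsmul = scaleA\<rparr> in
      fvs.span (trilin_rels A W A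
        \<union> {triple (a * \<epsilon> q) \<omega> b - triple a (lact W q \<omega>) b | a q \<omega> b.
             q \<in> vcar Q \<and> \<omega> \<in> vcar W}
        \<union> {triple a (ract W \<omega> q) b - triple a \<omega> (\<epsilon> q * b) | a q \<omega> b.
             q \<in> vcar Q \<and> \<omega> \<in> vcar W}))"

definition base_change ::
  "('k::field \<Rightarrow> 'a::{ring,monoid_mult} \<Rightarrow> 'a) \<Rightarrow> ('k, 'q) dga \<Rightarrow> ('q \<Rightarrow> 'a) \<Rightarrow>
   ('k, 'q, 'w) dgbimod \<Rightarrow> ('k, 'a, ('a \<times> 'w \<times> 'a \<Rightarrow>\<^sub>0 'k) set) dgbimod" where
  "base_change scaleA Q \<epsilon> W =
     (let N = base_change_rels scaleA Q \<epsilon> W in dgvs.extend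
       (quotient_dgvs
         (fvs.span {triple a \<omega> b | a \<omega> b. \<omega> \<in> vcar W}) N
         (\<lambda>n. fvs.span {triple a \<omega> b | a \<omega> b. \<omega> \<in> hcomp W n})
         (lin (\<lambda>(a, \<omega>, b). triple a (vdiff W \<omega>) b)))
       \<lparr>lact = (\<lambda>a'. qlift N (lin (\<lambda>(a, \<omega>, b). triple (a' * a) \<omega> b))),
        ract = (\<lambda>x b'. qlift N (lin (\<lambda>(a, \<omega>, b). triple a \<omega> (b * b'))) x)\<rparr>)"

definition cotangent_complex where
  "cotangent_complex scaleA =
     base_change scaleA (resolution scaleA) (resolution_aug scaleA) (kaehler (resolution scaleA))"


section \<open>Andre-Quillen cohomology\<close>

text \<open>
  Bimodule maps of homological degree \<open>-k\<close> from a dg \<open>A\<close>-bimodule \<open>B\<close> to a bimodule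
  concentrated in degree 0, extended by zero outside the carrier of \<open>B\<close>.
\<close>

definition bimod_hom ::
  "('k, 'a, 'v) dgbimod \<Rightarrow> ('k \<Rightarrow> 'm \<Rightarrow> 'm) \<Rightarrow> ('a \<Rightarrow> 'm \<Rightarrow> 'm) \<Rightarrow> ('m \<Rightarrow> 'a \<Rightarrow> 'm) \<Rightarrow> nat \<Rightarrow>
   ('v \<Rightarrow> 'm::ab_group_add) set" where
  "bimod_hom B scaleM l r k = {f.
     (\<forall>x. x \<notin> vcar B \<longrightarrow> f x = 0) \<and>
     (\<forall>x\<in>vcar B. \<forall>y\<in>vcar B. f (vadd B x y) = f x + f y) \<and>
     (\<forall>c. \<forall>x\<in>vcar B. f (vsmul B c x) = scaleM c (f x)) \<and>
     (\<forall>a. \<forall>x\<in>vcar B. f (lact B a x) = l a (f x)) \<and>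
     (\<forall>a. \<forall>x\<in>vcar B. f (ract B x a) = r (f x) a) \<and>
     (\<forall>j. j \<noteq> k \<longrightarrow> (\<forall>x\<in>hcomp B j. f x = 0))}"

text \<open>\<open>\<partial>f = - (-1)^|f| f \<circ> d\<close>, the target having zero differential.\<close>

definition bimod_hom_diff ::
  "('k::field, 'a, 'v) dgbimod \<Rightarrow> ('k \<Rightarrow> 'm \<Rightarrow> 'm) \<Rightarrow> nat \<Rightarrow> ('v \<Rightarrow> 'm::ab_group_add) \<Rightarrow> 'v \<Rightarrow> 'm" where
  "bimod_hom_diff B scaleM k f x =
     (if x \<in> vcar B then scaleM (- ((-1) ^ k)) (f (vdiff B x)) else 0)"

definition AQ_cohomology where
  "AQ_cohomology scaleA scaleM l r k =
     cohomology (\<lambda>c f x. scaleM c (f x))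
       (bimod_hom (cotangent_complex scaleA) scaleM l r)
       (bimod_hom_diff (cotangent_complex scaleA) scaleM) k"

end

theory Submission
  imports Defs
begin

text \<open>
  The argument computes everything explicitly in terms of words. A word has letters in
  \<open>A\<close> and a further letter, the cork, which stands for the nullary generator; it is a list
  over \<open>'a option\<close>, with \<open>None\<close> as the cork.

  The Koszul dual cooperad. Record of a tree only the word of its leaves and corks. An element
  of a cooperad whose two-vertex part consists of quadratic relations has, by the
  associativity relation, coefficients that change by a fixed sign under the rotation
  \<open>(a b) c \<leadsto> a (b c)\<close> at the root; the slices of its decomposition lie in the cooperad
  again, so the same holds below the root. Rotations connect all trees with a given word, hence
  the element is a combination of the signed sums \<open>corolla w\<close> of all trees with word \<open>w\<close>.
  Conversely these sums span a cooperad of the required kind, because the decomposition of a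
  corolla is the signed sum over all ways of cutting its word into blocks. This gives
  \<open>uAs_dual_eq\<close>; the bar construction on \<open>A\<close> is spanned by the corollas of words with letters in \<open>A\<close>.

  The complex. The bar differential of a corolla is the signed sum of the corollas of the
  faces of its word: two adjacent letters of \<open>A\<close> are multiplied, or a cork is replaced by
  \<open>1\<close> (\<open>bar_diff_corolla\<close>). The cobar differential cuts the word in two
  (\<open>cobar_diff_corolla\<close>). Bimodule maps from the cotangent complex to \<open>M\<close> are the same
  as derivations of the resolution, and such a derivation is determined by arbitrary
  multilinear values on the words. In this way the complex becomes the complex of multilinear
  functions on nonempty words, a word having degree (length - 1) + (number of corks), with
  coboundary \<open>word_coboundary\<close>.

  The comparison. On words without corks \<open>word_coboundary\<close> is, up to sign, the Hochschild
  coboundary, and such a word of degree \<open>k\<close> has \<open>k + 1\<close> letters. Restriction to these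
  words is therefore a surjective cochain map onto the Hochschild complex without its term in
  degree 0, and for \<open>k \<ge> 1\<close> that term does not enter \<open>HH^(k+1)\<close>. Its kernel is
  exact: inserting \<open>1\<close> in front of the first cork contracts it up to terms with fewer
  corks, so that induction on the number of corks applies (\<open>cork_free_kernel_exact\<close>). The
  induction needs that \<open>word_coboundary\<close> squares to zero. The faces alone do not give a
  differential: their square consists of two boundary terms, which reflect the curvature
  \<open>\<theta>\<close> and which the two outer actions on \<open>M\<close> cancel.
\<close>

section \<open>Linear extension from a basis\<close>

abbreviation (input) bas :: "'x \<Rightarrow> ('x \<Rightarrow>\<^sub>0 'k::field)" where
  "bas x \<equiv> Poly_Mapping.single x 1"

text \<open>
  The linear map with prescribed values on the basis of a free vector space, with values in a
  space that need not be free; \<open>lin\<close> is the case of a free target.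
\<close>

definition lext :: "('k::field \<Rightarrow> 'm::ab_group_add \<Rightarrow> 'm) \<Rightarrow> ('x \<Rightarrow> 'm) \<Rightarrow> ('x \<Rightarrow>\<^sub>0 'k) \<Rightarrow> 'm" where
  "lext s f p = (\<Sum>x\<in>Poly_Mapping.keys p. s (Poly_Mapping.lookup p x) (f x))"

lemma lin_eq_lext: "lin = lext fscale"
  by (simp add: fun_eq_iff lin_def lext_def)

lemma fscale_single: "fscale c (Poly_Mapping.single x b) = Poly_Mapping.single x (c * b)"
  by (rule poly_mapping_eqI) (simp add: lookup_fscale lookup_single when_def)

lemma fscale_bas: "fscale c (bas x) = Poly_Mapping.single x c"
  by (simp add: fscale_single)

lemma span_bas: "p \<in> fvs.span (range (\<lambda>x. bas x))"
proof -
  have "p = (\<Sum>x\<in>Poly_Mapping.keys p. fscale (Poly_Mapping.lookup p x) (bas x))"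
    by (rule poly_mapping_eqI)
      (simp add: lookup_sum lookup_fscale lookup_single when_def in_keys_iff if_distrib
        cong: if_cong)
  also have "\<dots> \<in> fvs.span (range (\<lambda>x. bas x))"
    by (intro fvs.span_sum fvs.span_scale fvs.span_base) auto
  finally show ?thesis .
qed

lemma basis_induct [case_names single add]:
  assumes "\<And>c x. P (fscale c (bas x))" "\<And>p q. P p \<Longrightarrow> P q \<Longrightarrow> P (p + q)"
  shows "P p"
  using span_bas[of p]
proof (induction rule: fvs.span_induct_alt)
  case base
  show ?case using assms(1)[of 0 undefined] by simp
next
  case (step c x y)
  then show ?case using assms by auto
qed

lemma basis_induct2 [case_names single left right]:
  assumes "\<And>c d x y. P (fscale c (bas x)) (fscale d (bas y))"
    and "\<And>p p' q. P p q \<Longrightarrow> P p' q \<Longrightarrow> P (p + p') q"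
    and "\<And>p q q'. P p q \<Longrightarrow> P p q' \<Longrightarrow> P p (q + q')"
  shows "P p q"
proof (induction p rule: basis_induct)
  case (single c x)
  show ?case by (induction q rule: basis_induct) (use assms in auto)
qed (use assms in auto)

lemma fscale_hom: "module_hom fscale fscale (fscale c)"
  by unfold_locales (simp_all add: fvs.scale_right_distrib mult.commute)

context vector_space
begin

lemma lext_superset:
  assumes "finite S" "Poly_Mapping.keys p \<subseteq> S"
  shows "lext scale f p = (\<Sum>x\<in>S. scale (Poly_Mapping.lookup p x) (f x))"
  unfolding lext_def using assms by (intro sum.mono_neutral_left) (auto simp: in_keys_iff)

lemma lext_hom: "module_hom fscale scale (lext scale f)"
proof
  fix p q :: "'c \<Rightarrow>\<^sub>0 'a" and c
  let ?S = "Poly_Mapping.keys p \<union> Poly_Mapping.keys q"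
  have "Poly_Mapping.keys (p + q) \<subseteq> ?S" by (rule keys_add)
  then show "lext scale f (p + q) = lext scale f p + lext scale f q"
    by (simp add: lext_superset[of ?S] lookup_add scale_left_distrib sum.distrib)
  have "Poly_Mapping.keys (fscale c p) \<subseteq> Poly_Mapping.keys p"
    by (auto simp: in_keys_iff lookup_fscale)
  then show "lext scale f (fscale c p) = scale c (lext scale f p)"
    by (simp add: lext_superset[of "Poly_Mapping.keys p"] lookup_fscale scale_sum_right)
qed

lemmas lext_add = module_hom.add[OF lext_hom]
  and lext_scale = module_hom.scale[OF lext_hom]
  and lext_zero = module_hom.zero[OF lext_hom]
  and lext_diff = module_hom.diff[OF lext_hom]
  and lext_neg = module_hom.neg[OF lext_hom]
  and lext_sum = module_hom.sum[OF lext_hom]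

lemma lext_single: "lext scale f (Poly_Mapping.single x c) = scale c (f x)"
  by (subst lext_superset[of "{x}"]) auto

lemma lext_bas: "lext scale f (bas x) = f x"
  by (simp add: lext_single)

lemma hom_eq_on_basis:
  assumes "module_hom fscale scale f" "module_hom fscale scale g" "\<And>x. f (bas x) = g (bas x)"
  shows "f p = g p"
  by (induction p rule: basis_induct)
    (simp_all add: assms(3) module_hom.add[OF assms(1)] module_hom.add[OF assms(2)]
      module_hom.scale[OF assms(1)] module_hom.scale[OF assms(2)] del: fscale_bas)

lemma lext_add_fun: "lext scale (\<lambda>x. f x + g x) p = lext scale f p + lext scale g p"
  by (simp add: lext_def scale_right_distrib sum.distrib)

lemma lext_scale_fun: "lext scale (\<lambda>x. scale c (f x)) p = scale c (lext scale f p)"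
  by (simp add: lext_def scale_sum_right mult.commute)

lemma lext_diff_fun: "lext scale (\<lambda>x. f x - g x) p = lext scale f p - lext scale g p"
  by (simp add: lext_def scale_right_diff_distrib sum_subtractf)

lemma lext_zero_fun: "lext scale (\<lambda>x. 0) p = 0"
  by (simp add: lext_def)

lemma hom_span_subset:
  assumes "module_hom s scale f" "f ` S \<subseteq> T" "subspace T" "x \<in> module.span s S"
  shows "f x \<in> T"
proof -
  have "f ` module.span s S = span (f ` S)"
    by (rule module_hom.span_image[OF assms(1), symmetric])
  also have "\<dots> \<subseteq> T" by (rule span_minimal) (use assms in auto)
  finally show ?thesis using assms(4) by auto
qed

end

lemmas lin_hom = fvs.lext_hom[folded lin_eq_lext]
  and lin_add = fvs.lext_add[folded lin_eq_lext]
  and lin_scale = fvs.lext_scale[folded lin_eq_lext]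
  and lin_zero = fvs.lext_zero[folded lin_eq_lext]
  and lin_diff = fvs.lext_diff[folded lin_eq_lext]
  and lin_neg = fvs.lext_neg[folded lin_eq_lext]
  and lin_bas = fvs.lext_bas[folded lin_eq_lext]
  and lin_add_fun = fvs.lext_add_fun[folded lin_eq_lext]
  and lin_scale_fun = fvs.lext_scale_fun[folded lin_eq_lext]
  and lin_diff_fun = fvs.lext_diff_fun[folded lin_eq_lext]
  and lin_zero_fun = fvs.lext_zero_fun[folded lin_eq_lext]

lemmas lin_simps = lin_add lin_scale lin_zero lin_diff lin_neg lin_bas

lemma lookup_lin:
  "Poly_Mapping.lookup (lin f p) y
    = (\<Sum>x\<in>Poly_Mapping.keys p. Poly_Mapping.lookup p x * Poly_Mapping.lookup (f x) y)"
  by (simp add: lin_def lookup_sum lookup_fscale)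

lemma bilin_hom_left: "module_hom fscale fscale (\<lambda>p. bilin f p q)"
  unfolding bilin_def by (rule lin_hom)

lemma bilin_hom_right: "module_hom fscale fscale (\<lambda>q. bilin f p q)"
  by unfold_locales
    (simp_all add: bilin_def lin_add lin_scale lin_add_fun lin_scale_fun)

lemmas bilin_simps = module_hom.add[OF bilin_hom_left] module_hom.add[OF bilin_hom_right]
  module_hom.scale[OF bilin_hom_left] module_hom.scale[OF bilin_hom_right]
  module_hom.zero[OF bilin_hom_left] module_hom.zero[OF bilin_hom_right]
  module_hom.diff[OF bilin_hom_left] module_hom.diff[OF bilin_hom_right]
  module_hom.neg[OF bilin_hom_left] module_hom.neg[OF bilin_hom_right]

lemma bilin_bas: "bilin f (bas x) (bas y) = f x y"
  by (simp add: bilin_def lin_bas)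

lemma lookup_bilin:
  "Poly_Mapping.lookup (bilin f p q) z
    = (\<Sum>x\<in>Poly_Mapping.keys p. \<Sum>y\<in>Poly_Mapping.keys q.
        Poly_Mapping.lookup p x * Poly_Mapping.lookup q y * Poly_Mapping.lookup (f x y) z)"
  by (simp add: bilin_def lookup_lin sum_distrib_left mult.assoc)

lemma hom_compose:
  "module_hom s1 s2 f \<Longrightarrow> module_hom s2 s3 g \<Longrightarrow> module_hom s1 s3 (\<lambda>x. g (f x))"
  using module_hom_compose[of s1 s2 f s3 g] by (simp add: o_def)

text \<open>
  Congruences modulo a subspace become equations after applying a linear map with that kernel.
  This turns the verification that an operation respects a subspace of relations into a
  rewriting problem. The map is the projection along the subspace onto a complement.
\<close>

lemma subspace_is_kernel:
  fixes N :: "('x \<Rightarrow>\<^sub>0 'k::field) set"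
  assumes "fvs.subspace N"
  obtains \<pi> :: "('x \<Rightarrow>\<^sub>0 'k) \<Rightarrow> ('x \<Rightarrow>\<^sub>0 'k)"
  where "module_hom fscale fscale \<pi>" "\<And>p. \<pi> p = 0 \<longleftrightarrow> p \<in> N"
proof -
  interpret vp: vector_space_pair "fscale :: 'k \<Rightarrow> ('x \<Rightarrow>\<^sub>0 'k) \<Rightarrow> _"
      "fscale :: 'k \<Rightarrow> ('x \<Rightarrow>\<^sub>0 'k) \<Rightarrow> _"
    by unfold_locales
  obtain B where B: "B \<subseteq> N" "fvs.independent B" "N \<subseteq> fvs.span B"
    using fvs.basis_exists[of N] by metis
  define C where "C = fvs.extend_basis B"
  have C: "B \<subseteq> C" "fvs.independent C" "fvs.span C = UNIV"
    using fvs.extend_basis_superset[OF B(2)] fvs.independent_extend_basis[OF B(2)]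
      fvs.span_extend_basis[OF B(2)] by (auto simp: C_def)
  define \<pi> where "\<pi> = vp.construct C (\<lambda>b. if b \<in> B then 0 else b)"
  have lin: "Vector_Spaces.linear fscale fscale \<pi>"
    unfolding \<pi>_def by (rule vp.linear_construct[OF C(2)])
  then have hom: "module_hom fscale fscale \<pi>"
    by (simp add: module_hom_iff_linear)
  have bas: "\<pi> b = (if b \<in> B then 0 else b)" if "b \<in> C" for b
    unfolding \<pi>_def using vp.construct_basis[OF C(2) that] .
  have spanB: "fvs.span B = N"
    using B assms by (metis fvs.span_minimal subset_antisym)
  have ker: "\<pi> p = 0" if "p \<in> N" for p
  proof -
    have "\<pi> p \<in> {0}"
      by (rule fvs.hom_span_subset[OF hom, of B]) (use bas C that spanB in auto)
    then show ?thesis by simp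
  qed
  have mod: "p - \<pi> p \<in> N" for p
  proof -
    have h: "module_hom fscale fscale (\<lambda>p. p - \<pi> p)"
      by unfold_locales
        (simp_all add: module_hom.add[OF hom] module_hom.scale[OF hom] fvs.scale_right_diff_distrib)
    have "(\<lambda>p. p - \<pi> p) ` C \<subseteq> N"
      using bas B(1) fvs.subspace_0[OF assms] by auto
    then show ?thesis
      by (rule fvs.hom_span_subset[OF h _ assms, of C]) (simp add: C)
  qed
  have "p \<in> N" if "\<pi> p = 0" for p using mod[of p] that by simp
  then show ?thesis using ker hom that by blast
qed

section \<open>Cosets and quotient spaces\<close>

context vector_space
begin

lemma cls_eq_iff: "subspace N \<Longrightarrow> cls N x = cls N y \<longleftrightarrow> x - y \<in> N"
proof
  assume N: "subspace N" "cls N x = cls N y"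
  have "x \<in> cls N x" using subspace_0[OF N(1)] by (simp add: cls_def)
  then have "x \<in> cls N y" using N(2) by simp
  then show "x - y \<in> N" by (simp add: cls_def)
next
  assume N: "subspace N" "x - y \<in> N"
  have "z - x \<in> N \<longleftrightarrow> z - y \<in> N" for z
    using subspace_add[OF N(1) _ N(2), of "z - x"] subspace_diff[OF N(1) _ N(2), of "z - y"]
    by auto
  then show "cls N x = cls N y" by (auto simp: cls_def)
qed

lemma cls_self: "subspace N \<Longrightarrow> x \<in> cls N x"
  using subspace_0 by (simp add: cls_def)

lemma qlift_cls:
  assumes "subspace N" and f: "\<And>x y. f (x + y) = f x + f y" and "\<And>x. x \<in> N \<Longrightarrow> f x \<in> N"
  shows "qlift N f (cls N x) = cls N (f x)"
proof -
  have "cls N (f y) = cls N (f x)" if "y \<in> cls N x" for y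
  proof -
    have "f y = f (y - x) + f x" using f[of "y - x" x] by simp
    then have "f y - f x \<in> N" using assms(3)[of "y - x"] that by (simp add: cls_def)
    then show ?thesis using cls_eq_iff[OF assms(1)] by blast
  qed
  then show ?thesis
    using cls_self[OF assms(1), of x] unfolding qlift_def by blast
qed

lemma qlift2_cls:
  assumes N: "subspace N"
    and f: "\<And>x x' y. f (x + x') y = f x y + f x' y" "\<And>x y y'. f x (y + y') = f x y + f x y'"
    and "\<And>x y. x \<in> N \<Longrightarrow> f x y \<in> N" "\<And>x y. y \<in> N \<Longrightarrow> f x y \<in> N"
  shows "qlift2 N f (cls N x) (cls N y) = cls N (f x y)"
proof -
  have "cls N (f x' y') = cls N (f x y)" if "x' \<in> cls N x" "y' \<in> cls N y" for x' y'
  proof -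
    have "f x' y' = f (x' - x) y' + f x (y' - y) + f x y"
      using f(1)[of "x' - x" x y'] f(2)[of x "y' - y" y] by simp
    then have "f x' y' - f x y \<in> N"
      using assms(4)[of "x' - x" y'] assms(5)[of "y' - y" x] that subspace_add[OF N]
      by (simp add: cls_def)
    then show ?thesis using cls_eq_iff[OF N] by blast
  qed
  then show ?thesis
    using cls_self[OF N, of x] cls_self[OF N, of y] unfolding qlift2_def by blast
qed

lemma qlift2_plus: "subspace N \<Longrightarrow> qlift2 N (+) (cls N x) (cls N y) = cls N (x + y)"
proof -
  assume N: "subspace N"
  have "cls N (x' + y') = cls N (x + y)" if "x' \<in> cls N x" "y' \<in> cls N y" for x' y'
  proof -
    have "(x' + y') - (x + y) = (x' - x) + (y' - y)" by simp
    then show ?thesis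
      using that subspace_add[OF N] cls_eq_iff[OF N] by (metis cls_def mem_Collect_eq)
  qed
  then show ?thesis
    using cls_self[OF N, of x] cls_self[OF N, of y] unfolding qlift2_def by blast
qed

lemma qlift_scale: "subspace N \<Longrightarrow> qlift N (scale c) (cls N x) = cls N (scale c x)"
  by (rule qlift_cls) (auto simp: scale_right_distrib subspace_scale)

text \<open>
  A linear map induces an isomorphism of quotients as soon as it detects the subspace divided
  out and is surjective modulo the target's. It is applied to cocycles modulo coboundaries.
\<close>

lemma quotient_iso:
  assumes M': "vector_space s'"
    and N: "subspace N" "module.subspace s' N'" and U: "subspace U"
    and add: "\<And>x y. x \<in> U \<Longrightarrow> y \<in> U \<Longrightarrow> \<rho> (x + y) = \<rho> x + \<rho> y"
    and scl: "\<And>c x. x \<in> U \<Longrightarrow> \<rho> (scale c x) = s' c (\<rho> x)"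
    and into: "\<And>x. x \<in> U \<Longrightarrow> \<rho> x \<in> U'"
    and ker: "\<And>x. x \<in> U \<Longrightarrow> \<rho> x \<in> N' \<longleftrightarrow> x \<in> N"
    and sur: "\<And>y. y \<in> U' \<Longrightarrow> \<exists>x\<in>U. \<rho> x - y \<in> N'"
  shows "vs_isomorphic (quotient_vs scale U N) (quotient_vs s' U' N')"
proof -
  interpret W: vector_space s' by (rule M')
  have diff: "\<rho> (x - y) = \<rho> x - \<rho> y" if "x \<in> U" "y \<in> U" for x y
    using add[of "x - y" y] that subspace_diff[OF U] by simp
  have eq: "cls N x = cls N y \<longleftrightarrow> cls N' (\<rho> x) = cls N' (\<rho> y)" if "x \<in> U" "y \<in> U" for x y
    using that ker[of "x - y"] diff subspace_diff[OF U]
    by (simp add: cls_eq_iff[OF N(1)] W.cls_eq_iff[OF N(2)])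
  define \<Phi> where "\<Phi> X = cls N' (\<rho> (SOME x. x \<in> U \<and> X = cls N x))" for X
  have \<Phi>: "\<Phi> (cls N x) = cls N' (\<rho> x)" if "x \<in> U" for x
  proof -
    define y where "y = (SOME y. y \<in> U \<and> cls N x = cls N y)"
    have "y \<in> U \<and> cls N x = cls N y"
      unfolding y_def by (rule someI[of _ x]) (use that in auto)
    then have "cls N' (\<rho> y) = cls N' (\<rho> x)" using eq[of x y] that by blast
    then show ?thesis by (simp only: \<Phi>_def y_def)
  qed
  have "bij_betw \<Phi> (cls N ` U) (cls N' ` U')"
  proof (rule bij_betw_imageI)
    show "inj_on \<Phi> (cls N ` U)"
      using eq by (fastforce simp: inj_on_def \<Phi>)
    show "\<Phi> ` cls N ` U = cls N' ` U'"
    proof (intro set_eqI iffI)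
      fix Y assume "Y \<in> cls N' ` U'"
      then obtain y where y: "y \<in> U'" "Y = cls N' y" by auto
      then obtain x where x: "x \<in> U" "\<rho> x - y \<in> N'" using sur by blast
      then have "Y = \<Phi> (cls N x)" using y using W.cls_eq_iff[OF N(2), of "\<rho> x" y] by (simp add: \<Phi>)
      then show "Y \<in> \<Phi> ` cls N ` U" using x by auto
    qed (auto simp: \<Phi> into)
  qed
  moreover have "\<Phi> (qlift2 N (+) (cls N x) (cls N y)) = qlift2 N' (+) (\<Phi> (cls N x)) (\<Phi> (cls N y))"
    if "x \<in> U" "y \<in> U" for x y
    by (simp only: qlift2_plus[OF N(1)] W.qlift2_plus[OF N(2)] \<Phi> that subspace_add[OF U] add)
  moreover have "\<Phi> (qlift N (scale c) (cls N x)) = qlift N' (s' c) (\<Phi> (cls N x))"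
    if "x \<in> U" for c x
    by (simp only: qlift_scale[OF N(1)] W.qlift_scale[OF N(2)] \<Phi> that subspace_scale[OF U] scl)
  ultimately show ?thesis
    unfolding vs_isomorphic_def quotient_vs_def by (intro exI[of _ \<Phi>]) simp
qed

end

section \<open>Coefficients of multilinear extensions\<close>

lemma lookup_lin_at:
  assumes "\<And>x. x \<in> Poly_Mapping.keys p \<Longrightarrow>
    Poly_Mapping.lookup (f x) y = (if x = a then c else 0)"
  shows "Poly_Mapping.lookup (lin f p) y = Poly_Mapping.lookup p a * c"
proof -
  have "Poly_Mapping.lookup (lin f p) y
      = (\<Sum>x\<in>Poly_Mapping.keys p. if x = a then Poly_Mapping.lookup p a * c else 0)"
    unfolding lookup_lin by (rule sum.cong) (auto simp: assms)
  then show ?thesis by (simp add: in_keys_iff)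
qed

lemma lookup_bilin_at:
  assumes "\<And>x x'. x \<in> Poly_Mapping.keys p \<Longrightarrow> x' \<in> Poly_Mapping.keys q \<Longrightarrow>
    Poly_Mapping.lookup (f x x') y = (if x = a \<and> x' = b then c else 0)"
  shows "Poly_Mapping.lookup (bilin f p q) y = Poly_Mapping.lookup p a * Poly_Mapping.lookup q b * c"
proof -
  have "Poly_Mapping.lookup (lin (f x) q) y
      = (if x = a then Poly_Mapping.lookup q b * c else 0)" if "x \<in> Poly_Mapping.keys p" for x
  proof (cases "x = a")
    case True
    then show ?thesis using lookup_lin_at[of q "f x" y b c] assms[OF that] by simp
  next
    case False
    then show ?thesis using lookup_lin_at[of q "f x" y b 0] assms[OF that] by simp
  qed
  then show ?thesis unfolding bilin_def by (subst lookup_lin_at) (auto simp: mult.assoc)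
qed

lemma lookup_ftensor:
  "Poly_Mapping.lookup (ftensor ps) xs
    = (if length xs = length ps then prod_list (map2 Poly_Mapping.lookup ps xs) else 0)"
proof (induction ps arbitrary: xs)
  case Nil
  then show ?case by (auto simp: lookup_single when_def)
next
  case (Cons p ps)
  show ?case
  proof (cases xs)
    case Nil
    have "Poly_Mapping.lookup (ftensor (p # ps)) xs = Poly_Mapping.lookup p undefined * Poly_Mapping.lookup (ftensor ps) [] * 0"
      unfolding ftensor.simps by (rule lookup_bilin_at) (simp add: lookup_single Nil)
    then show ?thesis using Nil by simp
  next
    case (Cons y ys)
    have "Poly_Mapping.lookup (ftensor (p # ps)) xs = Poly_Mapping.lookup p y * Poly_Mapping.lookup (ftensor ps) ys * 1"
      unfolding ftensor.simps by (rule lookup_bilin_at) (auto simp: lookup_single Cons when_def)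
    then show ?thesis using Cons Cons.IH by simp
  qed
qed

section \<open>Trees and their words\<close>

fun tree_word :: "'b tree \<Rightarrow> 'b option list" where
  "tree_word (Leaf b) = [Some b]"
| "tree_word Bullet = [None]"
| "tree_word (Mu s t) = tree_word s @ tree_word t"

text \<open>
  The sign of a tree in its corolla. It is the solution of the sign rule for rotations:
  \<open>Mu (Mu a b) c\<close> and \<open>Mu a (Mu b c)\<close> have signs that differ by \<open>-(-1)^(weight a)\<close>,
  which is the rule imposed by associativity once each vertex has degree 1.
\<close>

fun tree_sign :: "'b tree \<Rightarrow> 'k::field" where
  "tree_sign (Leaf b) = 1"
| "tree_sign Bullet = 1"
| "tree_sign (Mu s t) = (-1) ^ weight s * tree_sign s * tree_sign t"

text \<open>
  With these degrees of letters, the weight of a tree is one less than the degree of its word: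
  each letter is counted once for the binary vertices that join it to the rest, and a cork a
  second time for its own vertex.
\<close>

fun ldeg :: "'b option \<Rightarrow> nat" where
  "ldeg None = 2"
| "ldeg (Some b) = 1"

definition wdeg :: "'b option list \<Rightarrow> nat" where
  "wdeg w = sum_list (map ldeg w)"

lemma wdeg_simps [simp]: "wdeg [] = 0" "wdeg (x # w) = ldeg x + wdeg w" "wdeg (u @ v) = wdeg u + wdeg v"
  by (simp_all add: wdeg_def)

lemma ldeg_pos [simp]: "ldeg x \<noteq> 0" "0 < ldeg x"
  by (cases x; simp)+

fun somes :: "'b option list \<Rightarrow> 'b list" where
  "somes [] = []"
| "somes (Some b # w) = b # somes w"
| "somes (None # w) = somes w"

lemma somes_append [simp]: "somes (u @ v) = somes u @ somes v"
  by (induction u rule: somes.induct) auto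

lemma tree_word_nonempty [simp]: "tree_word t \<noteq> []"
  by (induction t) auto

lemma length_tree_word_pos: "0 < length (tree_word t)"
  by simp

lemma wdeg_tree_word: "wdeg (tree_word t) = Suc (weight t)"
  by (induction t) auto

lemma leaves_somes: "leaves t = somes (tree_word t)"
  by (induction t) auto

lemma arity_somes: "arity t = length (somes (tree_word t))"
  by (simp add: arity_def leaves_somes)

lemma tree_word_map_tree: "tree_word (map_tree f t) = map (map_option f) (tree_word t)"
  by (induction t) auto

lemma weight_map_tree [simp]: "weight (map_tree f t) = weight t"
  by (induction t) auto

lemma tree_sign_map_tree [simp]: "tree_sign (map_tree f t) = tree_sign t"
  by (induction t) auto

lemma leaves_map_tree: "leaves (map_tree f t) = map f (leaves t)"
  by (induction t) auto

lemma arity_map_tree [simp]: "arity (map_tree f t) = arity t"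
  by (simp add: arity_def leaves_map_tree)

lemma tree_sign_square: "tree_sign t * tree_sign t = (1::'k::field)"
proof (induction t)
  case (Mu s t)
  have "tree_sign (Mu s t) * tree_sign (Mu s t)
      = ((-1) ^ weight s * (-1) ^ weight s) * (tree_sign s * tree_sign s) * (tree_sign t * tree_sign t :: 'k)"
    by (simp only: tree_sign.simps mult_ac)
  then show ?case using Mu by (simp flip: power_add)
qed auto

lemma tree_sign_square_mult: "tree_sign t * (tree_sign t * c) = (c::'k::field)"
  by (simp add: tree_sign_square flip: mult.assoc)

abbreviation shape :: "'b tree \<Rightarrow> unit tree" where
  "shape \<equiv> map_tree (\<lambda>_. ())"

lemma arity_simps [simp]: "arity (Leaf b) = 1" "arity Bullet = 0" "arity (Mu s t) = arity s + arity t"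
  by (simp_all add: arity_def)

lemma leaves_decorate: "length bs = arity t \<Longrightarrow> leaves (decorate t bs) = bs"
  by (induction t arbitrary: bs) (auto simp: length_Suc_conv)

lemma shape_decorate [simp]: "shape (decorate (t :: unit tree) bs) = t"
  by (induction t arbitrary: bs) auto

lemma decorate_leaves: "decorate (map_tree f t) (leaves t) = t"
  by (induction t) (auto simp: arity_def leaves_map_tree)

lemma decorate_eq_iff:
  fixes t :: "unit tree"
  shows "length bs = arity t \<Longrightarrow> decorate t bs = z \<longleftrightarrow> t = shape z \<and> bs = leaves z"
  using leaves_decorate decorate_leaves shape_decorate by metis

section \<open>Corollas with corks\<close>

lemma finite_trees_of_word: "finite {t. tree_word t = w}"
proof (induction "length w" arbitrary: w rule: less_induct)
  case less
  let ?M = "\<Union>i\<in>{0<..<length w}. (\<lambda>(s, t). Mu s t) ` ({t. tree_word t = take i w} \<times> {t. tree_word t = drop i w})"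
  have "{t. tree_word t = w} \<subseteq> insert Bullet ((\<lambda>x. Leaf (the x)) ` set w) \<union> ?M"
  proof (intro subsetI, goal_cases)
    case (1 t)
    then show ?case
    proof (cases t)
      case (Mu s t')
      then have "t \<in> (\<lambda>(s, t). Mu s t) ` ({t. tree_word t = take (length (tree_word s)) w} \<times> {t. tree_word t = drop (length (tree_word s)) w})"
        "length (tree_word s) \<in> {0<..<length w}"
        using 1 by auto
      then show ?thesis by blast
    qed force+
  qed
  moreover have "finite ?M" using less by (intro finite_UN_I finite_imageI finite_cartesian_product) auto
  ultimately show ?case by (meson finite.insertI finite_Un finite_imageI finite_set finite_subset)
qed

text \<open>
  For a word of \<open>n\<close> letters these are the elements of the Koszul dual cooperad of the operad
  of associative algebras, with the unit plugged into the inputs that carry a cork.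
\<close>

definition corolla :: "'b option list \<Rightarrow> ('b tree \<Rightarrow>\<^sub>0 'k::field)" where
  "corolla w = (\<Sum>t | tree_word t = w. Poly_Mapping.single t (tree_sign t))"

lemma lookup_corolla:
  "Poly_Mapping.lookup (corolla w) t = (if tree_word t = w then tree_sign t else 0)"
  by (simp add: corolla_def lookup_sum lookup_single when_def finite_trees_of_word)

lemma corolla_Nil [simp]: "corolla [] = 0"
  by (simp add: corolla_def)

lemma keys_corolla: "t \<in> Poly_Mapping.keys (corolla w) \<Longrightarrow> tree_word t = w"
  by (auto simp: in_keys_iff lookup_corolla split: if_splits)

fun split_sum :: "('x list \<Rightarrow> 'x list \<Rightarrow> 'm::comm_monoid_add) \<Rightarrow> 'x list \<Rightarrow> 'm" where
  "split_sum \<phi> [] = 0"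
| "split_sum \<phi> [x] = 0"
| "split_sum \<phi> (x # y # w) = \<phi> [x] (y # w) + split_sum (\<lambda>u. \<phi> (x # u)) (y # w)"

lemma split_sum_zero [simp]: "split_sum (\<lambda>_ _. 0) w = 0"
proof (induction w)
  case (Cons x w)
  then show ?case by (cases w) auto
qed auto

lemma split_sum_add: "split_sum (\<lambda>u v. \<phi> u v + \<psi> u v) w = split_sum \<phi> w + split_sum \<psi> w"
proof (induction w arbitrary: \<phi> \<psi>)
  case (Cons x w)
  then show ?case by (cases w) (auto simp: algebra_simps)
qed auto

lemma split_sum_cong:
  "(\<And>u v. u @ v = w \<Longrightarrow> u \<noteq> [] \<Longrightarrow> v \<noteq> [] \<Longrightarrow> \<phi> u v = \<psi> u v) \<Longrightarrow> split_sum \<phi> w = split_sum \<psi> w"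
proof (induction w arbitrary: \<phi> \<psi>)
  case (Cons x w)
  show ?case
  proof (cases w)
    case (Cons y w')
    have "split_sum (\<lambda>u. \<phi> (x # u)) w = split_sum (\<lambda>u. \<psi> (x # u)) w"
      by (rule Cons.IH) (simp add: Cons.prems)
    then show ?thesis using Cons Cons.prems[of "[x]" w] by simp
  qed auto
qed auto

lemma split_sum_hom:
  assumes "f 0 = 0" "\<And>x y. f (x + y) = f x + f y"
  shows "f (split_sum \<phi> w) = split_sum (\<lambda>u v. f (\<phi> u v)) w"
proof (induction w arbitrary: \<phi>)
  case (Cons x w)
  then show ?case by (cases w) (auto simp: assms)
qed (auto simp: assms)

lemma split_sum_in:
  assumes "0 \<in> S" "\<And>x y. x \<in> S \<Longrightarrow> y \<in> S \<Longrightarrow> x + y \<in> S" "\<And>u v. \<phi> u v \<in> S"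
  shows "split_sum \<phi> w \<in> S"
  using assms(3)
proof (induction w arbitrary: \<phi>)
  case (Cons x w)
  then show ?case by (cases w) (auto simp: assms)
qed (auto simp: assms)

lemma split_sum_indicator:
  "split_sum (\<lambda>u v. if u = u0 \<and> v = v0 then c else 0) w
    = (if u0 @ v0 = w \<and> u0 \<noteq> [] \<and> v0 \<noteq> [] then c else 0)"
proof (induction w arbitrary: u0)
  case (Cons x w)
  show ?case
  proof (cases w)
    case Nil
    have "u0 @ v0 \<noteq> [x]" if "u0 \<noteq> []" "v0 \<noteq> []"
      using that by (cases u0) auto
    then show ?thesis using Nil by auto
  next
    case w: (Cons y w')
    show ?thesis
    proof (cases u0)
      case Nil
      then show ?thesis by (simp add: w)
    next
      case u0: (Cons z u1)
      have "split_sum (\<lambda>u v. if x # u = u0 \<and> v = v0 then c else 0) w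
        = (if x = z \<and> u1 @ v0 = w \<and> u1 \<noteq> [] \<and> v0 \<noteq> [] then c else 0)"
        using Cons.IH[of u1] by (cases "x = z") (simp_all add: u0)
      then show ?thesis by (cases u1) (auto simp: w u0)
    qed
  qed
qed auto

definition letter :: "'b option \<Rightarrow> 'b tree" where
  "letter x = (case x of Some b \<Rightarrow> Leaf b | None \<Rightarrow> Bullet)"

lemma letter_simps [simp]: "letter (Some b) = Leaf b" "letter None = Bullet"
  by (auto simp: letter_def)

lemma tree_word_letter [simp]: "tree_word (letter x) = [x]"
  by (cases x) auto

definition graft :: "('b tree \<Rightarrow>\<^sub>0 'k::field) \<Rightarrow> ('b tree \<Rightarrow>\<^sub>0 'k) \<Rightarrow> ('b tree \<Rightarrow>\<^sub>0 'k)" where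
  "graft = bilin (\<lambda>s t. bas (Mu s t))"

lemma lookup_graft:
  "Poly_Mapping.lookup (graft p q) t
    = (case t of Mu s t' \<Rightarrow> Poly_Mapping.lookup p s * Poly_Mapping.lookup q t' | _ \<Rightarrow> 0)"
proof (cases t)
  case (Mu s t')
  have "Poly_Mapping.lookup (graft p q) t = Poly_Mapping.lookup p s * Poly_Mapping.lookup q t' * 1"
    unfolding graft_def by (rule lookup_bilin_at) (auto simp: lookup_single when_def Mu)
  then show ?thesis by (simp add: Mu)
qed (simp_all add: graft_def lookup_bilin lookup_single)

lemmas graft_simps = bilin_simps[of "\<lambda>s t. bas (Mu s t)", folded graft_def]
lemmas graft_bas = bilin_bas[of "\<lambda>s t. bas (Mu s t)", folded graft_def]

lemma lookup_split_sum:
  "Poly_Mapping.lookup (split_sum \<phi> w) t = split_sum (\<lambda>u v. Poly_Mapping.lookup (\<phi> u v) t) w"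
  by (rule split_sum_hom) (auto simp: lookup_add)

lemma tree_word_eq_single_iff: "tree_word t = [x] \<longleftrightarrow> t = letter x"
proof (cases t)
  case (Mu a b)
  have "length (tree_word a @ tree_word b) \<noteq> 1"
    using length_tree_word_pos[of a] length_tree_word_pos[of b] unfolding length_append by linarith
  then have "tree_word t \<noteq> [x]" using Mu by (metis One_nat_def length_Cons list.size(3) tree_word.simps(3))
  then show ?thesis using Mu by (cases x) auto
next
  case (Leaf b)
  then show ?thesis by (cases x) auto
next
  case Bullet
  then show ?thesis by (cases x) auto
qed

lemma corolla_letter: "corolla [x] = bas (letter x)"
proof -
  have "{t. tree_word t = [x]} = {letter x}" by (auto simp: tree_word_eq_single_iff)
  then show ?thesis by (cases x) (simp_all add: corolla_def)
qed

text \<open>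
  A tree with more than one letter has a root, which cuts its word in two; the exponent is the
  weight of the left subtree.
\<close>

lemma corolla_split:
  fixes w :: "'b option list"
  assumes "length w \<noteq> 1"
  shows "(corolla w :: 'b tree \<Rightarrow>\<^sub>0 'k::field)
    = split_sum (\<lambda>u v. fscale ((-1) ^ Suc (wdeg u)) (graft (corolla u) (corolla v))) w"
proof (rule poly_mapping_eqI)
  fix t :: "'b tree"
  let ?s = "(\<lambda>u v. fscale ((-1) ^ Suc (wdeg u)) (graft (corolla u) (corolla v) :: 'b tree \<Rightarrow>\<^sub>0 'k))"
  show "Poly_Mapping.lookup (corolla w :: 'b tree \<Rightarrow>\<^sub>0 'k) t = Poly_Mapping.lookup (split_sum ?s w) t"
  proof (cases t)
    case (Mu a b)
    have *: "Poly_Mapping.lookup (?s u v) t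
        = (if u = tree_word a \<and> v = tree_word b then tree_sign t else 0)" for u v
      by (auto simp: Mu lookup_fscale lookup_graft lookup_corolla wdeg_tree_word)
    have "Poly_Mapping.lookup (split_sum ?s w) t = (if tree_word t = w then tree_sign t else 0)"
      unfolding lookup_split_sum * split_sum_indicator by (simp add: Mu)
    then show ?thesis by (simp only: lookup_corolla)
  qed (use assms in \<open>auto simp: lookup_split_sum lookup_corolla lookup_fscale lookup_graft\<close>)
qed

section \<open>Invariance under rotations\<close>

abbreviation corolla_span :: "('b tree \<Rightarrow>\<^sub>0 'k::field) set" where
  "corolla_span \<equiv> fvs.span (range corolla)"

definition rotation_invariant :: "('b tree \<Rightarrow>\<^sub>0 'k::field) \<Rightarrow> bool" where
  "rotation_invariant x \<longleftrightarrow> (\<forall>s t. tree_word s = tree_word t \<longrightarrow>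
     tree_sign s * Poly_Mapping.lookup x s = tree_sign t * Poly_Mapping.lookup x t)"

text \<open>
  Invariance under all changes of tree with a given word is what rotations generate; an
  invariant element is read off from its coefficients at one tree for each word.
\<close>

lemma corolla_span_iff: "x \<in> corolla_span \<longleftrightarrow> rotation_invariant x"
proof
  assume "x \<in> corolla_span"
  then show "rotation_invariant x"
  proof (induction rule: fvs.span_induct_alt)
    case (step c x y)
    then obtain w where x: "x = corolla w" by auto
    have *: "tree_sign s * Poly_Mapping.lookup (fscale c x + y) s
        = c * (if tree_word s = w then 1 else 0) + tree_sign s * Poly_Mapping.lookup y s" for s
      using tree_sign_square[of s] by (auto simp: x lookup_add lookup_fscale lookup_corolla algebra_simps)
    show ?case unfolding rotation_invariant_def *
    proof (intro allI impI)
      fix s t :: "'a tree" assume st: "tree_word s = tree_word t"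
      then have "tree_sign s * Poly_Mapping.lookup y s = tree_sign t * Poly_Mapping.lookup y t"
        using step(2) unfolding rotation_invariant_def by blast
      then show "c * (if tree_word s = w then 1 else 0) + tree_sign s * Poly_Mapping.lookup y s
          = c * (if tree_word t = w then 1 else 0) + tree_sign t * Poly_Mapping.lookup y t"
        by (simp only: st)
    qed
  qed (simp add: rotation_invariant_def)
next
  assume inv: "rotation_invariant x"
  define tr :: "'a option list \<Rightarrow> 'a tree" where "tr w = (SOME t. tree_word t = w)" for w
  have tr: "tree_word (tr (tree_word t)) = tree_word t" for t
    unfolding tr_def by (rule someI) auto
  have "x = (\<Sum>w\<in>tree_word ` Poly_Mapping.keys x.
      fscale (tree_sign (tr w) * Poly_Mapping.lookup x (tr w)) (corolla w))" (is "_ = ?r")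
  proof (rule poly_mapping_eqI)
    fix t
    have "tree_sign (tr (tree_word t)) * Poly_Mapping.lookup x (tr (tree_word t)) * tree_sign t
        = Poly_Mapping.lookup x t"
    proof -
      have "tree_sign (tr (tree_word t)) * Poly_Mapping.lookup x (tr (tree_word t))
          = tree_sign t * Poly_Mapping.lookup x t"
        using inv tr[of t] unfolding rotation_invariant_def by blast
      then show ?thesis by (simp add: tree_sign_square_mult mult.commute mult.left_commute)
    qed
    moreover have "Poly_Mapping.lookup ?r t = (\<Sum>w\<in>tree_word ` Poly_Mapping.keys x.
        if w = tree_word t then tree_sign (tr (tree_word t)) * Poly_Mapping.lookup x (tr (tree_word t)) * tree_sign t else 0)"
      unfolding lookup_sum by (rule sum.cong) (auto simp: lookup_fscale lookup_corolla)
    ultimately show "Poly_Mapping.lookup x t = Poly_Mapping.lookup ?r t"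
      by (auto simp: in_keys_iff)
  qed
  also have "\<dots> \<in> corolla_span"
    by (intro fvs.span_sum fvs.span_scale fvs.span_base) auto
  finally show "x \<in> corolla_span" .
qed

section \<open>Coefficients of the decomposition map\<close>

text \<open>
  \<open>join\<close> grafts the upper trees onto the lower one. The decomposition of a tree is the sum of
  all its preimages under \<open>join\<close>, each with sign \<open>cut_sign\<close>; all later statements on the
  cooperad structure are read off from this description of the coefficients.
\<close>

fun join :: "'b tree tree \<Rightarrow> 'b tree" where
  "join (Leaf t) = t"
| "join Bullet = Bullet"
| "join (Mu x y) = Mu (join x) (join y)"

fun cut_sign :: "'b tree tree \<Rightarrow> 'k::field" where
  "cut_sign (Leaf t) = 1"
| "cut_sign Bullet = 1"
| "cut_sign (Mu x y) = cut_sign x * cut_sign y * (-1) ^ (inner_weight x * weight y)"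

lemma lookup_decomp:
  "Poly_Mapping.lookup (decomp t) z = (if join z = t then cut_sign z else 0)"
proof (induction t arbitrary: z)
  case (Leaf b)
  then show ?case by (cases z) (auto simp: lookup_single when_def)
next
  case Bullet
  then show ?case by (cases z) (auto simp: lookup_single lookup_add when_def)
next
  case (Mu s t)
  let ?f = "\<lambda>x y. Poly_Mapping.single (Mu x y) ((-1) ^ (inner_weight x * weight y))"
  have "Poly_Mapping.lookup (bilin ?f (decomp s) (decomp t)) z
      = (case z of Mu x y \<Rightarrow> Poly_Mapping.lookup (decomp s) x * Poly_Mapping.lookup (decomp t) y *
          (-1) ^ (inner_weight x * weight y) | _ \<Rightarrow> 0)"
  proof (cases z)
    case (Mu x y)
    then show ?thesis by (simp, intro lookup_bilin_at) (auto simp: lookup_single when_def)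
  qed (simp_all add: lookup_bilin lookup_single)
  then show ?case
    using Mu by (cases z) (auto simp: lookup_add lookup_single when_def)
qed

lemma lookup_lin_decomp:
  "Poly_Mapping.lookup (lin decomp x) z = Poly_Mapping.lookup x (join z) * cut_sign z"
  by (rule lookup_lin_at) (auto simp: lookup_decomp)

lemma lookup_compose:
  fixes c :: "unit tree \<Rightarrow>\<^sub>0 'k::field"
  assumes "c \<in> of_arity n" "length ys = n"
  shows "Poly_Mapping.lookup (bilin (\<lambda>t ts. bas (decorate t ts)) c (ftensor ys)) z
    = Poly_Mapping.lookup c (shape z) * Poly_Mapping.lookup (ftensor ys) (leaves z)"
proof -
  have "Poly_Mapping.lookup (bilin (\<lambda>t ts. bas (decorate t ts)) c (ftensor ys)) z
    = Poly_Mapping.lookup c (shape z) * Poly_Mapping.lookup (ftensor ys) (leaves z) * 1"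
  proof (rule lookup_bilin_at)
    fix t ts
    assume "t \<in> Poly_Mapping.keys c" "ts \<in> Poly_Mapping.keys (ftensor ys)"
    then have "length ts = arity t"
      using assms by (auto simp: of_arity_def in_keys_iff lookup_ftensor split: if_splits)
    then show "Poly_Mapping.lookup (bas (decorate t ts)) z = (if t = shape z \<and> ts = leaves z then 1 else 0)"
      by (simp add: lookup_single when_def decorate_eq_iff)
  qed
  then show ?thesis by simp
qed

section \<open>The Koszul dual cooperad: upper bound\<close>

lemma lookup_weight_part:
  "Poly_Mapping.lookup (weight_part w x) t = (if weight t = w then Poly_Mapping.lookup x t else 0)"
  unfolding weight_part_def
  by (subst lookup_lin_at[where a = t and c = "if weight t = w then 1 else 0"])
    (auto simp: lookup_single when_def)

lemma lookup_homog_part: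
  "Poly_Mapping.lookup (homog_part n w x) t
    = (if arity t = n \<and> weight t = w then Poly_Mapping.lookup x t else 0)"
  unfolding homog_part_def
  by (subst lookup_lin_at[where a = t and c = "if arity t = n \<and> weight t = w then 1 else 0"])
    (auto simp: lookup_single when_def)

lemma weight_part_hom: "module_hom fscale fscale (weight_part w)"
  unfolding weight_part_def by (rule lin_hom)

lemma quadratic_relations_coeff:
  fixes y :: "unit tree \<Rightarrow>\<^sub>0 'k::field"
  assumes "y \<in> uAs_quadratic_relations"
  shows "Poly_Mapping.lookup y (Mu (Mu lf lf) lf) + Poly_Mapping.lookup y (Mu lf (Mu lf lf)) = 0"
proof -
  obtain z :: "unit tree \<Rightarrow>\<^sub>0 'k" where z: "z \<in> uAs_relations" "y = weight_part 2 z"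
    using assms by (auto simp: uAs_quadratic_relations_def)
  have "Poly_Mapping.lookup z (Mu (Mu lf lf) lf) + Poly_Mapping.lookup z (Mu lf (Mu lf lf)) = 0"
    using z(1) unfolding uAs_relations_def
  proof (induction rule: fvs.span_induct_alt)
    case (step c x y)
    then have "Poly_Mapping.lookup x (Mu (Mu lf lf) lf) = - Poly_Mapping.lookup x (Mu lf (Mu lf lf))"
      by (auto simp: lookup_minus lookup_single)
    then show ?case using step(2) by (simp add: lookup_add lookup_fscale algebra_simps)
  qed simp
  then show ?thesis by (simp add: z(2) lookup_weight_part)
qed

text \<open>
  The lower trees that occur below a fixed list of upper trees. Applied to an element of
  \<open>D \<circ> D\<close> it stays in \<open>D\<close>, since on a generator it returns a multiple of the lower factor.
\<close>

definition lower_slice :: "unit tree list \<Rightarrow> (unit tree tree \<Rightarrow>\<^sub>0 'k::field) \<Rightarrow> (unit tree \<Rightarrow>\<^sub>0 'k)" where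
  "lower_slice ts = lin (\<lambda>z. if leaves z = ts then bas (shape z) else 0)"

lemma lookup_lower_slice:
  "Poly_Mapping.lookup (lower_slice ts y) t
    = (if arity t = length ts then Poly_Mapping.lookup y (decorate t ts) else 0)"
proof -
  have "Poly_Mapping.lookup (lower_slice ts y) t
      = Poly_Mapping.lookup y (decorate t ts) * (if arity t = length ts then 1 else 0)"
    unfolding lower_slice_def
  proof (rule lookup_lin_at)
    fix z :: "unit tree tree"
    show "Poly_Mapping.lookup (if leaves z = ts then bas (shape z) else 0 :: _ \<Rightarrow>\<^sub>0 'a) t
      = (if z = decorate t ts then if arity t = length ts then 1 else 0 else 0)"
    proof (cases "arity t = length ts")
      case True
      have "decorate t ts = z \<longleftrightarrow> t = shape z \<and> ts = leaves z"
        using decorate_eq_iff[of ts t z] True by simp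
      then show ?thesis using True by (auto simp: lookup_single when_def)
    next
      case False
      have "shape z \<noteq> t" if "leaves z = ts"
        using False that by (metis arity_def arity_map_tree)
      then show ?thesis using False by (auto simp: lookup_single when_def)
    qed
  qed
  then show ?thesis by simp
qed

lemma lower_slice_in:
  fixes D :: "(unit tree \<Rightarrow>\<^sub>0 'k::field) set"
  assumes D: "fvs.subspace D" and y: "y \<in> comp_square D"
  shows "lower_slice ts y \<in> D"
proof (rule fvs.hom_span_subset[OF _ _ D y[unfolded comp_square_def]])
  show "module_hom fscale fscale (lower_slice ts :: _ \<Rightarrow> _ \<Rightarrow>\<^sub>0 'k)"
    unfolding lower_slice_def by (rule lin_hom)
  show "lower_slice ts ` {bilin (\<lambda>t ts. bas (decorate t ts)) c (ftensor ys) |n c ys.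
     c \<in> D \<inter> of_arity n \<and> length ys = n \<and> set ys \<subseteq> D} \<subseteq> D"
  proof safe
    fix n c and ys :: "(unit tree \<Rightarrow>\<^sub>0 'k) list"
    assume c: "c \<in> D" "c \<in> of_arity (length ys)"
    have "lower_slice ts (bilin (\<lambda>t ts. bas (decorate t ts)) c (ftensor ys))
        = fscale (Poly_Mapping.lookup (ftensor ys) ts) c"
    proof (rule poly_mapping_eqI)
      fix t
      have "Poly_Mapping.lookup c t = 0" if "arity t \<noteq> length ys"
        using c(2) that by (auto simp: of_arity_def in_keys_iff)
      then show "Poly_Mapping.lookup (lower_slice ts (bilin (\<lambda>t ts. bas (decorate t ts)) c (ftensor ys))) t
        = Poly_Mapping.lookup (fscale (Poly_Mapping.lookup (ftensor ys) ts) c) t"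
        by (auto simp: lookup_lower_slice lookup_compose[OF c(2) refl] lookup_fscale leaves_decorate
            lookup_ftensor)
    qed
    then show "lower_slice ts (bilin (\<lambda>t ts. bas (decorate t ts)) c (ftensor ys)) \<in> D"
      using fvs.subspace_scale[OF D c(1)] by simp
  qed
qed

text \<open>
  The trees that occur as right upper factor when the lower tree is the binary generator and
  the left upper factor is fixed. It serves to pass from a tree to its right subtree.
\<close>

definition right_slice :: "unit tree \<Rightarrow> (unit tree tree \<Rightarrow>\<^sub>0 'k::field) \<Rightarrow> (unit tree \<Rightarrow>\<^sub>0 'k)" where
  "right_slice s = lin (\<lambda>z. case z of Mu (Leaf s') (Leaf t) \<Rightarrow> if s' = s then bas t else 0 | _ \<Rightarrow> 0)"

lemma lookup_right_slice:
  "Poly_Mapping.lookup (right_slice s y) t = Poly_Mapping.lookup y (Mu (Leaf s) (Leaf t))"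
  unfolding right_slice_def
  by (subst lookup_lin_at[where a = "Mu (Leaf s) (Leaf t)" and c = 1])
    (auto simp: lookup_single when_def split: tree.splits)

lemma right_slice_in:
  fixes D :: "(unit tree \<Rightarrow>\<^sub>0 'k::field) set"
  assumes D: "fvs.subspace D" and y: "y \<in> comp_square D"
  shows "right_slice s y \<in> D"
proof (rule fvs.hom_span_subset[OF _ _ D y[unfolded comp_square_def]])
  show "module_hom fscale fscale (right_slice s :: _ \<Rightarrow> _ \<Rightarrow>\<^sub>0 'k)"
    unfolding right_slice_def by (rule lin_hom)
  show "right_slice s ` {bilin (\<lambda>t ts. bas (decorate t ts)) c (ftensor ys) |n c ys.
     c \<in> D \<inter> of_arity n \<and> length ys = n \<and> set ys \<subseteq> D} \<subseteq> D"
  proof safe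
    fix n c and ys :: "(unit tree \<Rightarrow>\<^sub>0 'k) list"
    assume c: "c \<in> D" "c \<in> of_arity (length ys)" and ys: "set ys \<subseteq> D"
    let ?x = "bilin (\<lambda>t ts. bas (decorate t ts)) c (ftensor ys)"
    have "right_slice s ?x \<in> D"
    proof (cases "length ys = 2")
      case True
      then obtain p q where pq: "ys = [p, q]" by (auto simp: numeral_2_eq_2 length_Suc_conv)
      have "right_slice s ?x = fscale (Poly_Mapping.lookup c (Mu lf lf) * Poly_Mapping.lookup p s) q"
        by (rule poly_mapping_eqI)
          (simp add: pq lookup_right_slice lookup_compose[OF c(2)[unfolded pq] refl] lookup_fscale
            lookup_ftensor del: ftensor.simps)
      then show ?thesis using fvs.subspace_scale[OF D] ys pq by simp
    next
      case False
      then have "right_slice s ?x = 0"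
        by (intro poly_mapping_eqI)
          (simp add: lookup_right_slice lookup_compose[OF c(2) refl] lookup_ftensor)
      then show ?thesis using fvs.subspace_0[OF D] by simp
    qed
    then show "right_slice s ?x \<in> D" .
  qed
qed

locale quadratic_subcooperad =
  fixes D :: "(unit tree \<Rightarrow>\<^sub>0 'k::field) set"
  assumes sub: "subcooperad D"
    and quad: "\<And>x. x \<in> D \<Longrightarrow> weight_part 2 x \<in> uAs_quadratic_relations"
begin

lemma subspace: "fvs.subspace D" and decomp_in: "x \<in> D \<Longrightarrow> lin decomp x \<in> comp_square D"
  using sub by (auto simp: subcooperad_def)

definition ncoeff :: "(unit tree \<Rightarrow>\<^sub>0 'k) \<Rightarrow> unit tree \<Rightarrow> 'k" where
  "ncoeff x t = tree_sign t * Poly_Mapping.lookup x t"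

text \<open>
  The slice of the decomposition over the three upper trees \<open>a, b, c\<close> lies in \<open>D\<close>, so its
  two-vertex part is a quadratic relation; there the coefficients of the two trees with three
  leaves are opposite.
\<close>

lemma root_rotation:
  assumes "x \<in> D"
  shows "ncoeff x (Mu (Mu a b) c) = ncoeff x (Mu a (Mu b c))"
proof -
  have "lower_slice [a, b, c] (lin decomp x) \<in> D"
    by (rule lower_slice_in[OF subspace decomp_in[OF assms]])
  from quadratic_relations_coeff[OF quad[OF this]]
  have "Poly_Mapping.lookup x (Mu (Mu a b) c) + (-1) ^ weight a * Poly_Mapping.lookup x (Mu a (Mu b c)) = 0"
    by (simp add: lookup_weight_part lookup_lower_slice lookup_lin_decomp inner_weight_def arity_def mult.commute)
  then have "Poly_Mapping.lookup x (Mu (Mu a b) c) = - ((-1) ^ weight a * Poly_Mapping.lookup x (Mu a (Mu b c)))"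
    by (simp add: eq_neg_iff_add_eq_0)
  then show ?thesis
    by (simp add: ncoeff_def power_add mult_ac flip: power_mult_distrib)
qed

text \<open>
  Repeated rotation at the root makes the left subtree a single letter.
\<close>

lemma comb_form:
  assumes "x \<in> D"
  shows "\<exists>t'. tree_word t' = tl (tree_word s) @ tree_word t \<and> ncoeff x (Mu s t) = ncoeff x (Mu (letter (hd (tree_word s))) t')"
proof (induction s arbitrary: t)
  case (Mu a b)
  from Mu(1)[of "Mu b t"] show ?case
    using root_rotation[OF assms, of a b t] by (auto simp: tl_append2 hd_append2)
qed auto

text \<open>
  By \<open>comb_form\<close> both trees may be taken to have the same single letter on the left. What
  remains is a comparison of right subtrees, which have a shorter word, in the slice of \<open>x\<close>
  over that letter.
\<close>

lemma ncoeff_cong: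
  "x \<in> D \<Longrightarrow> tree_word s = tree_word t \<Longrightarrow> ncoeff x s = ncoeff x t"
proof (induction "length (tree_word s)" arbitrary: s t x rule: less_induct)
  case less
  show ?case
  proof (cases "\<exists>y. tree_word s = [y]")
    case True
    then show ?thesis using less.prems by (metis tree_word_eq_single_iff)
  next
    case False
    then obtain s1 s2 where s: "s = Mu s1 s2" by (cases s) auto
    obtain t1 t2 where t: "t = Mu t1 t2" using False less.prems by (cases t) auto
    let ?l = "letter (hd (tree_word s)) :: unit tree"
    obtain s' where s': "tree_word s' = tl (tree_word s)" "ncoeff x s = ncoeff x (Mu ?l s')"
      using comb_form[OF less.prems(1), of s1 s2] by (auto simp: s)
    obtain t' where t': "tree_word t' = tl (tree_word s)" "ncoeff x t = ncoeff x (Mu ?l t')"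
      using comb_form[OF less.prems(1), of t1 t2] less.prems(2) by (auto simp: t)
    define x' where "x' = right_slice ?l (lin decomp x)"
    have x': "x' \<in> D"
      unfolding x'_def by (rule right_slice_in[OF subspace decomp_in[OF less.prems(1)]])
    have nx: "ncoeff x (Mu ?l r) = (-1) ^ weight ?l * tree_sign ?l * ncoeff x' r" for r
      by (simp add: ncoeff_def x'_def lookup_right_slice lookup_lin_decomp inner_weight_def)
    have "length (tree_word s') < length (tree_word s)" using s'(1) by simp
    then have "ncoeff x' s' = ncoeff x' t'"
      using less.hyps[of s' x' t'] x' s'(1) t'(1) by simp
    then show ?thesis using s'(2) t'(2) nx by simp
  qed
qed

lemma subset_corolla_span: "D \<subseteq> corolla_span"
proof
  fix x assume "x \<in> D"
  then have "rotation_invariant x"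
    unfolding rotation_invariant_def using ncoeff_cong[of x, unfolded ncoeff_def] by blast
  then show "x \<in> corolla_span" by (simp only: corolla_span_iff)
qed

end

section \<open>The Koszul dual cooperad: lower bound\<close>

lemma corolla_in_span [simp]: "corolla w \<in> corolla_span"
  by (rule fvs.span_base) simp

text \<open>
  A cut of a tree is described, up to the choice of trees with given words, by the list of its
  blocks: \<open>None\<close> is a cork of the lower tree, and \<open>Some u\<close> is an upper tree with word
  \<open>u\<close>. The weight of the latter is \<open>wdeg u - 1\<close>.
\<close>

fun opt_deg :: "'b option list option \<Rightarrow> nat" where
  "opt_deg None = 0"
| "opt_deg (Some u) = wdeg u - 1"

definition blocks :: "'b tree tree \<Rightarrow> 'b option list option list" where
  "blocks z = map (map_option tree_word) (tree_word z)"

fun flat :: "'b option list option list \<Rightarrow> 'b option list" where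
  "flat [] = []"
| "flat (Some u # V) = u @ flat V"
| "flat (None # V) = None # flat V"

lemma flat_append [simp]: "flat (U @ V) = flat U @ flat V"
  by (induction U rule: flat.induct) auto

lemma blocks_simps [simp]: "blocks (Leaf t) = [Some (tree_word t)]" "blocks Bullet = [None]"
  "blocks (Mu x y) = blocks x @ blocks y"
  by (simp_all add: blocks_def)

lemma tree_word_join: "tree_word (join z) = flat (blocks z)"
  by (induction z) auto

text \<open>
  The Koszul sign for moving each later letter of the lower word past the weight of each
  earlier upper tree.
\<close>

fun blocks_sign :: "'b option list option list \<Rightarrow> 'k::field" where
  "blocks_sign [] = 1"
| "blocks_sign (x # V) = (-1) ^ (opt_deg x * wdeg V) * blocks_sign V"

definition upper_deg :: "'b option list option list \<Rightarrow> nat" where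
  "upper_deg V = sum_list (map opt_deg V)"

lemma blocks_sign_append:
  "blocks_sign (U @ V) = (blocks_sign U * blocks_sign V * (-1) ^ (upper_deg U * wdeg V) :: 'k::field)"
  by (induction U) (auto simp: upper_deg_def power_add algebra_simps)

lemma upper_deg_blocks: "upper_deg (blocks z) = inner_weight z"
  by (induction z) (auto simp: upper_deg_def inner_weight_def wdeg_tree_word)

lemma ldeg_map_option [simp]: "ldeg (map_option f x) = ldeg x"
  by (cases x) auto

lemma wdeg_map_option [simp]: "wdeg (map (map_option f) w) = wdeg w"
  by (induction w) auto

lemma wdeg_blocks: "wdeg (blocks z) = Suc (weight z)"
  by (simp add: blocks_def wdeg_tree_word)

lemma weight_join: "weight (join z) = weight z + inner_weight z"
  by (induction z) (auto simp: inner_weight_def)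

text \<open>
  The sign of a cut and the sign of the cut tree combine to a sign that depends on the blocks
  only and the signs of the lower and upper trees. This is why the decomposition of a corolla is
  again a combination of composites of corollas.
\<close>

lemma cut_sign_tree_sign:
  "cut_sign z * tree_sign (join z)
    = (blocks_sign (blocks z) * tree_sign z * prod_list (map tree_sign (leaves z)) :: 'k::field)"
proof (induction z)
  case (Mu x y)
  let ?a = "(-1 :: 'k) ^ weight x" and ?b = "(-1 :: 'k) ^ inner_weight x"
  have "cut_sign (Mu x y) * tree_sign (join (Mu x y))
      = (cut_sign x * tree_sign (join x)) * (cut_sign y * tree_sign (join y))
        * ((-1) ^ (inner_weight x * weight y)) * ?a * (?b :: 'k)"
    by (simp add: weight_join power_add mult_ac)
  then show ?case
    by (simp add: Mu blocks_sign_append upper_deg_blocks wdeg_blocks power_add mult_ac)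
qed auto

lemma lookup_corolla_tensor:
  "Poly_Mapping.lookup (ftensor (map corolla us)) ts
    = (if map tree_word ts = us then prod_list (map tree_sign ts) else 0)"
proof (cases "length ts = length us")
  case True
  then show ?thesis
    unfolding lookup_ftensor by (induction ts us rule: list_induct2) (auto simp: lookup_corolla)
next
  case False
  then have "map tree_word ts \<noteq> us" by auto
  with False show ?thesis by (simp add: lookup_ftensor)
qed

lemma somes_map_option: "somes (map (map_option f) w) = map f (somes w)"
  by (induction w rule: somes.induct) auto

definition block_shape :: "'b option list \<Rightarrow> unit option list" where
  "block_shape = map (map_option (\<lambda>_. ()))"

lemma map_option_eq_iff_shape:
  "map (map_option f) w = V \<longleftrightarrow> block_shape w = block_shape V \<and> map f (somes w) = somes V"
proof (induction w arbitrary: V)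
  case Nil
  then show ?case by (auto simp: block_shape_def)
next
  case (Cons x w)
  show ?case
  proof (cases V)
    case (Cons y V')
    then show ?thesis using Cons.IH[of V']
      by (cases x; cases y) (auto simp: block_shape_def)
  qed (simp add: block_shape_def)
qed

definition block_corolla :: "unit option list option list \<Rightarrow> (unit tree tree \<Rightarrow>\<^sub>0 'k::field)" where
  "block_corolla V = bilin (\<lambda>t ts. bas (decorate t ts)) (corolla (block_shape V))
     (ftensor (map corolla (somes V)))"

lemma length_somes_shape [simp]: "length (somes (block_shape w)) = length (somes w)"
  by (simp add: block_shape_def somes_map_option)

lemma corolla_of_arity: "corolla w \<in> of_arity (length (somes w))"
  by (auto simp: of_arity_def arity_somes dest: keys_corolla)

lemma corolla_shape_of_arity: "corolla (block_shape V) \<in> of_arity (length (somes V))"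
  using corolla_of_arity[of "block_shape V"] by simp

lemma lookup_block_corolla:
  "Poly_Mapping.lookup (block_corolla V) z
    = (if blocks z = V then tree_sign z * prod_list (map tree_sign (leaves z)) else 0)"
proof -
  have "blocks z = V \<longleftrightarrow> tree_word (shape z) = block_shape V \<and> map tree_word (leaves z) = somes V"
    unfolding blocks_def map_option_eq_iff_shape
    by (simp add: tree_word_map_tree leaves_somes block_shape_def)
  then show ?thesis
    unfolding block_corolla_def
    by (subst lookup_compose[OF corolla_shape_of_arity])
      (auto simp: lookup_corolla lookup_corolla_tensor)
qed

lemma block_corolla_in: "block_corolla V \<in> comp_square (corolla_span :: (unit tree \<Rightarrow>\<^sub>0 'k::field) set)"
  unfolding comp_square_def block_corolla_def
  by (rule fvs.span_base, rule CollectI,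
      rule exI[of _ "length (somes V)"], rule exI[of _ "corolla (block_shape V)"],
      rule exI[of _ "map corolla (somes V)"])
    (use corolla_shape_of_arity in auto)

text \<open>
  The decomposition sums over all ways of cutting the word into blocks; indexing by the blocks
  that do occur keeps the sum finite without describing them.
\<close>

lemma decomp_corolla:
  fixes w :: "unit option list"
  defines "y \<equiv> lin decomp (corolla w :: _ \<Rightarrow>\<^sub>0 'k::field)"
  shows "y = (\<Sum>V\<in>blocks ` Poly_Mapping.keys y. fscale (blocks_sign V) (block_corolla V))"
    (is "_ = ?r")
proof (rule poly_mapping_eqI)
  fix z
  have y: "Poly_Mapping.lookup y z = (if flat (blocks z) = w
      then blocks_sign (blocks z) * (tree_sign z * prod_list (map tree_sign (leaves z))) else 0)" for z
    unfolding y_def lookup_lin_decomp lookup_corolla tree_word_join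
    using cut_sign_tree_sign[of z, where 'k='k] by (simp add: mult_ac)
  have "Poly_Mapping.lookup ?r z = (\<Sum>V\<in>blocks ` Poly_Mapping.keys y. if V = blocks z
      then blocks_sign (blocks z) * (tree_sign z * prod_list (map tree_sign (leaves z))) else 0)"
    unfolding lookup_sum by (rule sum.cong) (auto simp: lookup_fscale lookup_block_corolla)
  also have "\<dots> = (if blocks z \<in> blocks ` Poly_Mapping.keys y
      then blocks_sign (blocks z) * (tree_sign z * prod_list (map tree_sign (leaves z))) else 0)"
    by simp
  also have "\<dots> = Poly_Mapping.lookup y z"
  proof (cases "blocks z \<in> blocks ` Poly_Mapping.keys y")
    case True
    then obtain z' where "blocks z = blocks z'" "Poly_Mapping.lookup y z' \<noteq> 0"
      by (auto simp: in_keys_iff)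
    then have "flat (blocks z) = w" using y[of z'] by (auto split: if_splits)
    then show ?thesis using True y[of z] by simp
  next
    case False
    then have "z \<notin> Poly_Mapping.keys y" by blast
    then show ?thesis using False by (simp add: in_keys_iff)
  qed
  finally show "Poly_Mapping.lookup y z = Poly_Mapping.lookup ?r z" by simp
qed

lemma corolla_small:
  "(corolla [Some (), Some (), Some ()] :: _ \<Rightarrow>\<^sub>0 'k::field)
    = bas (Mu lf (Mu lf lf)) - bas (Mu (Mu lf lf) lf)"
  "(corolla [None, Some ()] :: _ \<Rightarrow>\<^sub>0 'k) = - bas (Mu Bullet lf)"
  "(corolla [Some (), None] :: _ \<Rightarrow>\<^sub>0 'k) = bas (Mu lf Bullet)"
  by (simp_all add: corolla_split corolla_letter graft_bas graft_simps)

lemma weight_part_corolla: "weight_part k (corolla w) = (if wdeg w = Suc k then corolla w else 0)"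
  by (rule poly_mapping_eqI) (auto simp: lookup_weight_part lookup_corolla wdeg_tree_word)

lemma homog_part_corolla:
  "homog_part n k (corolla w) = (if length (somes w) = n \<and> wdeg w = Suc k then corolla w else 0)"
  by (rule poly_mapping_eqI) (auto simp: lookup_homog_part lookup_corolla wdeg_tree_word arity_somes)

lemma words_of_degree_3:
  assumes "wdeg (w :: unit option list) = 3"
  shows "w = [Some (), Some (), Some ()] \<or> w = [None, Some ()] \<or> w = [Some (), None]"
proof -
  have pos: "wdeg v = 0 \<longleftrightarrow> v = []" for v :: "unit option list"
  proof (cases v)
    case (Cons a list) then show ?thesis by (cases a) auto
  qed auto
  obtain x u where w: "w = x # u" using assms by (cases w) auto
  show ?thesis
  proof (cases u)
    case Nil
    then show ?thesis using assms w by (cases x) auto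
  next
    case u: (Cons y v)
    show ?thesis
    proof (cases v)
      case Nil
      then show ?thesis using assms w u by (cases x; cases y) auto
    next
      case v: (Cons z v')
      then show ?thesis using assms w u pos[of v'] by (cases x; cases y; cases z) auto
    qed
  qed
qed

lemma quadratic_relations_subspace: "fvs.subspace (uAs_quadratic_relations :: (_ \<Rightarrow>\<^sub>0 'k::field) set)"
  unfolding uAs_quadratic_relations_def uAs_relations_def
  using module_hom.subspace_image[OF weight_part_hom fvs.subspace_span] .

lemma weight_part_in_quadratic_relations:
  "(weight_part 2 (corolla w) :: _ \<Rightarrow>\<^sub>0 'k::field) \<in> uAs_quadratic_relations"
proof (cases "wdeg w = 3")
  case True
  have gen: "weight_part 2 x \<in> uAs_quadratic_relations"
    if "x \<in> {bas (Mu (Mu lf lf) lf) - bas (Mu lf (Mu lf lf)), bas (Mu Bullet lf) - bas lf,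
      bas (Mu lf Bullet) - bas lf}" for x :: "_ \<Rightarrow>\<^sub>0 'k"
    unfolding uAs_quadratic_relations_def uAs_relations_def
    using that by (intro imageI fvs.span_base)
  have w2: "weight_part 2 (bas t) = (if weight t = 2 then bas t else 0 :: _ \<Rightarrow>\<^sub>0 'k)" for t
    by (simp add: weight_part_def lin_bas)
  note wd = module_hom.diff[OF weight_part_hom, of 2]
  note Q = quadratic_relations_subspace
  have "corolla [Some (), Some (), Some ()] \<in> (uAs_quadratic_relations :: (_ \<Rightarrow>\<^sub>0 'k) set)"
    using fvs.subspace_neg[OF Q gen[of "bas (Mu (Mu lf lf) lf) - bas (Mu lf (Mu lf lf))"]]
    by (simp add: wd w2 corolla_small)
  moreover have "corolla [None, Some ()] \<in> (uAs_quadratic_relations :: (_ \<Rightarrow>\<^sub>0 'k) set)"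
    using fvs.subspace_neg[OF Q gen[of "bas (Mu Bullet lf) - bas lf"]] by (simp add: wd w2 corolla_small)
  moreover have "corolla [Some (), None] \<in> (uAs_quadratic_relations :: (_ \<Rightarrow>\<^sub>0 'k) set)"
    using gen[of "bas (Mu lf Bullet) - bas lf"] by (simp add: wd w2 corolla_small)
  ultimately have "corolla w \<in> (uAs_quadratic_relations :: (_ \<Rightarrow>\<^sub>0 'k) set)"
    using words_of_degree_3[OF True] by blast
  then show ?thesis using True by (simp add: weight_part_corolla)
next
  case False
  then show ?thesis using fvs.subspace_0[OF quadratic_relations_subspace] by (simp add: weight_part_corolla)
qed

lemma subcooperad_corolla_span: "subcooperad (corolla_span :: (_ \<Rightarrow>\<^sub>0 'k::field) set)"
  unfolding subcooperad_def
proof (intro conjI ballI allI)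
  show "fvs.subspace corolla_span" by (rule fvs.subspace_span)
  fix x :: "unit tree \<Rightarrow>\<^sub>0 'k" assume x: "x \<in> corolla_span"
  show "homog_part n w x \<in> corolla_span" for n w
  proof (rule fvs.hom_span_subset[OF _ _ fvs.subspace_span x])
    show "module_hom fscale fscale (homog_part n w :: _ \<Rightarrow> _ \<Rightarrow>\<^sub>0 'k)"
      unfolding homog_part_def by (rule lin_hom)
    show "homog_part n w ` range corolla \<subseteq> (corolla_span :: (_ \<Rightarrow>\<^sub>0 'k) set)"
      by (auto simp: homog_part_corolla fvs.span_zero)
  qed
  have sub: "fvs.subspace (comp_square corolla_span :: (_ \<Rightarrow>\<^sub>0 'k) set)"
    unfolding comp_square_def by (rule fvs.subspace_span)
  have gens: "lin decomp (corolla w) \<in> comp_square (corolla_span :: (_ \<Rightarrow>\<^sub>0 'k) set)" for w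
    by (subst decomp_corolla)
      (intro fvs.subspace_sum[OF sub] fvs.subspace_scale[OF sub] block_corolla_in)
  show "lin decomp x \<in> comp_square corolla_span"
    by (rule fvs.hom_span_subset[OF lin_hom _ sub x]) (use gens in blast)
qed

theorem uAs_dual_eq: "uAs_dual = (corolla_span :: (_ \<Rightarrow>\<^sub>0 'k::field) set)"
proof
  have "D \<subseteq> corolla_span" if "subcooperad D" "\<forall>x\<in>D. weight_part 2 x \<in> uAs_quadratic_relations"
    for D :: "(_ \<Rightarrow>\<^sub>0 'k) set"
    using that by (intro quadratic_subcooperad.subset_corolla_span) (simp add: quadratic_subcooperad_def)
  then show "uAs_dual \<subseteq> (corolla_span :: (_ \<Rightarrow>\<^sub>0 'k) set)"
    unfolding uAs_dual_def by (intro fvs.span_minimal fvs.subspace_span) blast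
  have "weight_part 2 x \<in> uAs_quadratic_relations" if "x \<in> corolla_span" for x :: "_ \<Rightarrow>\<^sub>0 'k"
    by (rule fvs.hom_span_subset[OF weight_part_hom _ quadratic_relations_subspace that])
      (auto simp: weight_part_in_quadratic_relations)
  then show "corolla_span \<subseteq> (uAs_dual :: (_ \<Rightarrow>\<^sub>0 'k) set)"
    unfolding uAs_dual_def using subcooperad_corolla_span by (blast intro: fvs.span_base)
qed

section \<open>Generators of the bar construction\<close>

lemma lookup_decorate_sum:
  assumes "c \<in> of_arity (length as)"
  shows "Poly_Mapping.lookup (lin (\<lambda>t. bas (decorate t as)) c) t
    = (if leaves t = as then Poly_Mapping.lookup c (shape t) else 0)"
proof -
  have "Poly_Mapping.lookup (lin (\<lambda>t. bas (decorate t as)) c) t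
      = Poly_Mapping.lookup c (shape t) * (if leaves t = as then 1 else 0)"
  proof (rule lookup_lin_at)
    fix s assume "s \<in> Poly_Mapping.keys c"
    then have "decorate s as = t \<longleftrightarrow> s = shape t \<and> as = leaves t"
      using assms by (intro decorate_eq_iff) (auto simp: of_arity_def)
    then show "Poly_Mapping.lookup (bas (decorate s as)) t = (if s = shape t then if leaves t = as then 1 else 0 else 0)"
      by (auto simp: lookup_single when_def)
  qed
  then show ?thesis by simp
qed

lemma decorate_corolla:
  fixes w :: "'b option list"
  shows "lin (\<lambda>t. bas (decorate t (somes w))) (corolla (block_shape w)) = corolla w"
proof (rule poly_mapping_eqI)
  fix t :: "'b tree"
  have "map (map_option (\<lambda>x. x)) (tree_word t) = tree_word t"
    by (rule map_idI) (rule option.map_ident)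
  then have "tree_word t = w \<longleftrightarrow> tree_word (shape t) = block_shape w \<and> leaves t = somes w"
    using map_option_eq_iff_shape[of "\<lambda>x. x" "tree_word t" w]
    by (simp add: tree_word_map_tree leaves_somes block_shape_def)
  then show "Poly_Mapping.lookup (lin (\<lambda>t. bas (decorate t (somes w))) (corolla (block_shape w))) t
      = Poly_Mapping.lookup (corolla w) t"
    by (auto simp: lookup_decorate_sum[OF corolla_shape_of_arity] lookup_corolla)
qed

text \<open>
  Labelling the leaves of a corolla over \<open>unit\<close> gives the corolla of the labelled word.
\<close>

theorem bar_gens_eq: "bar_gens = (corolla_span :: ('a tree \<Rightarrow>\<^sub>0 'k::field) set)"
proof
  have "lin (\<lambda>t. bas (decorate t as)) c \<in> corolla_span"
    if c: "c \<in> uAs_dual" "c \<in> of_arity (length as)" for c :: "unit tree \<Rightarrow>\<^sub>0 'k" and as :: "'a list"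
    unfolding corolla_span_iff rotation_invariant_def
  proof (intro allI impI)
    fix s t :: "'a tree" assume st: "tree_word s = tree_word t"
    have "rotation_invariant c" using c(1) by (simp add: uAs_dual_eq corolla_span_iff)
    moreover have w: "tree_word (shape s) = tree_word (shape t)" and l: "leaves s = leaves t"
      using st by (simp_all add: tree_word_map_tree leaves_somes)
    ultimately have "tree_sign s * Poly_Mapping.lookup c (shape s)
        = tree_sign t * Poly_Mapping.lookup c (shape t)"
      unfolding rotation_invariant_def tree_sign_map_tree[symmetric, of s "\<lambda>_. ()"]
        tree_sign_map_tree[symmetric, of t "\<lambda>_. ()"] by blast
    then show "tree_sign s * Poly_Mapping.lookup (lin (\<lambda>t. bas (decorate t as)) c) s
        = tree_sign t * Poly_Mapping.lookup (lin (\<lambda>t. bas (decorate t as)) c) t"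
      unfolding lookup_decorate_sum[OF c(2)] l by simp
  qed
  then show "bar_gens \<subseteq> (corolla_span :: ('a tree \<Rightarrow>\<^sub>0 'k) set)"
    unfolding bar_gens_def by (intro fvs.span_minimal fvs.subspace_span) auto
  have "corolla w \<in> (bar_gens :: ('a tree \<Rightarrow>\<^sub>0 'k) set)" for w
    unfolding bar_gens_def
    by (rule fvs.span_base, subst decorate_corolla[symmetric], rule CollectI,
        rule exI[of _ "length (somes w)"], rule exI[of _ "corolla (block_shape w)"],
        rule exI[of _ "somes w"])
      (simp add: uAs_dual_eq corolla_shape_of_arity)
  then show "corolla_span \<subseteq> (bar_gens :: ('a tree \<Rightarrow>\<^sub>0 'k) set)"
    unfolding bar_gens_def by (intro fvs.span_minimal fvs.subspace_span) auto
qed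

section \<open>Composition of linear extensions\<close>

lemma hom_lin: "module_hom fscale fscale h \<Longrightarrow> h (lin f p) = lin (\<lambda>x. h (f x)) p"
  using fvs.hom_eq_on_basis[OF hom_compose[OF lin_hom] lin_hom, of h f "\<lambda>x. h (f x)" p]
  by (simp add: lin_bas)

lemma hom_bilin: "module_hom fscale fscale h \<Longrightarrow> h (bilin f p q) = bilin (\<lambda>x y. h (f x y)) p q"
  by (simp add: bilin_def hom_lin)

lemma bilin_lin_lin:
  "bilin g (lin f p) (lin f' q) = bilin (\<lambda>x y. bilin g (f x) (f' y)) p q"
proof -
  have "bilin g (lin f p) (lin f' q) = lin (\<lambda>x. bilin g (f x) (lin f' q)) p"
    by (rule hom_lin[OF bilin_hom_left])
  also have "\<dots> = lin (\<lambda>x. lin (\<lambda>y. bilin g (f x) (f' y)) q) p"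
    by (simp add: hom_lin[OF bilin_hom_right])
  finally show ?thesis by (simp add: bilin_def)
qed

lemma bilin_zero_fun [simp]: "bilin (\<lambda>x y. 0) p q = 0"
  by (simp add: bilin_def lin_zero_fun)

lemma bilin_diff_fun: "bilin (\<lambda>x y. f x y - g x y) p q = bilin f p q - bilin g p q"
  by (simp add: bilin_def lin_diff_fun)

lemma bilin_cong_keys:
  assumes "\<And>x y. x \<in> Poly_Mapping.keys p \<Longrightarrow> y \<in> Poly_Mapping.keys q \<Longrightarrow> f x y = g x y"
  shows "bilin f p q = bilin g p q"
  by (rule poly_mapping_eqI) (simp add: lookup_bilin assms)

lemma lin_cong_keys:
  assumes "\<And>x. x \<in> Poly_Mapping.keys p \<Longrightarrow> f x = g x"
  shows "lin f p = lin g p"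
  by (rule poly_mapping_eqI) (simp add: lookup_lin assms)

lemma lin_ident: "lin bas p = p"
proof -
  have "module_hom fscale fscale (\<lambda>x :: 'a \<Rightarrow>\<^sub>0 'b. x)" by unfold_locales auto
  then show ?thesis using fvs.hom_eq_on_basis[OF lin_hom, of "\<lambda>x. x" bas p] by (simp add: lin_bas)
qed

section \<open>The bar differential on trees\<close>

abbreviation unleaf :: "'a \<Rightarrow> 'a tree \<Rightarrow> 'a" where
  "unleaf b v \<equiv> (case v of Leaf a \<Rightarrow> a | _ \<Rightarrow> b)"

definition inner_vertices :: "'b tree tree \<Rightarrow> 'b tree list" where
  "inner_vertices x = filter (\<lambda>u. weight u \<noteq> 0) (leaves x)"

lemma inner_vertices_simps [simp]:
  "inner_vertices (Leaf u) = (if weight u = 0 then [] else [u])"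
  "inner_vertices Bullet = []"
  "inner_vertices (Mu x y) = inner_vertices x @ inner_vertices y"
  by (simp_all add: inner_vertices_def)

lemma weight_zero_is_leaf: "weight t = 0 \<Longrightarrow> \<exists>b. t = Leaf b"
  by (cases t) auto

lemma map_unleaf_cong:
  "inner_vertices x = [] \<Longrightarrow> map_tree (unleaf b) x = map_tree (unleaf c) x"
  by (induction x) (auto split: if_splits dest: weight_zero_is_leaf)

text \<open>
  The part of a cut that leaves nothing above but leaves.
\<close>

definition trivial_cut :: "'a tree tree \<Rightarrow> ('a tree \<Rightarrow>\<^sub>0 'k::field)" where
  "trivial_cut x = (if inner_vertices x = [] then bas (map_tree (unleaf undefined) x) else 0)"

lemma inner_weight_simps [simp]:
  "inner_weight (Leaf u) = weight u" "inner_weight Bullet = 0"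
  "inner_weight (Mu x y) = inner_weight x + inner_weight y"
  by (simp_all add: inner_weight_def)

lemma inner_weight_vertices: "inner_weight x = sum_list (map weight (inner_vertices x))"
  by (induction x) auto

lemma trivial_cut_Mu:
  "fscale ((-1) ^ (inner_weight x * n)) (trivial_cut (Mu x y)) = graft (trivial_cut x) (trivial_cut y)"
  by (auto simp: trivial_cut_def graft_simps graft_bas inner_weight_vertices)

lemma lin_single_bilin:
  "module_hom fscale fscale h \<Longrightarrow>
    h (bilin (\<lambda>x y. Poly_Mapping.single (f x y) (c x y)) p q)
      = bilin (\<lambda>x y. fscale (c x y) (h (bas (f x y)))) p q"
  by (simp add: hom_bilin module_hom.scale[symmetric] fscale_bas)

lemma lin_trivial_cut_decomp: "lin trivial_cut (decomp t) = (bas t :: _ \<Rightarrow>\<^sub>0 'k::field)"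
proof (induction t)
  case (Mu s t)
  have "lin trivial_cut (decomp (Mu s t))
      = (bilin (\<lambda>x y. graft (trivial_cut x) (trivial_cut y)) (decomp s) (decomp t) :: _ \<Rightarrow>\<^sub>0 'k)"
    by (simp add: lin_add lin_bas lin_single_bilin[OF lin_hom] trivial_cut_Mu)
      (simp add: trivial_cut_def)
  also have "\<dots> = graft (lin trivial_cut (decomp s)) (lin trivial_cut (decomp t))"
    by (simp add: graft_def bilin_lin_lin)
  finally show ?case by (simp add: Mu graft_bas)
qed (auto simp: lin_simps trivial_cut_def)

lemma lin_signed_trivial_cut_decomp:
  "lin (\<lambda>x. fscale ((-1) ^ weight x) (trivial_cut x)) (decomp t)
    = (fscale ((-1) ^ weight t) (bas t) :: _ \<Rightarrow>\<^sub>0 'k::field)"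
proof -
  have "fscale ((-1) ^ weight x) (trivial_cut x)
      = (lin (\<lambda>t. fscale ((-1) ^ weight t) (bas t)) (trivial_cut x) :: _ \<Rightarrow>\<^sub>0 'k)"
    for x :: "'a tree tree"
    by (simp add: trivial_cut_def lin_simps)
  then have "lin (\<lambda>x. fscale ((-1) ^ weight x) (trivial_cut x)) (decomp t)
      = (lin (\<lambda>t. fscale ((-1) ^ weight t) (bas t)) (lin trivial_cut (decomp t)) :: _ \<Rightarrow>\<^sub>0 'k)"
    by (simp add: hom_lin[OF lin_hom])
  then show ?thesis by (simp add: lin_trivial_cut_decomp lin_bas)
qed

lemma kappa_act_weight: "kappa_act e m u = Some b \<Longrightarrow> weight u = 1"
  by (induction e m u rule: kappa_act.induct) auto

lemma bar_term_inner:
  "bar_term x = (case inner_vertices x of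
        [u] \<Rightarrow> (case kappa_act 1 (*) u of
                 None \<Rightarrow> 0
               | Some b \<Rightarrow> Poly_Mapping.single (map_tree (unleaf b) x) ((-1) ^ weight x))
      | _ \<Rightarrow> 0)"
  by (simp add: bar_term_def inner_vertices_def)

lemma graft_single: "graft (Poly_Mapping.single s c) (Poly_Mapping.single t d) = Poly_Mapping.single (Mu s t) (c * d)"
proof -
  have "graft (fscale c (bas s)) (fscale d (bas t)) = fscale c (fscale d (bas (Mu s t)))"
    by (simp only: graft_simps graft_bas fvs.scale_left_commute)
  then show ?thesis by (simp add: fscale_bas fscale_single)
qed

text \<open>
  In a cut with exactly one upper vertex tree, that tree lies over the left or over the right
  subtree, and on the other side the cut is trivial.
\<close>

lemma bar_term_Mu:
  "(fscale ((-1) ^ (inner_weight x * weight y)) (bar_term (Mu x y)) :: _ \<Rightarrow>\<^sub>0 'k::field)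
    = - graft (bar_term x) (trivial_cut y)
      - graft (fscale ((-1) ^ weight x) (trivial_cut x)) (bar_term y)"
proof (cases "inner_vertices x")
  case x: Nil
  show ?thesis
  proof (cases "inner_vertices y")
    case Nil
    then show ?thesis by (simp add: bar_term_inner x graft_simps)
  next
    case (Cons u us)
    have iw: "inner_weight x = 0" by (simp add: inner_weight_vertices x)
    show ?thesis
    proof (cases "us = [] \<and> kappa_act 1 (*) u \<noteq> None")
      case True
      then obtain b where b: "kappa_act 1 (*) u = Some b" by auto
      have m: "map_tree (unleaf b) x = map_tree (unleaf undefined) x"
        by (rule map_unleaf_cong[OF x])
      show ?thesis using True Cons b
        by (simp add: bar_term_inner trivial_cut_def x iw m graft_simps graft_single fscale_single power_add
            single_uminus)
    next
      case False
      then show ?thesis using Cons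
        by (auto simp: bar_term_inner x graft_simps split: list.splits option.splits)
    qed
  qed
next
  case x: (Cons u us)
  have tx: "trivial_cut x = 0" by (simp add: trivial_cut_def x)
  show ?thesis
  proof (cases "us = [] \<and> kappa_act 1 (*) u \<noteq> None")
    case True
    then obtain b where b: "kappa_act 1 (*) u = Some b" by auto
    have iw: "inner_weight x = 1" using True x kappa_act_weight[OF b] by (simp add: inner_weight_vertices)
    show ?thesis
    proof (cases "inner_vertices y")
      case y: Nil
      have m: "map_tree (unleaf b) y = map_tree (unleaf undefined) y"
        by (rule map_unleaf_cong[OF y])
      have "(-1) ^ weight y * (-1) ^ weight y = (1::'k)" by (simp flip: power_add)
      then show ?thesis using True b
        by (simp add: bar_term_inner trivial_cut_def x y iw m graft_simps graft_single fscale_single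
            power_add single_uminus mult_ac)
    next
      case (Cons v vs)
      then show ?thesis using True b
        by (simp add: bar_term_inner trivial_cut_def x graft_simps)
    qed
  next
    case False
    then show ?thesis
      by (auto simp: bar_term_inner x tx graft_simps append_eq_Cons_conv split: list.splits option.splits)
  qed
qed

definition junction :: "'a::{ring,monoid_mult} tree \<Rightarrow> 'a tree \<Rightarrow> ('a tree \<Rightarrow>\<^sub>0 'k::field)" where
  "junction s t = (case s of Leaf a \<Rightarrow> (case t of Leaf b \<Rightarrow> bas (Leaf (a * b)) | _ \<Rightarrow> 0) | _ \<Rightarrow> 0)"

text \<open>
  \<open>bar_diff\<close> is, up to the term at the root, a derivation of degree -1 for grafting, where
  grafting itself has degree 1; hence the minus sign in front of the first term.
\<close>

lemma bar_diff_simps: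
  "bar_diff (Leaf a) = (0 :: _ \<Rightarrow>\<^sub>0 'k::field)"
  "bar_diff Bullet = (bas (Leaf 1) :: _ \<Rightarrow>\<^sub>0 'k)"
  "bar_diff (Mu s t) = (junction s t - graft (bar_diff s) (bas t)
     - fscale ((-1) ^ weight s) (graft (bas s) (bar_diff t)) :: _ \<Rightarrow>\<^sub>0 'k)"
proof -
  show "bar_diff (Leaf a) = (0 :: _ \<Rightarrow>\<^sub>0 'k)" "bar_diff Bullet = (bas (Leaf 1) :: _ \<Rightarrow>\<^sub>0 'k)"
    by (simp_all add: bar_diff_def lin_simps bar_term_def)
  have J: "bar_term (Leaf (Mu s t)) = (junction s t :: _ \<Rightarrow>\<^sub>0 'k)"
    by (cases s; cases t) (simp_all add: bar_term_def junction_def)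
  have "(bar_diff (Mu s t) :: _ \<Rightarrow>\<^sub>0 'k) = bar_term (Leaf (Mu s t))
      + bilin (\<lambda>x y. fscale ((-1) ^ (inner_weight x * weight y)) (bar_term (Mu x y))) (decomp s) (decomp t)"
    by (simp add: bar_diff_def lin_add lin_bas lin_single_bilin[OF lin_hom])
  also have "bilin (\<lambda>x y. fscale ((-1) ^ (inner_weight x * weight y)) (bar_term (Mu x y))) (decomp s) (decomp t)
      = bilin (\<lambda>x y. graft (- bar_term x) (trivial_cut y)) (decomp s) (decomp t)
       - (bilin (\<lambda>x y. graft (fscale ((-1) ^ weight x) (trivial_cut x)) (bar_term y)) (decomp s) (decomp t) :: _ \<Rightarrow>\<^sub>0 'k)"
    by (simp add: bar_term_Mu bilin_diff_fun[symmetric] graft_simps)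
  also have "bilin (\<lambda>x y. graft (- bar_term x) (trivial_cut y)) (decomp s) (decomp t)
      = (graft (lin (\<lambda>x. - bar_term x) (decomp s)) (bas t) :: _ \<Rightarrow>\<^sub>0 'k)"
  proof -
    have T: "(bas t :: _ \<Rightarrow>\<^sub>0 'k) = lin trivial_cut (decomp t)" by (simp add: lin_trivial_cut_decomp)
    show ?thesis by (simp only: graft_def T bilin_lin_lin)
  qed
  also have "lin (\<lambda>x. - bar_term x) (decomp s) = (- bar_diff s :: _ \<Rightarrow>\<^sub>0 'k)"
    using lin_diff_fun[of "\<lambda>_. 0" bar_term "decomp s"] by (simp add: lin_zero_fun bar_diff_def)
  also have "bilin (\<lambda>x y. graft (fscale ((-1) ^ weight x) (trivial_cut x)) (bar_term y)) (decomp s) (decomp t)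
      = (graft (lin (\<lambda>x. fscale ((-1) ^ weight x) (trivial_cut x)) (decomp s)) (bar_diff t) :: _ \<Rightarrow>\<^sub>0 'k)"
    by (simp add: graft_def bilin_lin_lin bar_diff_def)
  finally show "(bar_diff (Mu s t) :: _ \<Rightarrow>\<^sub>0 'k) = junction s t - graft (bar_diff s) (bas t)
     - fscale ((-1) ^ weight s) (graft (bas s) (bar_diff t))"
    by (simp add: J lin_signed_trivial_cut_decomp graft_simps)
qed

section \<open>The cobar differential on trees\<close>

lemmas wmult_simps = bilin_simps[of "\<lambda>u v. bas (u @ v)", folded wmult_def]
lemmas wmult_bas = bilin_bas[of "\<lambda>u v. bas (u @ v)", folded wmult_def]
lemmas wmult_hom_left = bilin_hom_left[of "\<lambda>u v. bas (u @ v)", folded wmult_def]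
lemmas wmult_hom_right = bilin_hom_right[of "\<lambda>u v. bas (u @ v)", folded wmult_def]

definition emb :: "('x \<Rightarrow>\<^sub>0 'k::field) \<Rightarrow> ('x list \<Rightarrow>\<^sub>0 'k)" where
  "emb = lin (\<lambda>t. bas [t])"

lemma emb_hom: "module_hom fscale fscale emb"
  unfolding emb_def by (rule lin_hom)

lemmas emb_simps = module_hom.add[OF emb_hom] module_hom.scale[OF emb_hom]
  module_hom.zero[OF emb_hom] module_hom.diff[OF emb_hom] module_hom.neg[OF emb_hom]

lemma emb_bas [simp]: "emb (bas t) = bas [t]"
  by (simp add: emb_def lin_bas)

text \<open>
  Selects the trivial lower tree in each argument of the binary generator, the only case where
  \<open>\<kappa>\<close> does not vanish.
\<close>

definition lower_pair :: "'a tree tree \<Rightarrow> ('a tree list \<Rightarrow>\<^sub>0 'k::field)" where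
  "lower_pair x = (case x of Leaf t \<Rightarrow> bas [t] | _ \<Rightarrow> 0)"

lemma lin_lower_pair_decomp: "lin lower_pair (decomp t) = (bas [t] :: _ \<Rightarrow>\<^sub>0 'k::field)"
proof (cases t)
  case (Mu a b)
  then show ?thesis
    by (simp add: lin_add lin_bas lin_single_bilin[OF lin_hom]) (simp add: lower_pair_def)
qed (auto simp: lin_simps lower_pair_def)

lemma cobar_diff_simps:
  fixes s t :: "'a tree"
  shows "cobar_diff (Leaf a) = (0 :: 'a tree list \<Rightarrow>\<^sub>0 'k::field)"
  "cobar_diff Bullet = (bas [] :: 'a tree list \<Rightarrow>\<^sub>0 'k)"
  "cobar_diff (Mu s t) = (bas [s, t] :: _ \<Rightarrow>\<^sub>0 'k)"
proof -
  let ?f = "\<lambda>x :: 'a tree tree. (case kappa_act [] (@) (map_tree (\<lambda>u. [u]) x) of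
     None \<Rightarrow> 0 | Some w \<Rightarrow> bas w) :: _ \<Rightarrow>\<^sub>0 'k"
  show "cobar_diff (Leaf a) = (0 :: 'a tree list \<Rightarrow>\<^sub>0 'k)"
    "cobar_diff Bullet = (bas [] :: 'a tree list \<Rightarrow>\<^sub>0 'k)"
    by (simp_all add: cobar_diff_def lin_simps)
  have f: "fscale ((-1) ^ (inner_weight x * weight y)) (?f (Mu x y)) = wmult (lower_pair x) (lower_pair y)" for x y
    by (cases x; cases y) (simp_all add: lower_pair_def wmult_bas wmult_simps)
  have "cobar_diff (Mu s t) = bilin (\<lambda>x y. fscale ((-1) ^ (inner_weight x * weight y)) (?f (Mu x y))) (decomp s) (decomp t)"
    unfolding cobar_diff_def by (simp add: lin_add lin_bas lin_single_bilin[OF lin_hom])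
  also have "\<dots> = wmult (lin lower_pair (decomp s)) (lin lower_pair (decomp t))"
    by (simp only: f) (simp add: wmult_def bilin_lin_lin)
  finally show "cobar_diff (Mu s t) = (bas [s, t] :: _ \<Rightarrow>\<^sub>0 'k)" by (simp add: lin_lower_pair_decomp wmult_bas)
qed

section \<open>Signed sums over the faces of a word\<close>

text \<open>
  Multiplication by \<open>(-1)^n\<close> in any abelian group, so that signs need no scalars.
\<close>

definition pm :: "nat \<Rightarrow> 'm::ab_group_add \<Rightarrow> 'm" where
  "pm n x = (if even n then x else - x)"

lemma pm_simps [simp]: "pm 0 x = x" "pm (Suc n) x = - pm n x" "pm n 0 = 0" "pm n (- x) = - pm n x"
  "pm n (pm n x) = x"
  by (auto simp: pm_def)

lemma pm_two [simp]: "pm 2 x = x"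
  by (simp add: pm_def)

lemma pm_add: "pm n (x + y) = pm n x + pm n y" and pm_diff: "pm n (x - y) = pm n x - pm n y"
  and pm_plus: "pm (m + n) x = pm m (pm n x)" and pm_commute: "pm m (pm n x) = pm n (pm m x)"
  by (auto simp: pm_def)

lemma (in vector_space) scale_pm: "scale ((-1) ^ n) x = pm n x"
  by (auto simp: pm_def)

lemma lin_pm: "lin f (pm n p) = pm n (lin f p)"
  by (simp add: pm_def lin_neg)

lemma fscale_pm: "fscale ((-1) ^ n) x = pm n x"
  by (rule fvs.scale_pm)

lemma pm_hom: "(\<And>x y. f (x + y) = f x + f y) \<Longrightarrow> f (pm n x) = pm n (f x)"
  for f :: "'x::ab_group_add \<Rightarrow> 'y::ab_group_add"
proof -
  assume a: "\<And>x y. f (x + y) = f x + f y"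
  have "f 0 = 0" using a[of 0 0] by simp
  then have "f (- x) = - f x" using a[of x "- x"] by (simp add: eq_neg_iff_add_eq_0 add.commute)
  then show ?thesis by (simp add: pm_def)
qed

text \<open>
  The face of \<open>x # w\<close> at its first letter: a cork becomes \<open>1\<close>, and a letter of \<open>A\<close> is
  multiplied with the next one.
\<close>

fun head_sum :: "('a::{ring,monoid_mult} option list \<Rightarrow> 'm::ab_group_add) \<Rightarrow> 'a option \<Rightarrow> 'a option list \<Rightarrow> 'm" where
  "head_sum \<psi> None w = \<psi> (Some 1 # w)"
| "head_sum \<psi> (Some a) (Some b # w) = \<psi> (Some (a * b) # w)"
| "head_sum \<psi> (Some a) (None # w) = 0"
| "head_sum \<psi> (Some a) [] = 0"

lemma head_sum_None: "head_sum g None = (\<lambda>w. g (Some 1 # w))"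
  by (rule ext) simp

primrec bar_sum :: "'a::{ring,monoid_mult} option list \<Rightarrow> ('a option list \<Rightarrow> 'm::ab_group_add) \<Rightarrow> 'm" where
  "bar_sum [] \<psi> = 0"
| "bar_sum (x # w) \<psi> = head_sum \<psi> x w + pm (ldeg x) (bar_sum w (\<lambda>v. \<psi> (x # v)))"

lemma head_sum_add: "head_sum (\<lambda>v. \<phi> v + \<psi> v) x w = head_sum \<phi> x w + head_sum \<psi> x w"
  by (induction \<phi> x w rule: head_sum.induct) auto

lemma bar_sum_add: "bar_sum w (\<lambda>v. \<phi> v + \<psi> v) = bar_sum w \<phi> + bar_sum w \<psi>"
  by (induction w arbitrary: \<phi> \<psi>) (auto simp: head_sum_add pm_add algebra_simps)

lemma head_sum_hom: "f 0 = 0 \<Longrightarrow> head_sum (\<lambda>v. f (\<psi> v)) x w = f (head_sum \<psi> x w)"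
  by (induction \<psi> x w rule: head_sum.induct) auto

lemma bar_sum_hom:
  assumes "\<And>x y. f (x + y) = f x + f y"
  shows "f (bar_sum w \<psi>) = bar_sum w (\<lambda>v. f (\<psi> v))"
proof (induction w arbitrary: \<psi>)
  case Nil
  show ?case using assms[of 0 0] by simp
next
  case (Cons x w)
  have "f 0 = 0" using assms[of 0 0] by simp
  then show ?case using Cons by (simp add: assms head_sum_hom pm_hom[of f, OF assms])
qed

lemma bar_sum_zero [simp]: "bar_sum w (\<lambda>_. 0) = 0"
  using bar_sum_add[of w "\<lambda>_. 0" "\<lambda>_. 0"] by simp

lemma bar_sum_cong:
  "(\<And>v. v \<noteq> [] \<Longrightarrow> Suc (wdeg v) = wdeg w \<Longrightarrow> length w \<le> Suc (length v) \<Longrightarrow> \<phi> v = \<psi> v)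
    \<Longrightarrow> bar_sum w \<phi> = bar_sum w \<psi>"
proof (induction w arbitrary: \<phi> \<psi>)
  case (Cons x w)
  have "head_sum \<phi> x w = head_sum \<psi> x w"
  proof (cases x)
    case None
    then show ?thesis using Cons.prems[of "Some 1 # w"] by simp
  next
    case (Some a)
    show ?thesis
    proof (cases w)
      case w: (Cons y w')
      show ?thesis
      proof (cases y)
        case (Some b)
        then show ?thesis using Cons.prems[of "Some (a * b) # w'"] w \<open>x = Some a\<close> by simp
      qed (simp add: w Some)
    qed (simp add: Some)
  qed
  moreover have "bar_sum w (\<lambda>v. \<phi> (x # v)) = bar_sum w (\<lambda>v. \<psi> (x # v))"
    by (rule Cons.IH) (simp add: Cons.prems)
  ultimately show ?case by simp
qed simp

lemma head_sum_split:
  assumes "w \<noteq> []"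
  shows "head_sum (split_sum \<phi>) x w
    = bar_sum [x] (\<lambda>u. \<phi> u w) + split_sum (\<lambda>u v. head_sum (\<lambda>u'. \<phi> u' v) x u) w"
proof -
  obtain y w' where w: "w = y # w'" using assms by (cases w) auto
  show ?thesis
  proof (cases x)
    case None
    then show ?thesis by (simp add: w)
  next
    case x: (Some a)
    show ?thesis
    proof (cases y)
      case None
      have "split_sum (\<lambda>u v. head_sum (\<lambda>u'. \<phi> u' v) x u) w = split_sum (\<lambda>u v. 0) w"
        by (rule split_sum_cong) (auto simp: w None x append_eq_Cons_conv)
      then show ?thesis by (simp add: x w None)
    next
      case (Some b)
      then show ?thesis by (cases w') (simp_all add: x w)
    qed
  qed
qed

text \<open>
  The faces form a coderivation for cutting words in two. A face that multiplies two letters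
  never separates them, and no cut of a face corresponds to a cut between them.
\<close>

lemma bar_sum_split:
  fixes w :: "'a::{ring,monoid_mult} option list" and \<phi> :: "_ \<Rightarrow> _ \<Rightarrow> 'b::ab_group_add"
  shows "bar_sum w (split_sum \<phi>) = split_sum (\<lambda>u v. bar_sum u (\<lambda>u'. \<phi> u' v)) w
    + split_sum (\<lambda>u v. pm (wdeg u) (bar_sum v (\<phi> u))) w"
proof (induction w arbitrary: \<phi>)
  case (Cons x w)
  show ?case
  proof (cases w)
    case Nil
    then show ?thesis by (cases x) auto
  next
    case w: (Cons y w')
    have "bar_sum w (\<lambda>v. split_sum \<phi> (x # v)) = bar_sum w (\<lambda>v. \<phi> [x] v + split_sum (\<lambda>u. \<phi> (x # u)) v)"
    proof (rule bar_sum_cong)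
      fix v :: "'a option list" assume "v \<noteq> []"
      then show "split_sum \<phi> (x # v) = \<phi> [x] v + split_sum (\<lambda>u. \<phi> (x # u)) v" by (cases v) auto
    qed
    then have L: "bar_sum w (\<lambda>v. split_sum \<phi> (x # v)) = bar_sum w (\<phi> [x])
        + (split_sum (\<lambda>u v. bar_sum u (\<lambda>u'. \<phi> (x # u') v)) w
          + split_sum (\<lambda>u v. pm (wdeg u) (bar_sum v (\<phi> (x # u)))) w)"
      by (simp add: bar_sum_add Cons.IH)
    have step: "split_sum \<psi> (x # w) = \<psi> [x] w + split_sum (\<lambda>u. \<psi> (x # u)) w" for \<psi> :: "_ \<Rightarrow> _ \<Rightarrow> 'b"
      by (simp add: w)
    have P: "pm n (split_sum \<psi> w) = split_sum (\<lambda>u v. pm n (\<psi> u v)) w" for n and \<psi> :: "_ \<Rightarrow> _ \<Rightarrow> 'b"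
      by (rule split_sum_hom) (auto simp: pm_add)
    have wne: "w \<noteq> []" by (simp add: w)
    show ?thesis
      unfolding step bar_sum.simps(2)[of x w] L head_sum_split[OF wne]
      by (simp add: split_sum_add pm_add P pm_plus add_ac)
  qed
qed simp

section \<open>Differentials of corollas\<close>

definition head_part :: "'a option list \<Rightarrow> ('a tree \<Rightarrow>\<^sub>0 'k::field)" where
  "head_part w = (case w of [x] \<Rightarrow> bas (letter x) | _ \<Rightarrow> 0)"

lemma corolla_rec:
  "(corolla w :: _ \<Rightarrow>\<^sub>0 'k::field) = head_part w + split_sum (\<lambda>u v. - pm (wdeg u) (graft (corolla u) (corolla v))) w"
proof (cases "length w = 1")
  case True
  then obtain x where "w = [x]" by (auto simp: length_Suc_conv)
  then show ?thesis by (simp add: corolla_letter head_part_def)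
next
  case False
  then have "head_part w = (0 :: _ \<Rightarrow>\<^sub>0 'k)" by (auto simp: head_part_def split: list.splits)
  then show ?thesis by (simp only: corolla_split[OF False] fscale_pm pm_simps add_0)
qed

lemma graft_pm: "graft (pm n p) q = pm n (graft p q)" "graft p (pm n q) = pm n (graft p q)"
  by (auto simp: pm_def graft_simps)

lemma lin_bar_diff_graft:
  "lin bar_diff (graft p q) = bilin junction p q - graft (lin bar_diff p) q
    - graft (lin (\<lambda>t. fscale ((-1) ^ weight t) (bas t)) p) (lin bar_diff q)"
proof -
  have "lin bar_diff (graft p q) = bilin (\<lambda>s t. bar_diff (Mu s t)) p q"
    unfolding graft_def by (subst hom_bilin[OF lin_hom]) (simp add: lin_bas)
  also have "\<dots> = bilin junction p q - bilin (\<lambda>s t. graft (bar_diff s) (bas t)) p q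
      - bilin (\<lambda>s t. graft (fscale ((-1) ^ weight s) (bas s)) (bar_diff t)) p q"
    by (simp add: bar_diff_simps bilin_diff_fun graft_simps)
  also have "bilin (\<lambda>s t. graft (bar_diff s) (bas t)) p q = graft (lin bar_diff p) q"
    using bilin_lin_lin[of "\<lambda>s t. bas (Mu s t)" bar_diff p bas q] by (simp add: graft_def lin_ident)
  also have "bilin (\<lambda>s t. graft (fscale ((-1) ^ weight s) (bas s)) (bar_diff t)) p q
      = graft (lin (\<lambda>t. fscale ((-1) ^ weight t) (bas t)) p) (lin bar_diff q)"
    by (simp add: graft_def bilin_lin_lin)
  finally show ?thesis .
qed

lemma lin_sign_corolla:
  "lin (\<lambda>t. fscale ((-1) ^ weight t) (bas t)) (corolla u) = (- pm (wdeg u) (corolla u) :: _ \<Rightarrow>\<^sub>0 'k::field)"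
proof -
  have "(lin (\<lambda>t. fscale ((-1) ^ weight t) (bas t)) (corolla u) :: _ \<Rightarrow>\<^sub>0 'k)
      = lin (\<lambda>t. fscale (- ((-1) ^ wdeg u)) (bas t)) (corolla u)"
  proof (rule lin_cong_keys)
    fix t assume "t \<in> Poly_Mapping.keys (corolla u :: _ \<Rightarrow>\<^sub>0 'k)"
    then have "wdeg u = Suc (weight t)" using keys_corolla wdeg_tree_word by metis
    then show "fscale ((-1) ^ weight t) (bas t) = fscale (- ((-1) ^ wdeg u)) (bas t :: _ \<Rightarrow>\<^sub>0 'k)" by simp
  qed
  also have "\<dots> = fscale (- ((-1) ^ wdeg u)) (corolla u)"
    by (simp add: lin_scale_fun lin_ident del: fvs.scale_minus_left)
  finally show ?thesis by (simp add: fscale_pm)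
qed

lemma junction_corolla:
  "bilin junction (corolla u) (corolla v)
    = (case u of [Some a] \<Rightarrow> (case v of [Some b] \<Rightarrow> bas (Leaf (a * b)) | _ \<Rightarrow> 0) | _ \<Rightarrow> 0)" (is "_ = ?r")
proof (cases "(\<exists>a. u = [Some a]) \<and> (\<exists>b. v = [Some b])")
  case True
  then show ?thesis by (auto simp: corolla_letter bilin_bas junction_def)
next
  case False
  have "bilin junction (corolla u) (corolla v) = bilin (\<lambda>_ _. 0) (corolla u) (corolla v :: _ \<Rightarrow>\<^sub>0 'b)"
  proof (rule bilin_cong_keys)
    fix s t assume "s \<in> Poly_Mapping.keys (corolla u :: _ \<Rightarrow>\<^sub>0 'b)" "t \<in> Poly_Mapping.keys (corolla v :: _ \<Rightarrow>\<^sub>0 'b)"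
    then have "tree_word s = u" "tree_word t = v" by (auto dest: keys_corolla)
    then show "junction s t = (0 :: _ \<Rightarrow>\<^sub>0 'b)" using False
      by (cases s; cases t) (auto simp: junction_def)
  qed
  moreover have "?r = 0" using False by (auto split: list.splits option.splits)
  ultimately show ?thesis by simp
qed

text \<open>
  Both sides satisfy the same recursion along cuts of the word: \<open>bar_diff\<close> is a derivation
  for grafting and the faces are a coderivation for cutting. The term at the root only contributes
  for words of two letters of \<open>A\<close>.
\<close>

theorem bar_diff_corolla:
  fixes w :: "'a::{ring,monoid_mult} option list"
  shows "lin bar_diff (corolla w) = (bar_sum w corolla :: _ \<Rightarrow>\<^sub>0 'k::field)"
proof (induction "length w" arbitrary: w rule: less_induct)
  case less
  show ?case
  proof (cases "length w \<le> 1")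
    case True
    then consider "w = []" | x where "w = [x]" by (cases w) auto
    then show ?thesis
    proof cases
      case 2
      then show ?thesis
        by (cases x) (simp_all add: corolla_letter lin_bas bar_diff_simps)
    qed (simp add: lin_zero)
  next
    case False
    let ?c = "corolla :: 'a option list \<Rightarrow> 'a tree \<Rightarrow>\<^sub>0 'k" and ?h = "head_part :: 'a option list \<Rightarrow> 'a tree \<Rightarrow>\<^sub>0 'k"
    let ?J = "\<lambda>u v. bilin junction (?c u) (?c v)"
    let ?A = "\<lambda>u v. pm (wdeg u) (graft (bar_sum u ?c) (?c v))"
    let ?B = "\<lambda>u v. - graft (?c u) (bar_sum v ?c)"
    have h0: "?h w = 0" using False by (auto simp: head_part_def split: list.splits)
    have "lin bar_diff (?c w) = split_sum (\<lambda>u v. lin bar_diff (- pm (wdeg u) (graft (?c u) (?c v)))) w"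
      by (subst corolla_rec, simp add: h0) (rule split_sum_hom; simp add: lin_simps)
    also have "\<dots> = split_sum (\<lambda>u v. - pm (wdeg u) (?J u v) + (?A u v + ?B u v)) w"
    proof (rule split_sum_cong)
      fix u v assume uv: "u @ v = w" "u \<noteq> []" "v \<noteq> []"
      then have IH: "lin bar_diff (?c u) = bar_sum u ?c" "lin bar_diff (?c v) = bar_sum v ?c"
        using less[of u] less[of v] by auto
      have "lin bar_diff (- pm (wdeg u) (graft (?c u) (?c v))) = - pm (wdeg u) (lin bar_diff (graft (?c u) (?c v)))"
        by (simp add: lin_neg lin_pm)
      then show "lin bar_diff (- pm (wdeg u) (graft (?c u) (?c v))) = - pm (wdeg u) (?J u v) + (?A u v + ?B u v)"
        by (simp add: lin_bar_diff_graft IH lin_sign_corolla graft_simps graft_pm pm_add pm_diff)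
    qed
    also have "\<dots> = split_sum (\<lambda>u v. - pm (wdeg u) (?J u v)) w + (split_sum ?A w + split_sum ?B w)"
      by (simp only: split_sum_add)
    also have "split_sum (\<lambda>u v. - pm (wdeg u) (?J u v)) w = bar_sum w ?h"
    proof -
      obtain x y w' where w: "w = x # y # w'" using False by (cases w rule: remdups_adj.cases) auto
      show ?thesis
      proof (cases w')
        case Nil
        then show ?thesis by (cases x; cases y) (simp_all add: w junction_corolla head_part_def)
      next
        case (Cons z w'')
        have "split_sum (\<lambda>u v. - pm (wdeg u) (?J u v)) w = split_sum (\<lambda>u v. 0) w"
          by (rule split_sum_cong)
            (auto simp: w Cons junction_corolla append_eq_Cons_conv split: list.splits option.splits)
        moreover have "bar_sum w ?h = bar_sum w (\<lambda>_. 0)"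
          by (rule bar_sum_cong) (auto simp: w Cons head_part_def split: list.splits)
        ultimately show ?thesis by simp
      qed
    qed
    also have "split_sum ?A w = split_sum (\<lambda>u v. bar_sum u (\<lambda>u'. - pm (wdeg u') (graft (?c u') (?c v)))) w"
    proof (rule split_sum_cong)
      fix u v :: "'a option list"
      have "bar_sum u (\<lambda>u'. - pm (wdeg u') (graft (?c u') (?c v))) = bar_sum u (\<lambda>u'. pm (wdeg u) (graft (?c u') (?c v)))"
      proof (rule bar_sum_cong)
        fix u' :: "'a option list" assume "Suc (wdeg u') = wdeg u"
        then have "wdeg u = Suc (wdeg u')" by simp
        then show "- pm (wdeg u') (graft (?c u') (?c v)) = pm (wdeg u) (graft (?c u') (?c v))" by simp
      qed
      also have "\<dots> = ?A u v"
        by (rule bar_sum_hom[symmetric]) (simp add: graft_simps pm_add)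
      finally show "?A u v = bar_sum u (\<lambda>u'. - pm (wdeg u') (graft (?c u') (?c v)))" by simp
    qed
    also have "split_sum ?B w = split_sum (\<lambda>u v. pm (wdeg u) (bar_sum v (\<lambda>v'. - pm (wdeg u) (graft (?c u) (?c v'))))) w"
    proof (rule split_sum_cong)
      fix u v :: "'a option list"
      have "bar_sum v (\<lambda>v'. - pm (wdeg u) (graft (?c u) (?c v'))) = - pm (wdeg u) (graft (?c u) (bar_sum v ?c))"
        by (rule bar_sum_hom[symmetric]) (simp add: graft_simps pm_add)
      then show "?B u v = pm (wdeg u) (bar_sum v (\<lambda>v'. - pm (wdeg u) (graft (?c u) (?c v'))))" by simp
    qed
    also have "split_sum (\<lambda>u v. bar_sum u (\<lambda>u'. - pm (wdeg u') (graft (?c u') (?c v)))) w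
        + split_sum (\<lambda>u v. pm (wdeg u) (bar_sum v (\<lambda>v'. - pm (wdeg u) (graft (?c u) (?c v'))))) w
        = bar_sum w (split_sum (\<lambda>u v. - pm (wdeg u) (graft (?c u) (?c v))))"
      by (rule bar_sum_split[symmetric])
    also have "bar_sum w ?h + bar_sum w (split_sum (\<lambda>u v. - pm (wdeg u) (graft (?c u) (?c v))))
       = bar_sum w ?c"
    proof -
      have "bar_sum w ?c = bar_sum w (\<lambda>v. ?h v + split_sum (\<lambda>u v. - pm (wdeg u) (graft (?c u) (?c v))) v)"
        by (rule arg_cong[where f = "bar_sum w"]) (rule ext, rule corolla_rec)
      then show ?thesis by (simp only: bar_sum_add)
    qed
    finally show ?thesis .
  qed
qed

theorem cobar_diff_corolla:
  "(lin cobar_diff (corolla w) :: _ \<Rightarrow>\<^sub>0 'k::field) = (if w = [None] then bas [] else 0)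
    + split_sum (\<lambda>u v. - pm (wdeg u) (wmult (emb (corolla u)) (emb (corolla v)))) w"
proof -
  have g: "lin cobar_diff (graft p q) = wmult (emb p) (emb q)" for p q :: "'a tree \<Rightarrow>\<^sub>0 'k"
  proof -
    have "lin cobar_diff (graft p q) = bilin (\<lambda>s t. wmult (bas [s]) (bas [t])) p q"
      unfolding graft_def by (subst hom_bilin[OF lin_hom]) (simp add: lin_bas cobar_diff_simps wmult_bas)
    then show ?thesis by (simp add: wmult_def emb_def bilin_lin_lin)
  qed
  have "lin cobar_diff (head_part w) = (if w = [None] then bas [] else 0 :: _ \<Rightarrow>\<^sub>0 'k)"
    by (auto simp: head_part_def letter_def lin_simps cobar_diff_simps split: list.splits option.splits)
  moreover have "(lin cobar_diff (split_sum (\<lambda>u v. - pm (wdeg u) (graft (corolla u) (corolla v))) w) :: _ \<Rightarrow>\<^sub>0 'k)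
      = split_sum (\<lambda>u v. lin cobar_diff (- pm (wdeg u) (graft (corolla u) (corolla v)))) w"
    by (rule split_sum_hom) (simp_all add: lin_simps)
  ultimately show ?thesis
    by (subst corolla_rec) (simp add: lin_add lin_neg lin_pm g)
qed

section \<open>Augmented dg algebras\<close>

text \<open>
  What the constructions below use of a dg algebra whose elements form a carrier set, here of
  cosets; hence the closure conditions.
\<close>

locale dg_algebra =
  fixes Q :: "('k::field, 'q) dga"
  assumes add_closed: "x \<in> vcar Q \<Longrightarrow> y \<in> vcar Q \<Longrightarrow> vadd Q x y \<in> vcar Q"
    and smul_closed: "x \<in> vcar Q \<Longrightarrow> vsmul Q c x \<in> vcar Q"
    and mult_closed: "x \<in> vcar Q \<Longrightarrow> y \<in> vcar Q \<Longrightarrow> amult Q x y \<in> vcar Q"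
    and one_closed: "aone Q \<in> vcar Q"
    and diff_closed: "x \<in> vcar Q \<Longrightarrow> vdiff Q x \<in> vcar Q"
    and inv_closed: "x \<in> vcar Q \<Longrightarrow> ainv Q x \<in> vcar Q"
    and diff_add: "x \<in> vcar Q \<Longrightarrow> y \<in> vcar Q \<Longrightarrow>
      vdiff Q (vadd Q x y) = vadd Q (vdiff Q x) (vdiff Q y)"
    and diff_smul: "x \<in> vcar Q \<Longrightarrow> vdiff Q (vsmul Q c x) = vsmul Q c (vdiff Q x)"
    and diff_mult: "x \<in> vcar Q \<Longrightarrow> y \<in> vcar Q \<Longrightarrow> vdiff Q (amult Q x y)
      = vadd Q (amult Q (vdiff Q x) y) (amult Q (ainv Q x) (vdiff Q y))"
    and inv_add: "x \<in> vcar Q \<Longrightarrow> y \<in> vcar Q \<Longrightarrow>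
      ainv Q (vadd Q x y) = vadd Q (ainv Q x) (ainv Q y)"
    and inv_smul: "x \<in> vcar Q \<Longrightarrow> ainv Q (vsmul Q c x) = vsmul Q c (ainv Q x)"
    and inv_mult: "x \<in> vcar Q \<Longrightarrow> y \<in> vcar Q \<Longrightarrow>
      ainv Q (amult Q x y) = amult Q (ainv Q x) (ainv Q y)"
    and mult_add_left: "x \<in> vcar Q \<Longrightarrow> y \<in> vcar Q \<Longrightarrow> z \<in> vcar Q \<Longrightarrow>
      amult Q (vadd Q x y) z = vadd Q (amult Q x z) (amult Q y z)"
    and mult_add_right: "x \<in> vcar Q \<Longrightarrow> y \<in> vcar Q \<Longrightarrow> z \<in> vcar Q \<Longrightarrow>
      amult Q x (vadd Q y z) = vadd Q (amult Q x y) (amult Q x z)"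
    and mult_smul_left: "x \<in> vcar Q \<Longrightarrow> y \<in> vcar Q \<Longrightarrow>
      amult Q (vsmul Q c x) y = vsmul Q c (amult Q x y)"
    and mult_smul_right: "x \<in> vcar Q \<Longrightarrow> y \<in> vcar Q \<Longrightarrow>
      amult Q x (vsmul Q c y) = vsmul Q c (amult Q x y)"
    and mult_assoc: "x \<in> vcar Q \<Longrightarrow> y \<in> vcar Q \<Longrightarrow> z \<in> vcar Q \<Longrightarrow>
      amult Q (amult Q x y) z = amult Q x (amult Q y z)"
    and one_left: "x \<in> vcar Q \<Longrightarrow> amult Q (aone Q) x = x"
    and one_right: "x \<in> vcar Q \<Longrightarrow> amult Q x (aone Q) = x"
    and one_hcomp: "aone Q \<in> hcomp Q 0"

locale augmented_dg_algebra = dg_algebra Q + A: unital_algebra scaleA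
  for Q :: "('k::field, 'q) dga" and scaleA :: "'k \<Rightarrow> 'a::{ring,monoid_mult} \<Rightarrow> 'a" +
  fixes \<epsilon> :: "'q \<Rightarrow> 'a"
  assumes aug_add: "x \<in> vcar Q \<Longrightarrow> y \<in> vcar Q \<Longrightarrow> \<epsilon> (vadd Q x y) = \<epsilon> x + \<epsilon> y"
    and aug_smul: "x \<in> vcar Q \<Longrightarrow> \<epsilon> (vsmul Q c x) = scaleA c (\<epsilon> x)"
    and aug_mult: "x \<in> vcar Q \<Longrightarrow> y \<in> vcar Q \<Longrightarrow> \<epsilon> (amult Q x y) = \<epsilon> x * \<epsilon> y"
    and aug_one: "\<epsilon> (aone Q) = 1"
    and aug_diff: "x \<in> vcar Q \<Longrightarrow> \<epsilon> (vdiff Q x) = 0"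
    and aug_inv: "x \<in> vcar Q \<Longrightarrow> \<epsilon> (ainv Q x) = \<epsilon> x"
    and aug_hcomp: "x \<in> hcomp Q n \<Longrightarrow> n \<noteq> 0 \<Longrightarrow> \<epsilon> x = 0"

section \<open>The tensor algebra on trees\<close>

lemma fscale_pm_right: "fscale c (pm n p) = pm n (fscale c p)"
  by (simp add: pm_def)

lemma wmult_assoc: "wmult (wmult p q) r = wmult p (wmult q r)"
proof (induction p q rule: basis_induct2)
  case (single c d x y)
  have "wmult (wmult (bas x) (bas y)) r = wmult (bas x) (wmult (bas y) r)"
    by (induction r rule: basis_induct) (simp_all add: wmult_simps wmult_bas)
  then show ?case by (simp only: wmult_simps)
qed (simp_all add: wmult_simps)

lemma wmult_one [simp]: "wmult (bas []) p = p" "wmult p (bas []) = p"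
  by (induction p rule: basis_induct) (simp_all add: wmult_simps wmult_bas)

lemma ftensor_Cons: "ftensor (p # ps) = wmult (emb p) (ftensor ps)"
proof -
  have "bilin (\<lambda>x xs. bas (x # xs)) p q = wmult (emb p) q" for q :: "'a list \<Rightarrow>\<^sub>0 'b"
    by (induction p q rule: basis_induct2)
      (simp_all add: bilin_simps bilin_bas emb_simps wmult_simps wmult_bas)
  then show ?thesis by simp
qed

lemma ftensor_Nil: "ftensor [] = bas []"
  by simp

declare ftensor.simps [simp del]

lemma ftensor_append: "ftensor (ps @ qs) = wmult (ftensor ps) (ftensor qs)"
  by (induction ps) (simp_all add: ftensor_Nil ftensor_Cons wmult_assoc)

lemma ftensor_single: "ftensor [p] = emb p"
  by (simp add: ftensor_Nil ftensor_Cons)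

lemma ftensor_bas: "ftensor (map (\<lambda>x. bas x) w) = bas w"
  by (induction w) (simp_all add: ftensor_Nil ftensor_Cons wmult_bas)

abbreviation winv :: "('b tree list \<Rightarrow>\<^sub>0 'k::field) \<Rightarrow> ('b tree list \<Rightarrow>\<^sub>0 'k)" where
  "winv \<equiv> lin (\<lambda>w. Poly_Mapping.single w ((-1) ^ word_degree w))"

lemma word_degree_simps [simp]: "word_degree [] = 0" "word_degree (t # w) = weight t + word_degree w"
  "word_degree (u @ v) = word_degree u + word_degree v"
  by (simp_all add: word_degree_def)

lemma single_pm: "Poly_Mapping.single w ((-1) ^ n) = (pm n (bas w) :: _ \<Rightarrow>\<^sub>0 'k::field)"
  by (simp only: fscale_bas flip: fscale_pm)

lemma wmult_pm: "wmult (pm n p) q = pm n (wmult p q)" "wmult p (pm n q) = pm n (wmult p q)"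
  by (auto simp: pm_def wmult_simps)

lemma winv_bas: "winv (bas w) = pm (word_degree w) (bas w)"
  by (simp add: lin_bas single_pm)

lemma winv_wmult: "winv (wmult p q) = wmult (winv p) (winv q)"
proof (induction p q rule: basis_induct2)
  case (single c d x y)
  show ?case
    by (simp only: wmult_simps lin_scale wmult_bas winv_bas wmult_pm word_degree_simps pm_plus
        pm_commute[of "word_degree x"] fscale_pm_right)
qed (simp_all only: wmult_simps lin_add)

lemma wmult_bas_left: "wmult (bas u) (wmult (bas v) p) = wmult (bas (u @ v)) p"
  by (simp add: wmult_bas flip: wmult_assoc)

lemma word_diff_append:
  "word_diff (u @ v) = wmult (word_diff u) (bas v) + pm (word_degree u) (wmult (bas u) (word_diff v))"
proof (induction u)
  case (Cons t u)
  then show ?case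
    by (simp add: fscale_pm wmult_simps wmult_assoc wmult_bas pm_add pm_plus wmult_pm wmult_bas_left
        add.assoc)
qed (simp add: wmult_simps)

abbreviation wdiff :: "('a::{ring,monoid_mult} tree list \<Rightarrow>\<^sub>0 'k::field) \<Rightarrow> ('a tree list \<Rightarrow>\<^sub>0 'k)" where
  "wdiff \<equiv> lin word_diff"

lemma wdiff_wmult: "wdiff (wmult p q) = wmult (wdiff p) q + wmult (winv p) (wdiff q)"
proof (induction p q rule: basis_induct2)
  case (single c d x y)
  show ?case
    by (simp only: wmult_simps lin_scale fvs.scale_right_distrib wmult_bas winv_bas wmult_pm lin_bas
        word_diff_append)
qed (simp_all only: wmult_simps lin_add add_ac)

lemma wdiff_emb: "wdiff (emb p) = emb (lin bar_diff p) - lin cobar_diff p"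
proof (induction p rule: basis_induct)
  case (single c t)
  show ?case
    by (simp add: emb_simps lin_scale lin_bas wmult_simps emb_def[symmetric] fvs.scale_right_diff_distrib)
qed (simp add: emb_simps lin_add)

lemma winv_emb: "winv (emb p) = emb (lin (\<lambda>t. pm (weight t) (bas t)) p)"
proof (induction p rule: basis_induct)
  case (single c t)
  show ?case by (simp add: emb_simps lin_scale winv_bas lin_bas) (simp add: pm_def emb_simps)
qed (simp add: emb_simps lin_add)

section \<open>Multilinearity relations\<close>

text \<open>
  A tree with one marked leaf. Induction over such contexts replaces the description of the
  multilinearity relations by positions in a list of labels.
\<close>

inductive tree_context :: "('a \<Rightarrow> 'a tree) \<Rightarrow> bool" where
  leaf: "tree_context Leaf"
| left: "tree_context F \<Longrightarrow> tree_context (\<lambda>x. Mu (F x) t)"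
| right: "tree_context F \<Longrightarrow> tree_context (\<lambda>x. Mu t (F x))"

lemma tree_context_decorate:
  "length us + 1 + length vs = arity t \<Longrightarrow> tree_context (\<lambda>x. decorate t (us @ [x] @ vs))"
proof (induction t arbitrary: us vs)
  case (Leaf b)
  then show ?case using tree_context.leaf by simp
next
  case (Mu s t)
  show ?case
  proof (cases "length us < arity s")
    case True
    define n where "n = arity s - length us - 1"
    have n: "length us + 1 + length (take n vs) = arity s" using True Mu.prems by (simp add: n_def)
    have "take (arity s) (us @ [x] @ vs) = us @ [x] @ take n vs"
      "drop (arity s) (us @ [x] @ vs) = drop n vs" for x
      using True by (simp_all add: n_def Suc_diff_Suc take_Cons' drop_Cons')
    then have "(\<lambda>x. decorate (Mu s t) (us @ [x] @ vs))
        = (\<lambda>x. Mu (decorate s (us @ [x] @ take n vs)) (decorate t (drop n vs)))" by simp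
    then show ?thesis using tree_context.left[OF Mu.IH(1)[OF n]] by simp
  next
    case False
    have n: "length (drop (arity s) us) + 1 + length vs = arity t" using False Mu.prems by simp
    have "(\<lambda>x. decorate (Mu s t) (us @ [x] @ vs))
        = (\<lambda>x. Mu (decorate s (take (arity s) us)) (decorate t (drop (arity s) us @ [x] @ vs)))"
      using False by simp
    then show ?thesis using tree_context.right[OF Mu.IH(2)[OF n]] by simp
  qed
qed simp

lemma decorate_Mu_append:
  "length as = arity s \<Longrightarrow> decorate (Mu s t) (as @ bs) = Mu (decorate s as) (decorate t bs)"
  by simp

lemma tree_context_is_decorate:
  "tree_context F \<Longrightarrow> \<exists>(t :: unit tree) us vs. length us + 1 + length vs = arity t \<and> F = (\<lambda>x. decorate t (us @ [x] @ vs))"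
proof (induction rule: tree_context.induct)
  case leaf
  show ?case by (rule exI[of _ "Leaf ()"], rule exI[of _ "[]"], rule exI[of _ "[]"]) auto
next
  case (left F t')
  then obtain t :: "unit tree" and us vs where
    *: "length us + 1 + length vs = arity t" "F = (\<lambda>x. decorate t (us @ [x] @ vs))" by blast
  have "arity t' = length (leaves t')" by (simp add: arity_def)
  moreover have "(\<lambda>x. Mu (F x) t') = (\<lambda>x. decorate (Mu t (shape t')) (us @ [x] @ (vs @ leaves t')))"
  proof
    fix x
    show "Mu (F x) t' = decorate (Mu t (shape t')) (us @ [x] @ (vs @ leaves t'))"
      using decorate_Mu_append[of "us @ [x] @ vs" t "shape t'" "leaves t'"] *(1)
      by (simp add: *(2) decorate_leaves)
  qed
  ultimately have "length us + 1 + length (vs @ leaves t') = arity (Mu t (shape t'))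
      \<and> (\<lambda>x. Mu (F x) t') = (\<lambda>x. decorate (Mu t (shape t')) (us @ [x] @ (vs @ leaves t')))"
    using *(1) by simp
  then show ?case by blast
next
  case (right F t')
  then obtain t :: "unit tree" and us vs where
    *: "length us + 1 + length vs = arity t" "F = (\<lambda>x. decorate t (us @ [x] @ vs))" by blast
  have a: "arity t' = length (leaves t')" by (simp add: arity_def)
  moreover have "(\<lambda>x. Mu t' (F x)) = (\<lambda>x. decorate (Mu (shape t') t) ((leaves t' @ us) @ [x] @ vs))"
  proof
    fix x
    show "Mu t' (F x) = decorate (Mu (shape t') t) ((leaves t' @ us) @ [x] @ vs)"
      using decorate_Mu_append[of "leaves t'" "shape t'" t "us @ [x] @ vs"] a
      by (simp add: *(2) decorate_leaves)
  qed
  ultimately have "length (leaves t' @ us) + 1 + length vs = arity (Mu (shape t') t)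
      \<and> (\<lambda>x. Mu t' (F x)) = (\<lambda>x. decorate (Mu (shape t') t) ((leaves t' @ us) @ [x] @ vs))"
    using *(1) by simp
  then show ?case by blast
qed

text \<open>
  Linearity modulo \<open>N\<close>, with additivity and homogeneity in a single condition.
\<close>

definition affine_mod :: "('k \<Rightarrow> 'a::ab_group_add \<Rightarrow> 'a) \<Rightarrow> ('k \<Rightarrow> 'v::ab_group_add \<Rightarrow> 'v) \<Rightarrow> 'v set \<Rightarrow> ('a \<Rightarrow> 'v) \<Rightarrow> bool" where
  "affine_mod sA s N \<phi> \<longleftrightarrow> (\<forall>k a b. \<phi> (sA k a + b) - s k (\<phi> a) - \<phi> b \<in> N)"

lemma (in vector_space) affine_mod_add:
  assumes A: "vector_space sA" and "subspace N" "affine_mod sA scale N \<phi>"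
  shows "\<phi> (a + b) - \<phi> a - \<phi> b \<in> N"
proof -
  interpret A: vector_space sA by (rule A)
  show ?thesis using assms(3) unfolding affine_mod_def by (metis A.scale_one scale_one)
qed

lemma (in vector_space) affine_mod_scale:
  assumes A: "vector_space sA" and N: "subspace N" and aff: "affine_mod sA scale N \<phi>"
  shows "\<phi> (sA c a) - scale c (\<phi> a) \<in> N"
proof -
  have "\<phi> (0 + 0) - \<phi> 0 - \<phi> 0 \<in> N" by (rule affine_mod_add[OF assms])
  then have "\<phi> 0 \<in> N" using subspace_neg[OF N] by fastforce
  moreover have "\<phi> (sA c a + 0) - scale c (\<phi> a) - \<phi> 0 \<in> N"
    using aff unfolding affine_mod_def by blast
  ultimately show ?thesis using subspace_add[OF N] by fastforce
qed

text \<open>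
  The test used for each operation on trees: it respects the multilinearity relations if it is
  linear in every leaf.
\<close>

lemma (in vector_space) lext_multilin_rels:
  assumes A: "vector_space sA" and N: "subspace N"
    and aff: "\<And>F. tree_context F \<Longrightarrow> affine_mod sA scale N (\<lambda>x. h (F x))"
    and p: "p \<in> multilin_rels sA"
  shows "lext scale h p \<in> N"
  using p unfolding multilin_rels_def
proof (elim UnE CollectE exE conjE)
  fix t :: "unit tree" and us a b vs
  assume p: "p = bas (decorate t (us @ [a + b] @ vs)) - bas (decorate t (us @ [a] @ vs)) - bas (decorate t (us @ [b] @ vs))"
    and "length us + 1 + length vs = arity t"
  from affine_mod_add[OF A N aff[OF tree_context_decorate[OF this(2)]], of a b]
  show ?thesis by (simp add: p lext_diff lext_bas)
next
  fix t :: "unit tree" and us c a vs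
  assume p: "p = bas (decorate t (us @ [sA c a] @ vs)) - fscale c (bas (decorate t (us @ [a] @ vs)))"
    and "length us + 1 + length vs = arity t"
  from affine_mod_scale[OF A N aff[OF tree_context_decorate[OF this(2)]], of c a]
  show ?thesis by (simp add: p lext_diff lext_scale lext_bas)
qed

lemmas lin_multilin_rels = fvs.lext_multilin_rels[folded lin_eq_lext]

context unital_algebra
begin

abbreviation multilin_span :: "('a tree \<Rightarrow>\<^sub>0 'k) set" where
  "multilin_span \<equiv> fvs.span (multilin_rels scale)"

lemma scale_vector_space: "vector_space scale" by unfold_locales

lemma affine_tree_context:
  assumes "tree_context F"
  shows "affine_mod scale fscale multilin_span (\<lambda>x. bas (F x))"
  unfolding affine_mod_def
proof (intro allI)
  fix k a b
  obtain t :: "unit tree" and us vs where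
    *: "length us + 1 + length vs = arity t" "F = (\<lambda>x. decorate t (us @ [x] @ vs))"
    using tree_context_is_decorate[OF assms] by blast
  have "bas (F (scale k a + b)) - bas (F (scale k a)) - bas (F b) \<in> multilin_rels scale"
    unfolding multilin_rels_def *(2) using *(1) by blast
  moreover have "bas (F (scale k a)) - fscale k (bas (F a)) \<in> multilin_rels scale"
    unfolding multilin_rels_def *(2) using *(1) by blast
  ultimately have "(bas (F (scale k a + b)) - bas (F (scale k a)) - bas (F b))
      + (bas (F (scale k a)) - fscale k (bas (F a))) \<in> multilin_span"
    by (intro fvs.span_add fvs.span_base)
  then show "bas (F (scale k a + b)) - fscale k (bas (F a)) - bas (F b) \<in> multilin_span"
    by (simp add: algebra_simps)
qed

lemma affine_mod_cong_hom:
  assumes h: "module_hom fscale fscale h" and "affine_mod scale fscale N \<phi>"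
    and "\<And>p. p \<in> N \<Longrightarrow> h p \<in> N'"
  shows "affine_mod scale fscale N' (\<lambda>x. h (\<phi> x))"
  unfolding affine_mod_def
proof (intro allI)
  fix k a b
  have "h (\<phi> (scale k a + b) - fscale k (\<phi> a) - \<phi> b) \<in> N'"
    using assms(2,3) by (simp add: affine_mod_def)
  then show "h (\<phi> (scale k a + b)) - fscale k (h (\<phi> a)) - h (\<phi> b) \<in> N'"
    by (simp add: module_hom.diff[OF h] module_hom.scale[OF h])
qed

lemma affine_mod_diff:
  assumes "fvs.subspace N" "affine_mod scale fscale N \<phi>" "affine_mod scale fscale N \<psi>"
  shows "affine_mod scale fscale N (\<lambda>x. \<phi> x - \<psi> x)"
  unfolding affine_mod_def
proof (intro allI)
  fix k a b
  have "(\<phi> (scale k a + b) - fscale k (\<phi> a) - \<phi> b) - (\<psi> (scale k a + b) - fscale k (\<psi> a) - \<psi> b) \<in> N"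
    by (rule fvs.subspace_diff[OF assms(1)]) (use assms(2,3) in \<open>auto simp: affine_mod_def\<close>)
  then show "\<phi> (scale k a + b) - \<psi> (scale k a + b) - fscale k (\<phi> a - \<psi> a) - (\<phi> b - \<psi> b) \<in> N"
    by (simp add: algebra_simps fvs.scale_right_diff_distrib)
qed

lemma affine_mod_zero: "fvs.subspace N \<Longrightarrow> affine_mod scale fscale N (\<lambda>x. 0)"
  by (simp add: affine_mod_def fvs.subspace_0)

lemma graft_hom: "module_hom fscale fscale (\<lambda>p. graft p q)" "module_hom fscale fscale (graft q)"
  unfolding graft_def by (rule bilin_hom_left bilin_hom_right)+

lemma graft_multilin_span:
  assumes "p \<in> multilin_span"
  shows "graft p q \<in> multilin_span" "graft q p \<in> multilin_span"
proof -
  have L: "graft p (bas t) \<in> multilin_span" for t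
  proof (rule fvs.hom_span_subset[OF graft_hom(1) _ fvs.subspace_span assms], safe)
    fix p assume p: "p \<in> multilin_rels scale"
    have "lin (\<lambda>s. graft (bas s) (bas t)) p \<in> multilin_span"
    proof (rule lin_multilin_rels[OF scale_vector_space fvs.subspace_span _ p])
      fix F :: "'a \<Rightarrow> 'a tree" assume "tree_context F"
      from affine_tree_context[OF tree_context.left[OF this, of t]]
      show "affine_mod scale fscale multilin_span (\<lambda>x. graft (bas (F x)) (bas t))" by (simp add: graft_bas)
    qed
    then show "graft p (bas t) \<in> multilin_span"
      using hom_lin[OF graft_hom(1)[of "bas t"], of bas p] by (simp add: lin_ident)
  qed
  have R: "graft (bas t) p \<in> multilin_span" for t
  proof (rule fvs.hom_span_subset[OF graft_hom(2) _ fvs.subspace_span assms], safe)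
    fix p assume p: "p \<in> multilin_rels scale"
    have "lin (\<lambda>s. graft (bas t) (bas s)) p \<in> multilin_span"
    proof (rule lin_multilin_rels[OF scale_vector_space fvs.subspace_span _ p])
      fix F :: "'a \<Rightarrow> 'a tree" assume "tree_context F"
      from affine_tree_context[OF tree_context.right[OF this, of t]]
      show "affine_mod scale fscale multilin_span (\<lambda>x. graft (bas t) (bas (F x)))" by (simp add: graft_bas)
    qed
    then show "graft (bas t) p \<in> multilin_span"
      using hom_lin[OF graft_hom(2)[of "bas t"], of bas p] by (simp add: lin_ident)
  qed
  show "graft p q \<in> multilin_span"
    by (induction q rule: basis_induct) (auto simp: graft_simps L intro: fvs.span_add fvs.span_scale)
  show "graft q p \<in> multilin_span"
    by (induction q rule: basis_induct) (auto simp: graft_simps R intro: fvs.span_add fvs.span_scale)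
qed

lemma tree_context_weight: "tree_context F \<Longrightarrow> weight (F x) = weight (F y)"
  by (induction rule: tree_context.induct) auto

lemma affine_junction:
  assumes "tree_context F"
  shows "affine_mod scale fscale multilin_span (\<lambda>x. junction (F x) t)" "affine_mod scale fscale multilin_span (\<lambda>x. junction t (F x))"
proof -
  have zero: "affine_mod scale fscale multilin_span (\<lambda>x. 0)" by (rule affine_mod_zero[OF fvs.subspace_span])
  have leaf: "affine_mod scale fscale multilin_span (\<lambda>x. bas (Leaf (x * b)))"
     "affine_mod scale fscale multilin_span (\<lambda>x. bas (Leaf (b * x)))" for b
    using affine_tree_context[OF tree_context.leaf]
    by (simp_all add: affine_mod_def distrib_right distrib_left scale_mult_left scale_mult_right)
  show "affine_mod scale fscale multilin_span (\<lambda>x. junction (F x) t)"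
    using assms
  proof cases
    case leaf
    then show ?thesis using \<open>\<And>b. affine_mod scale fscale multilin_span (\<lambda>x. bas (Leaf (x * b)))\<close> zero
      by (cases t) (simp_all add: junction_def)
  qed (simp_all add: junction_def zero)
  show "affine_mod scale fscale multilin_span (\<lambda>x. junction t (F x))"
    using assms
  proof cases
    case leaf
    then show ?thesis using \<open>\<And>b. affine_mod scale fscale multilin_span (\<lambda>x. bas (Leaf (b * x)))\<close> zero
      by (cases t) (simp_all add: junction_def)
  qed (cases t; simp add: junction_def zero)+
qed

text \<open>
  The only point where the structure of \<open>A\<close> enters is the product of two adjacent leaves,
  which is linear in both.
\<close>

lemma affine_bar_diff:
  "tree_context F \<Longrightarrow> affine_mod scale fscale multilin_span (\<lambda>x. bar_diff (F x))"
proof (induction rule: tree_context.induct)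
  case leaf
  show ?case by (simp add: bar_diff_simps affine_mod_zero[OF fvs.subspace_span])
next
  case (left F t)
  define n where "n = weight (F 0)"
  have w: "weight (F x) = n" for x unfolding n_def by (rule tree_context_weight[OF left(1)])
  have "affine_mod scale fscale multilin_span (\<lambda>x. graft (bar_diff (F x)) (bas t))"
    by (rule affine_mod_cong_hom[OF graft_hom(1) left(2)]) (rule graft_multilin_span)
  moreover have "affine_mod scale fscale multilin_span (\<lambda>x. fscale ((-1) ^ n) (graft (bas (F x)) (bar_diff t)))"
    by (rule affine_mod_cong_hom[OF hom_compose[OF graft_hom(1) fscale_hom] affine_tree_context[OF left(1)]])
      (intro fvs.span_scale graft_multilin_span)
  ultimately show ?case
    unfolding bar_diff_simps w
    by (intro affine_mod_diff affine_junction left fvs.subspace_span)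
next
  case (right F t)
  have "affine_mod scale fscale multilin_span (\<lambda>x. graft (bar_diff t) (bas (F x)))"
    by (rule affine_mod_cong_hom[OF graft_hom(2) affine_tree_context[OF right(1)]]) (rule graft_multilin_span(2))
  moreover have "affine_mod scale fscale multilin_span (\<lambda>x. fscale ((-1) ^ weight t) (graft (bas t) (bar_diff (F x))))"
    by (rule affine_mod_cong_hom[OF hom_compose[OF graft_hom(2) fscale_hom] right(2)])
      (rule fvs.span_scale, rule graft_multilin_span(2))
  ultimately show ?case
    unfolding bar_diff_simps
    by (intro affine_mod_diff affine_junction right fvs.subspace_span)
qed

section \<open>The ideal of multilinearity relations\<close>

abbreviation N :: "('a tree list \<Rightarrow>\<^sub>0 'k) set" where
  "N \<equiv> word_ideal scale"

lemma N_subspace: "fvs.subspace N"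
  unfolding word_ideal_def by (rule fvs.subspace_span)

lemma ftensor_in_N: "p \<in> multilin_rels scale \<Longrightarrow> ftensor (us @ [p] @ vs) \<in> N"
  unfolding word_ideal_def by (rule fvs.span_base) blast

lemma wmult_N:
  assumes "p \<in> N"
  shows "wmult q p \<in> N" "wmult p q \<in> N"
proof -
  have L: "wmult (bas w) p \<in> N" for w
  proof (rule fvs.hom_span_subset[OF wmult_hom_right _ N_subspace assms[unfolded word_ideal_def]], safe)
    fix us p vs assume p: "p \<in> multilin_rels scale"
    have "wmult (bas w) (ftensor (us @ [p] @ vs)) = ftensor ((map (\<lambda>x. bas x) w @ us) @ [p] @ vs)"
      by (simp only: ftensor_append ftensor_bas wmult_assoc)
    then show "wmult (bas w) (ftensor (us @ [p] @ vs)) \<in> N" using ftensor_in_N[OF p] by metis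
  qed
  have R: "wmult p (bas w) \<in> N" for w
  proof (rule fvs.hom_span_subset[OF wmult_hom_left _ N_subspace assms[unfolded word_ideal_def]], safe)
    fix us p vs assume p: "p \<in> multilin_rels scale"
    have "wmult (ftensor (us @ [p] @ vs)) (bas w) = ftensor (us @ [p] @ (vs @ map (\<lambda>x. bas x) w))"
      by (simp only: ftensor_append ftensor_bas wmult_assoc)
    then show "wmult (ftensor (us @ [p] @ vs)) (bas w) \<in> N" using ftensor_in_N[OF p] by metis
  qed
  show "wmult q p \<in> N"
    by (induction q rule: basis_induct)
      (auto simp: wmult_simps L intro: fvs.subspace_add[OF N_subspace] fvs.subspace_scale[OF N_subspace])
  show "wmult p q \<in> N"
    by (induction q rule: basis_induct)
      (auto simp: wmult_simps R intro: fvs.subspace_add[OF N_subspace] fvs.subspace_scale[OF N_subspace])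
qed

lemma emb_multilin_span:
  assumes "p \<in> multilin_span" shows "emb p \<in> N"
  by (rule fvs.hom_span_subset[OF emb_hom _ N_subspace assms])
    (use ftensor_in_N[of _ "[]" "[]"] in \<open>auto simp: ftensor_single\<close>)

lemma affine_cobar_diff:
  assumes "tree_context F"
  shows "affine_mod scale fscale N (\<lambda>x. cobar_diff (F x))"
  using assms
proof cases
  case leaf
  then show ?thesis by (simp add: cobar_diff_simps affine_mod_zero[OF N_subspace])
next
  case (left F t)
  have "affine_mod scale fscale N (\<lambda>x. wmult (emb (bas (F x))) (bas [t]))"
    by (rule affine_mod_cong_hom[OF hom_compose[OF emb_hom wmult_hom_left] affine_tree_context[OF left(2)]])
      (rule wmult_N(2), erule emb_multilin_span)
  then show ?thesis by (simp add: left(1) cobar_diff_simps wmult_bas)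
next
  case (right F t)
  have "affine_mod scale fscale N (\<lambda>x. wmult (bas [t]) (emb (bas (F x))))"
    by (rule affine_mod_cong_hom[OF hom_compose[OF emb_hom wmult_hom_right] affine_tree_context[OF right(2)]])
      (rule wmult_N(1), erule emb_multilin_span)
  then show ?thesis by (simp add: right(1) cobar_diff_simps wmult_bas)
qed

lemma affine_sign:
  assumes "tree_context F"
  shows "affine_mod scale fscale multilin_span (\<lambda>x. pm (weight (F x)) (bas (F x)))"
proof -
  define n where "n = weight (F 0)"
  have "weight (F x) = n" for x unfolding n_def by (rule tree_context_weight[OF assms])
  moreover have "affine_mod scale fscale multilin_span (\<lambda>x. fscale ((-1) ^ n) (bas (F x)))"
    by (rule affine_mod_cong_hom[OF fscale_hom affine_tree_context[OF assms]]) (rule fvs.span_scale)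
  ultimately show ?thesis by (simp add: fscale_pm)
qed

lemma winv_N:
  assumes "p \<in> N" shows "winv p \<in> N"
proof (rule fvs.hom_span_subset[OF lin_hom _ N_subspace assms[unfolded word_ideal_def]], safe)
  fix us p vs assume p: "p \<in> multilin_rels scale"
  have "winv (emb p) \<in> N"
    unfolding winv_emb by (intro emb_multilin_span lin_multilin_rels[OF scale_vector_space fvs.subspace_span affine_sign p])
  then show "winv (ftensor (us @ [p] @ vs)) \<in> N"
    by (simp only: ftensor_append ftensor_single winv_wmult wmult_N)
qed

text \<open>
  For a relation \<open>p\<close> between trees, \<open>wdiff (emb p)\<close> lies in the ideal by linearity of both
  differentials in every leaf; the derivation rule extends this to the ideal.
\<close>

lemma wdiff_N:
  assumes "p \<in> N" shows "wdiff p \<in> N"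
proof (rule fvs.hom_span_subset[OF lin_hom _ N_subspace assms[unfolded word_ideal_def]], safe)
  fix us p vs assume p: "p \<in> multilin_rels scale"
  have d: "wdiff (emb p) \<in> N"
    unfolding wdiff_emb
    by (rule fvs.subspace_diff[OF N_subspace emb_multilin_span[OF lin_multilin_rels[OF scale_vector_space fvs.subspace_span affine_bar_diff p]]
          lin_multilin_rels[OF scale_vector_space N_subspace affine_cobar_diff p]])
  have e: "emb p \<in> N" by (intro emb_multilin_span fvs.span_base p)
  show "wdiff (ftensor (us @ [p] @ vs)) \<in> N"
    unfolding ftensor_append ftensor_single wdiff_wmult
    by (rule fvs.subspace_add[OF N_subspace wmult_N(1)[OF wmult_N(2)[OF e]]
          wmult_N(1)[OF fvs.subspace_add[OF N_subspace wmult_N(2)[OF d] wmult_N(2)[OF winv_N[OF e]]]]])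
qed

section \<open>The augmentation\<close>

abbreviation aug :: "('a tree list \<Rightarrow>\<^sub>0 'k) \<Rightarrow> 'a" where
  "aug \<equiv> lext scale word_aug"

lemma word_aug_append: "word_aug (u @ v) = word_aug u * (word_aug v :: 'a)"
  by (induction u) (auto simp: mult.assoc)

lemma aug_wmult: "aug (wmult p q) = aug p * aug q"
  by (induction p q rule: basis_induct2)
    (simp_all add: wmult_simps wmult_bas lext_add lext_scale lext_bas word_aug_append distrib_left
      distrib_right scale_mult_left scale_mult_right mult.commute)

lemma lext_emb: "lext scale f (emb p) = lext scale (\<lambda>t. f [t]) p"
  by (induction p rule: basis_induct) (simp_all add: emb_simps lext_add lext_scale lext_bas)

abbreviation leaf_value :: "'a tree \<Rightarrow> 'a" where
  "leaf_value t \<equiv> (case t of Leaf a \<Rightarrow> a | _ \<Rightarrow> 0)"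

lemma affine_leaf_value:
  assumes "tree_context F"
  shows "affine_mod scale scale {0} (\<lambda>x. leaf_value (F x))"
  using assms by cases (auto simp: affine_mod_def)

lemma aug_N: "p \<in> N \<Longrightarrow> aug p = 0"
proof -
  assume "p \<in> N"
  have "aug p \<in> {0}"
  proof (rule hom_span_subset[OF lext_hom _ subspace_single_0 \<open>p \<in> N\<close>[unfolded word_ideal_def]], safe)
    fix us p vs assume p: "p \<in> multilin_rels scale"
    have "lext scale leaf_value p \<in> {0}"
      by (rule lext_multilin_rels[OF scale_vector_space subspace_single_0 affine_leaf_value p])
    then have "aug (emb p) = 0" by (simp add: lext_emb)
    then show "aug (ftensor (us @ [p] @ vs)) = 0"
      by (simp only: ftensor_append ftensor_single aug_wmult) simp
  qed
  then show ?thesis by simp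
qed

lemma aug_emb_graft: "aug (emb (graft p q)) = 0"
  by (induction p q rule: basis_induct2)
    (simp_all add: graft_simps graft_bas emb_simps lext_add lext_scale lext_bas)

lemma aug_treediff: "aug (emb (bar_diff t) - cobar_diff t) = 0"
proof (cases t)
  case (Mu u v)
  have "aug (emb (junction u v)) = leaf_value u * leaf_value v"
    by (cases u; cases v) (simp_all add: junction_def emb_simps lext_zero lext_bas)
  then show ?thesis
    by (simp add: Mu bar_diff_simps cobar_diff_simps emb_simps lext_diff lext_scale aug_emb_graft lext_bas)
qed (simp_all add: bar_diff_simps cobar_diff_simps lext_diff lext_bas emb_simps lext_zero)

text \<open>
  On a generator the augmentation sees two cases only: for the nullary generator
  \<open>1 - 1 = 0\<close>, and for the binary one with leaves \<open>a, b\<close> the product \<open>a b\<close> minus itself.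
\<close>

lemma aug_wdiff: "aug (wdiff p) = 0"
proof (induction p rule: basis_induct)
  case (single c w)
  have "aug (word_diff w) = 0"
    by (induction w)
      (simp_all add: lext_zero lext_add lext_scale aug_wmult aug_treediff emb_def[symmetric])
  then show ?case by (simp add: lin_scale lin_bas lext_scale)
qed (simp add: lin_add lext_add)

lemma word_aug_degree: "word_degree w \<noteq> 0 \<Longrightarrow> word_aug w = (0::'a)"
  by (induction w) (auto split: tree.splits)

lemma lext_pm: "lext scale f (pm n p) = pm n (lext scale f p)"
  by (simp add: pm_def lext_neg)

lemma aug_winv: "aug (winv p) = aug p"
proof (induction p rule: basis_induct)
  case (single c w)
  have "aug (pm (word_degree w) (bas w)) = aug (bas w)"
    by (cases "word_degree w = 0") (simp_all add: lext_pm lext_bas word_aug_degree)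
  then show ?case by (simp only: lin_scale lext_scale winv_bas)
qed (simp add: lin_add lext_add)

section \<open>The resolution as an augmented dg algebra\<close>

abbreviation U :: "('a tree list \<Rightarrow>\<^sub>0 'k) set" where
  "U \<equiv> resolution_words"

lemma U_subspace: "fvs.subspace U"
  unfolding resolution_words_def by (rule fvs.subspace_span)

lemma ftensor_in_U: "set ps \<subseteq> corolla_span \<Longrightarrow> ftensor ps \<in> U"
  unfolding resolution_words_def bar_gens_eq by (rule fvs.span_base) blast

lemma emb_in_U: "p \<in> corolla_span \<Longrightarrow> emb p \<in> U"
  using ftensor_in_U[of "[p]"] by (simp add: ftensor_single)

lemma one_in_U: "bas [] \<in> U"
  using ftensor_in_U[of "[]"] by (simp add: ftensor_Nil)

lemma U_induct [consumes 1, case_names hom tensor]: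
  assumes "p \<in> U" "module_hom fscale s h"
  shows "vector_space s \<Longrightarrow> module.subspace s T \<Longrightarrow> (\<And>ps. set ps \<subseteq> corolla_span \<Longrightarrow> h (ftensor ps) \<in> T) \<Longrightarrow> h p \<in> T"
  by (rule vector_space.hom_span_subset[OF _ assms(2) _ _ assms(1)[unfolded resolution_words_def bar_gens_eq]]) auto

lemma wmult_in_U:
  assumes "p \<in> U" "q \<in> U" shows "wmult p q \<in> U"
proof -
  have "wmult (ftensor ps) q \<in> U" if ps: "set ps \<subseteq> corolla_span" for ps
    using U_induct[OF assms(2) wmult_hom_right fvs.vector_space_axioms U_subspace]
    by (metis ftensor_append ftensor_in_U ps set_append Un_subset_iff)
  then show ?thesis
    using U_induct[OF assms(1) wmult_hom_left fvs.vector_space_axioms U_subspace] by blast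
qed

lemma bar_sum_in:
  assumes "fvs.subspace S" "\<And>v. \<psi> v \<in> S"
  shows "bar_sum (w :: 'a option list) \<psi> \<in> S"
  using assms(2)
proof (induction w arbitrary: \<psi>)
  case (Cons x w)
  have "head_sum \<psi> x w \<in> S"
    using Cons.prems fvs.subspace_0[OF assms(1)] by (induction \<psi> x w rule: head_sum.induct) auto
  moreover have "pm (ldeg x) (bar_sum w (\<lambda>v. \<psi> (x # v))) \<in> S"
    using Cons fvs.subspace_neg[OF assms(1)] by (auto simp: pm_def)
  ultimately show ?case using fvs.subspace_add[OF assms(1)] by simp
qed (simp add: fvs.subspace_0[OF assms(1)])

lemma pm_in: "fvs.subspace S \<Longrightarrow> x \<in> S \<Longrightarrow> pm n x \<in> S"
  by (simp add: pm_def fvs.subspace_neg)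

lemma wdiff_emb_in_U:
  assumes "p \<in> corolla_span" shows "wdiff (emb p) \<in> U"
proof (rule fvs.hom_span_subset[OF hom_compose[OF emb_hom lin_hom] _ U_subspace assms], safe)
  fix w :: "'a option list"
  have "emb (bar_sum w corolla) \<in> U"
    by (intro emb_in_U bar_sum_in fvs.subspace_span corolla_in_span)
  moreover have "lin cobar_diff (corolla w) \<in> U"
    unfolding cobar_diff_corolla
    by (intro fvs.subspace_add[OF U_subspace] split_sum_in fvs.subspace_neg[OF U_subspace] pm_in
        U_subspace wmult_in_U emb_in_U corolla_in_span)
      (auto simp: one_in_U fvs.subspace_0[OF U_subspace])
  ultimately show "wdiff (emb (corolla w)) \<in> U"
    unfolding wdiff_emb bar_diff_corolla by (intro fvs.subspace_diff[OF U_subspace])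
qed

lemma lin_pm_sign_corolla: "lin (\<lambda>t. pm (weight t) (bas t)) (corolla u) = - pm (wdeg u) (corolla u)"
  using lin_sign_corolla[of u] by (simp add: fscale_pm)

lemma winv_emb_in_U:
  assumes "p \<in> corolla_span" shows "winv (emb p) \<in> U"
proof (rule fvs.hom_span_subset[OF hom_compose[OF emb_hom lin_hom] _ U_subspace assms], safe)
  fix w :: "'a option list"
  show "winv (emb (corolla w)) \<in> U"
    unfolding winv_emb lin_pm_sign_corolla
    by (intro emb_in_U fvs.span_neg pm_in fvs.subspace_span corolla_in_span)
qed

lemma winv_in_U:
  assumes "p \<in> U" shows "winv p \<in> U"
proof (rule U_induct[OF assms lin_hom fvs.vector_space_axioms U_subspace])
  fix ps assume "set ps \<subseteq> (corolla_span :: ('a tree \<Rightarrow>\<^sub>0 'k) set)"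
  then show "winv (ftensor ps) \<in> U"
    by (induction ps) (auto simp: ftensor_Nil winv_bas one_in_U ftensor_Cons winv_wmult intro!: wmult_in_U winv_emb_in_U)
qed

lemma wdiff_in_U:
  assumes "p \<in> U" shows "wdiff p \<in> U"
proof (rule U_induct[OF assms lin_hom fvs.vector_space_axioms U_subspace])
  fix ps assume "set ps \<subseteq> (corolla_span :: ('a tree \<Rightarrow>\<^sub>0 'k) set)"
  then show "wdiff (ftensor ps) \<in> U"
  proof (induction ps)
    case Nil
    then show ?case by (simp add: ftensor_Nil lin_bas fvs.subspace_0[OF U_subspace])
  next
    case (Cons p ps)
    then show ?case
      by (auto simp: ftensor_Cons wdiff_wmult intro!: fvs.subspace_add[OF U_subspace] wmult_in_U
          wdiff_emb_in_U winv_emb_in_U ftensor_in_U)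
  qed
qed

abbreviation R where "R \<equiv> resolution scale"

lemma vcar_R: "vcar R = cls N ` U"
  and hcomp_R: "hcomp R n = cls N ` {p \<in> U. \<forall>w\<in>Poly_Mapping.keys p. word_degree w = n}"
  and aone_R: "aone R = cls N (bas [])"
  by (simp_all add: resolution_def quotient_dgvs_def quotient_vs_def vs.defs dgvs.defs)

lemma vadd_R: "vadd R (cls N p) (cls N q) = cls N (p + q)"
  by (simp add: resolution_def quotient_dgvs_def quotient_vs_def vs.defs dgvs.defs
      fvs.qlift2_plus[OF N_subspace])

lemma vsmul_R: "vsmul R c (cls N p) = cls N (fscale c p)"
  by (simp add: resolution_def quotient_dgvs_def quotient_vs_def vs.defs dgvs.defs
      fvs.qlift_scale[OF N_subspace])

lemma vdiff_R: "vdiff R (cls N p) = cls N (wdiff p)"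
  by (simp add: resolution_def quotient_dgvs_def quotient_vs_def vs.defs dgvs.defs
      fvs.qlift_cls[OF N_subspace] lin_add wdiff_N)

lemma amult_R: "amult R (cls N p) (cls N q) = cls N (wmult p q)"
  by (simp add: resolution_def quotient_dgvs_def quotient_vs_def vs.defs dgvs.defs
      fvs.qlift2_cls[OF N_subspace] wmult_simps wmult_N)

lemma ainv_R: "ainv R (cls N p) = cls N (winv p)"
  by (simp add: resolution_def quotient_dgvs_def quotient_vs_def vs.defs dgvs.defs
      fvs.qlift_cls[OF N_subspace] lin_add winv_N)

lemma resolution_aug_R: "resolution_aug scale (cls N p) = aug p"
proof -
  have "aug q = aug p" if "q \<in> cls N p" for q
    using aug_N[of "q - p"] that by (simp add: cls_def lext_diff)
  then have "aug ` cls N p = {aug p}" using fvs.cls_self[OF N_subspace, of p] by blast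
  then show ?thesis by (simp add: resolution_aug_def lext_def)
qed

lemma aug_degree:
  "\<forall>w\<in>Poly_Mapping.keys p. word_degree w = n \<Longrightarrow> n \<noteq> 0 \<Longrightarrow> aug p = 0"
  by (auto simp: lext_def word_aug_degree intro!: sum.neutral)

theorem augmented_resolution: "augmented_dg_algebra R scale (resolution_aug scale)"
  by unfold_locales
    (auto simp: vcar_R hcomp_R aone_R vadd_R vsmul_R vdiff_R amult_R ainv_R resolution_aug_R
      lin_add lin_scale wmult_simps wmult_assoc wdiff_wmult winv_wmult lext_add lext_scale lext_bas
      aug_wmult aug_wdiff aug_winv one_in_U
      intro!: imageI fvs.subspace_add[OF U_subspace] fvs.subspace_scale[OF U_subspace] wmult_in_U
        wdiff_in_U winv_in_U aug_degree)

end

section \<open>Kaehler differentials\<close>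

text \<open>
  A linear map that kills \<open>N\<close> has a well-defined value on cosets, computed at any element.
\<close>

lemma value_on_coset:
  assumes "\<And>q. q \<in> N \<Longrightarrow> L q = 0" "0 \<in> N" "\<And>p q. L (p - q) = L p - L q"
  shows "L (SOME q. q \<in> cls N p) = (L p :: 'm::ab_group_add)"
proof -
  have "(SOME q. q \<in> cls N p) \<in> cls N p"
    by (rule someI[of _ p]) (simp add: cls_def assms)
  then have "L ((SOME q. q \<in> cls N p) - p) = 0" using assms(1) by (simp add: cls_def)
  then show ?thesis by (simp add: assms(3))
qed

lemma trilin_relsI:
  "x \<in> vcar X \<Longrightarrow> x' \<in> vcar X \<Longrightarrow> y \<in> vcar Y \<Longrightarrow> z \<in> vcar Z \<Longrightarrow>
    triple (vadd X x x') y z - triple x y z - triple x' y z \<in> trilin_rels X Y Z"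
  "x \<in> vcar X \<Longrightarrow> y \<in> vcar Y \<Longrightarrow> y' \<in> vcar Y \<Longrightarrow> z \<in> vcar Z \<Longrightarrow>
    triple x (vadd Y y y') z - triple x y z - triple x y' z \<in> trilin_rels X Y Z"
  "x \<in> vcar X \<Longrightarrow> y \<in> vcar Y \<Longrightarrow> z \<in> vcar Z \<Longrightarrow> z' \<in> vcar Z \<Longrightarrow>
    triple x y (vadd Z z z') - triple x y z - triple x y z' \<in> trilin_rels X Y Z"
  "x \<in> vcar X \<Longrightarrow> y \<in> vcar Y \<Longrightarrow> z \<in> vcar Z \<Longrightarrow>
    triple (vsmul X c x) y z - fscale c (triple x y z) \<in> trilin_rels X Y Z"
  "x \<in> vcar X \<Longrightarrow> y \<in> vcar Y \<Longrightarrow> z \<in> vcar Z \<Longrightarrow>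
    triple x (vsmul Y c y) z - fscale c (triple x y z) \<in> trilin_rels X Y Z"
  "x \<in> vcar X \<Longrightarrow> y \<in> vcar Y \<Longrightarrow> z \<in> vcar Z \<Longrightarrow>
    triple x y (vsmul Z c z) - fscale c (triple x y z) \<in> trilin_rels X Y Z"
  unfolding trilin_rels_def
       apply (rule UnI1, rule UnI1, rule UnI1, rule UnI1, rule UnI1, blast)
      apply (rule UnI1, rule UnI1, rule UnI1, rule UnI1, rule UnI2, blast)
     apply (rule UnI1, rule UnI1, rule UnI1, rule UnI2, blast)
    apply (rule UnI1, rule UnI1, rule UnI2, blast)
   apply (rule UnI1, rule UnI2, blast)
  apply (rule UnI2, blast)
  done

text \<open>
  A linear map with kernel \<open>N\<close>, so that relations modulo \<open>N\<close> can be used for rewriting.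
\<close>

definition kernel_map :: "('x \<Rightarrow>\<^sub>0 'k::field) set \<Rightarrow> ('x \<Rightarrow>\<^sub>0 'k) \<Rightarrow> ('x \<Rightarrow>\<^sub>0 'k)" where
  "kernel_map N = (SOME \<pi>. module_hom fscale fscale \<pi> \<and> (\<forall>p. \<pi> p = 0 \<longleftrightarrow> p \<in> N))"

lemma kernel_map:
  fixes N :: "('x \<Rightarrow>\<^sub>0 'k::field) set"
  assumes "fvs.subspace N"
  shows "module_hom fscale fscale (kernel_map N)" "kernel_map N p = 0 \<longleftrightarrow> p \<in> N"
proof -
  have "\<exists>\<pi> :: ('x \<Rightarrow>\<^sub>0 'k) \<Rightarrow> ('x \<Rightarrow>\<^sub>0 'k). module_hom fscale fscale \<pi> \<and> (\<forall>p. \<pi> p = 0 \<longleftrightarrow> p \<in> N)"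
    by (rule subspace_is_kernel[OF assms]) blast
  from someI_ex[OF this] show "module_hom fscale fscale (kernel_map N)" "kernel_map N p = 0 \<longleftrightarrow> p \<in> N"
    unfolding kernel_map_def by blast+
qed

context dg_algebra
begin

abbreviation W where "W \<equiv> kaehler Q"
abbreviation K where "K \<equiv> kaehler_rels Q"
definition UW where
  "UW = fvs.span {triple x y z | x y z. x \<in> vcar Q \<and> y \<in> vcar Q \<and> z \<in> vcar Q}"

lemmas closed = add_closed smul_closed mult_closed one_closed diff_closed inv_closed

definition kdiff :: "'q \<times> 'q \<times> 'q \<Rightarrow> ('q \<times> 'q \<times> 'q \<Rightarrow>\<^sub>0 'k)" where
  "kdiff = (\<lambda>(x, y, z). triple (vdiff Q x) y z + triple (ainv Q x) (vdiff Q y) z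
          + triple (ainv Q x) (ainv Q y) (vdiff Q z))"

lemma K_subspace: "fvs.subspace K"
  unfolding kaehler_rels_def by (rule fvs.subspace_span)

abbreviation kproj where "kproj \<equiv> kernel_map K"

lemmas kproj_hom = kernel_map(1)[OF K_subspace] and kproj_iff = kernel_map(2)[OF K_subspace]
lemmas kproj_simps = module_hom.add[OF kproj_hom] module_hom.diff[OF kproj_hom] module_hom.scale[OF kproj_hom]

lemma trilin_rels_subset_K: "trilin_rels Q Q Q \<subseteq> K"
  unfolding kaehler_rels_def using fvs.span_superset by blast

lemma leibniz_in_K:
  assumes "x \<in> vcar Q" "y \<in> vcar Q" "y' \<in> vcar Q" "z \<in> vcar Q"
  shows "triple x (amult Q y y') z - triple x y (amult Q y' z) - triple (amult Q x y) y' z \<in> K"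
  unfolding kaehler_rels_def by (rule fvs.span_base, rule UnI2) (use assms in blast)

lemma kproj_triple:
  assumes "x \<in> vcar Q" "y \<in> vcar Q" "z \<in> vcar Q"
  shows "x' \<in> vcar Q \<Longrightarrow> kproj (triple (vadd Q x x') y z) = kproj (triple x y z) + kproj (triple x' y z)"
    "y' \<in> vcar Q \<Longrightarrow> kproj (triple x (vadd Q y y') z) = kproj (triple x y z) + kproj (triple x y' z)"
    "z' \<in> vcar Q \<Longrightarrow> kproj (triple x y (vadd Q z z')) = kproj (triple x y z) + kproj (triple x y z')"
    "kproj (triple (vsmul Q c x) y z) = fscale c (kproj (triple x y z))"
    "kproj (triple x (vsmul Q c y) z) = fscale c (kproj (triple x y z))"
    "kproj (triple x y (vsmul Q c z)) = fscale c (kproj (triple x y z))"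
    "y' \<in> vcar Q \<Longrightarrow> kproj (triple x (amult Q y y') z)
      = kproj (triple x y (amult Q y' z)) + kproj (triple (amult Q x y) y' z)"
proof -
  have R: "kproj p = 0" if "p \<in> trilin_rels Q Q Q" for p
    using that trilin_rels_subset_K kproj_iff by blast
  show "x' \<in> vcar Q \<Longrightarrow> kproj (triple (vadd Q x x') y z) = kproj (triple x y z) + kproj (triple x' y z)"
    using R[OF trilin_relsI(1)[of x Q x' y Q z Q]] assms by (simp add: kproj_simps algebra_simps)
  show "y' \<in> vcar Q \<Longrightarrow> kproj (triple x (vadd Q y y') z) = kproj (triple x y z) + kproj (triple x y' z)"
    using R[OF trilin_relsI(2)[of x Q y Q y' z Q]] assms by (simp add: kproj_simps algebra_simps)
  show "z' \<in> vcar Q \<Longrightarrow> kproj (triple x y (vadd Q z z')) = kproj (triple x y z) + kproj (triple x y z')"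
    using R[OF trilin_relsI(3)[of x Q y Q z Q z']] assms by (simp add: kproj_simps algebra_simps)
  show "kproj (triple (vsmul Q c x) y z) = fscale c (kproj (triple x y z))"
    using R[OF trilin_relsI(4)[of x Q y Q z Q c]] assms by (simp add: kproj_simps)
  show "kproj (triple x (vsmul Q c y) z) = fscale c (kproj (triple x y z))"
    using R[OF trilin_relsI(5)[of x Q y Q z Q c]] assms by (simp add: kproj_simps)
  show "kproj (triple x y (vsmul Q c z)) = fscale c (kproj (triple x y z))"
    using R[OF trilin_relsI(6)[of x Q y Q z Q c]] assms by (simp add: kproj_simps)
  assume "y' \<in> vcar Q"
  then have "kproj (triple x (amult Q y y') z - triple x y (amult Q y' z) - triple (amult Q x y) y' z) = 0"
    using leibniz_in_K assms kproj_iff by blast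
  then show "kproj (triple x (amult Q y y') z)
      = kproj (triple x y (amult Q y' z)) + kproj (triple (amult Q x y) y' z)"
    by (simp add: kproj_simps algebra_simps)
qed

lemma kaehler_rels_invariant:
  assumes h: "module_hom fscale fscale h" and p: "p \<in> K"
    and "\<And>q. q \<in> trilin_rels Q Q Q \<Longrightarrow> h q \<in> K"
    and "\<And>x y y' z. x \<in> vcar Q \<Longrightarrow> y \<in> vcar Q \<Longrightarrow> y' \<in> vcar Q \<Longrightarrow> z \<in> vcar Q \<Longrightarrow>
      h (triple x (amult Q y y') z - triple x y (amult Q y' z) - triple (amult Q x y) y' z) \<in> K"
  shows "h p \<in> K"
  by (rule fvs.hom_span_subset[OF h _ K_subspace p[unfolded kaehler_rels_def]]) (use assms(3,4) in auto)

text \<open>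
  Trilinearity relations are preserved since differential and grading involution are linear;
  for the Leibniz relation the Koszul signs match because the involution is multiplicative.
\<close>

lemma kdiff_K:
  assumes "p \<in> K" shows "lin kdiff p \<in> K"
proof -
  show ?thesis
  proof (rule kaehler_rels_invariant[OF lin_hom assms])
    fix q assume "q \<in> trilin_rels Q Q Q"
    then show "lin kdiff q \<in> K"
      unfolding kproj_iff[symmetric] trilin_rels_def
      by (elim UnE CollectE exE conjE)
        (simp_all add: lin_diff lin_scale lin_bas kdiff_def kproj_simps kproj_triple closed diff_add diff_smul inv_add inv_smul
          fvs.scale_right_distrib)
  next
    fix x y y' z assume "x \<in> vcar Q" "y \<in> vcar Q" "y' \<in> vcar Q" "z \<in> vcar Q"
    then show "lin kdiff (triple x (amult Q y y') z - triple x y (amult Q y' z) - triple (amult Q x y) y' z) \<in> K"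
      unfolding kproj_iff[symmetric]
      by (simp add: lin_diff lin_bas kdiff_def kproj_simps kproj_triple closed diff_mult inv_mult)
  qed
qed

lemma kact_K:
  assumes "p \<in> K" and q: "q \<in> vcar Q"
  shows "lin (\<lambda>(x, y, z). triple (amult Q q x) y z) p \<in> K" (is ?l)
    and "lin (\<lambda>(x, y, z). triple x y (amult Q z q)) p \<in> K" (is ?r)
proof -
  show ?l
  proof (rule kaehler_rels_invariant[OF lin_hom assms(1)])
    fix p assume "p \<in> trilin_rels Q Q Q"
    then show "lin (\<lambda>(x, y, z). triple (amult Q q x) y z) p \<in> K"
      unfolding kproj_iff[symmetric] trilin_rels_def
      by (elim UnE CollectE exE conjE)
        (simp_all add: lin_diff lin_scale lin_bas kproj_simps kproj_triple closed q mult_add_right mult_smul_right)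
  next
    fix x y y' z assume "x \<in> vcar Q" "y \<in> vcar Q" "y' \<in> vcar Q" "z \<in> vcar Q"
    then show "lin (\<lambda>(x, y, z). triple (amult Q q x) y z)
        (triple x (amult Q y y') z - triple x y (amult Q y' z) - triple (amult Q x y) y' z) \<in> K"
      unfolding kproj_iff[symmetric]
      by (simp add: lin_diff lin_bas kproj_simps kproj_triple closed q mult_assoc)
  qed
  show ?r
  proof (rule kaehler_rels_invariant[OF lin_hom assms(1)])
    fix p assume "p \<in> trilin_rels Q Q Q"
    then show "lin (\<lambda>(x, y, z). triple x y (amult Q z q)) p \<in> K"
      unfolding kproj_iff[symmetric] trilin_rels_def
      by (elim UnE CollectE exE conjE)
        (simp_all add: lin_diff lin_scale lin_bas kproj_simps kproj_triple closed q mult_add_left mult_smul_left)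
  next
    fix x y y' z assume "x \<in> vcar Q" "y \<in> vcar Q" "y' \<in> vcar Q" "z \<in> vcar Q"
    then show "lin (\<lambda>(x, y, z). triple x y (amult Q z q))
        (triple x (amult Q y y') z - triple x y (amult Q y' z) - triple (amult Q x y) y' z) \<in> K"
      unfolding kproj_iff[symmetric]
      by (simp add: lin_diff lin_bas kproj_simps kproj_triple closed q mult_assoc)
  qed
qed

lemmas record_defs = quotient_dgvs_def quotient_vs_def vs.defs dgvs.defs

lemma vcar_W: "vcar W = cls K ` UW"
  by (simp add: kaehler_def record_defs UW_def)

lemma hcomp_W: "hcomp W n = cls K ` fvs.span {triple x y z | x y z i j k.
          x \<in> hcomp Q i \<and> y \<in> hcomp Q j \<and> z \<in> hcomp Q k \<and> i + j + k = n}"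
  by (simp add: kaehler_def record_defs)

lemma vadd_W: "vadd W (cls K p) (cls K q) = cls K (p + q)"
  by (simp add: kaehler_def record_defs fvs.qlift2_plus[OF K_subspace])

lemma vsmul_W: "vsmul W c (cls K p) = cls K (fscale c p)"
  by (simp add: kaehler_def record_defs fvs.qlift_scale[OF K_subspace])

lemma vdiff_W: "vdiff W (cls K p) = cls K (lin kdiff p)"
proof -
  have "vdiff W = qlift K (lin kdiff)" by (simp add: kaehler_def record_defs kdiff_def)
  then show ?thesis using fvs.qlift_cls[OF K_subspace lin_add kdiff_K] by simp
qed

lemma lact_W: "x \<in> vcar Q \<Longrightarrow> lact W x (cls K p) = cls K (lin (\<lambda>(x', y, z). triple (amult Q x x') y z) p)"
proof -
  assume x: "x \<in> vcar Q"
  have "lact W x = qlift K (lin (\<lambda>(x', y, z). triple (amult Q x x') y z))"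
    by (simp add: kaehler_def record_defs)
  then show ?thesis using fvs.qlift_cls[OF K_subspace lin_add kact_K(1)[OF _ x]] by simp
qed

lemma ract_W: "x \<in> vcar Q \<Longrightarrow> ract W (cls K p) x = cls K (lin (\<lambda>(x', y, z). triple x' y (amult Q z x)) p)"
proof -
  assume x: "x \<in> vcar Q"
  have "ract W \<omega> x = qlift K (lin (\<lambda>(x', y, z). triple x' y (amult Q z x))) \<omega>" for \<omega>
    by (simp add: kaehler_def record_defs)
  then show ?thesis using fvs.qlift_cls[OF K_subspace lin_add kact_K(2)[OF _ x]] by simp
qed

lemmas W_simps = vadd_W vsmul_W vdiff_W lact_W ract_W

lemma triple_in_UW: "x \<in> vcar Q \<Longrightarrow> y \<in> vcar Q \<Longrightarrow> z \<in> vcar Q \<Longrightarrow> triple x y z \<in> UW"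
  unfolding UW_def by (rule fvs.span_base) blast

lemma UW_subspace: "fvs.subspace UW"
  unfolding UW_def by (rule fvs.subspace_span)

lemma UW_maps:
  assumes p: "p \<in> UW" and "\<And>x y z. x \<in> vcar Q \<Longrightarrow> y \<in> vcar Q \<Longrightarrow> z \<in> vcar Q \<Longrightarrow> f (x, y, z) \<in> UW"
  shows "lin f p \<in> UW"
  by (rule fvs.hom_span_subset[OF lin_hom _ UW_subspace p[unfolded UW_def]])
    (use assms(2) in \<open>auto simp: lin_bas\<close>)

lemma cls_in_W: "p \<in> UW \<Longrightarrow> cls K p \<in> vcar W"
  by (simp add: vcar_W)

lemma W_cases: "\<omega> \<in> vcar W \<Longrightarrow> (\<And>p. p \<in> UW \<Longrightarrow> \<omega> = cls K p \<Longrightarrow> thesis) \<Longrightarrow> thesis"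
  by (auto simp: vcar_W)

lemma W_closed:
  "\<omega> \<in> vcar W \<Longrightarrow> \<omega>' \<in> vcar W \<Longrightarrow> vadd W \<omega> \<omega>' \<in> vcar W"
  "\<omega> \<in> vcar W \<Longrightarrow> vsmul W c \<omega> \<in> vcar W"
  "\<omega> \<in> vcar W \<Longrightarrow> vdiff W \<omega> \<in> vcar W"
  "\<omega> \<in> vcar W \<Longrightarrow> x \<in> vcar Q \<Longrightarrow> lact W x \<omega> \<in> vcar W"
  "\<omega> \<in> vcar W \<Longrightarrow> x \<in> vcar Q \<Longrightarrow> ract W \<omega> x \<in> vcar W"
proof -
  show "\<omega> \<in> vcar W \<Longrightarrow> \<omega>' \<in> vcar W \<Longrightarrow> vadd W \<omega> \<omega>' \<in> vcar W"
    by (elim W_cases) (simp add: W_simps cls_in_W fvs.subspace_add[OF UW_subspace])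
  show "\<omega> \<in> vcar W \<Longrightarrow> vsmul W c \<omega> \<in> vcar W"
    by (elim W_cases) (simp add: W_simps cls_in_W fvs.subspace_scale[OF UW_subspace])
  show "\<omega> \<in> vcar W \<Longrightarrow> vdiff W \<omega> \<in> vcar W"
    by (elim W_cases)
      (simp add: W_simps cls_in_W UW_maps kdiff_def fvs.subspace_add[OF UW_subspace] triple_in_UW closed)
  show "\<omega> \<in> vcar W \<Longrightarrow> x \<in> vcar Q \<Longrightarrow> lact W x \<omega> \<in> vcar W"
    by (elim W_cases) (simp add: W_simps cls_in_W UW_maps triple_in_UW closed)
  show "\<omega> \<in> vcar W \<Longrightarrow> x \<in> vcar Q \<Longrightarrow> ract W \<omega> x \<in> vcar W"
    by (elim W_cases) (simp add: W_simps cls_in_W UW_maps triple_in_UW closed)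
qed

lemma W_diff_linear:
  "\<omega> \<in> vcar W \<Longrightarrow> \<omega>' \<in> vcar W \<Longrightarrow> vdiff W (vadd W \<omega> \<omega>') = vadd W (vdiff W \<omega>) (vdiff W \<omega>')"
  "\<omega> \<in> vcar W \<Longrightarrow> vdiff W (vsmul W c \<omega>) = vsmul W c (vdiff W \<omega>)"
  by (auto elim!: W_cases simp: W_simps lin_add lin_scale)

lemma cong_on_UW:
  assumes f: "module_hom fscale fscale f" "module_hom fscale fscale g" and p: "p \<in> UW"
    and "\<And>x y z. x \<in> vcar Q \<Longrightarrow> y \<in> vcar Q \<Longrightarrow> z \<in> vcar Q \<Longrightarrow> f (triple x y z) - g (triple x y z) \<in> K"
  shows "cls K (f p) = cls K (g p)"
proof -
  have h: "module_hom fscale fscale (\<lambda>p. f p - g p)"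
    by unfold_locales
      (simp_all add: module_hom.add[OF f(1)] module_hom.add[OF f(2)] module_hom.scale[OF f(1)]
        module_hom.scale[OF f(2)] fvs.scale_right_diff_distrib)
  have "f p - g p \<in> K"
    by (rule fvs.hom_span_subset[OF h _ K_subspace p[unfolded UW_def]]) (use assms(4) in auto)
  then show ?thesis by (simp add: fvs.cls_eq_iff[OF K_subspace])
qed

lemma W_diff_lact:
  assumes "\<omega> \<in> vcar W" and q: "q \<in> vcar Q"
  shows "vdiff W (lact W q \<omega>) = vadd W (lact W (vdiff Q q) \<omega>) (lact W (ainv Q q) (vdiff W \<omega>))"
proof -
  obtain p where p: "p \<in> UW" "\<omega> = cls K p" using assms by (elim W_cases)
  let ?l = "\<lambda>q. lin (\<lambda>(x, y, z). triple (amult Q q x) y z)"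
  have "cls K (lin kdiff (?l q p)) = cls K (?l (vdiff Q q) p + ?l (ainv Q q) (lin kdiff p))"
  proof (rule cong_on_UW[OF hom_compose[OF lin_hom lin_hom] _ p(1)])
    show "module_hom fscale fscale (\<lambda>p. ?l (vdiff Q q) p + ?l (ainv Q q) (lin kdiff p))"
      by unfold_locales (simp_all add: lin_add lin_scale fvs.scale_right_distrib)
    fix x y z assume "x \<in> vcar Q" "y \<in> vcar Q" "z \<in> vcar Q"
    then show "lin kdiff (?l q (triple x y z))
        - (?l (vdiff Q q) (triple x y z) + ?l (ainv Q q) (lin kdiff (triple x y z))) \<in> K"
      unfolding kproj_iff[symmetric]
      by (simp add: lin_bas lin_add kdiff_def kproj_simps kproj_triple closed q diff_mult inv_mult)
  qed
  then show ?thesis using q by (simp add: p(2) W_simps closed)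
qed

text \<open>
  The element \<open>\<omega>'\<close> is \<open>\<omega>\<close> with its Koszul sign. Only its existence matters: in the base
  change the last term vanishes, as the augmentation kills boundaries.
\<close>

lemma W_diff_ract:
  assumes "\<omega> \<in> vcar W" and q: "q \<in> vcar Q"
  shows "\<exists>\<omega>'\<in>vcar W. vdiff W (ract W \<omega> q) = vadd W (ract W (vdiff W \<omega>) q) (ract W \<omega>' (vdiff Q q))"
proof -
  obtain p where p: "p \<in> UW" "\<omega> = cls K p" using assms by (elim W_cases)
  let ?r = "\<lambda>q. lin (\<lambda>(x, y, z). triple x y (amult Q z q))"
  let ?i = "lin (\<lambda>(x, y, z). triple (ainv Q x) (ainv Q y) (ainv Q z))"
  have "cls K (lin kdiff (?r q p)) = cls K (?r q (lin kdiff p) + ?r (vdiff Q q) (?i p))"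
  proof (rule cong_on_UW[OF hom_compose[OF lin_hom lin_hom] _ p(1)])
    show "module_hom fscale fscale (\<lambda>p. ?r q (lin kdiff p) + ?r (vdiff Q q) (?i p))"
      by unfold_locales (simp_all add: lin_add lin_scale fvs.scale_right_distrib)
    fix x y z assume "x \<in> vcar Q" "y \<in> vcar Q" "z \<in> vcar Q"
    then show "lin kdiff (?r q (triple x y z))
        - (?r q (lin kdiff (triple x y z)) + ?r (vdiff Q q) (?i (triple x y z))) \<in> K"
      unfolding kproj_iff[symmetric]
      by (simp add: lin_bas lin_add kdiff_def kproj_simps kproj_triple closed q diff_mult)
  qed
  moreover have "?i p \<in> UW"
    by (rule UW_maps[OF p(1)]) (simp add: triple_in_UW closed)
  ultimately show ?thesis using q
    by (intro bexI[of _ "cls K (?i p)"]) (auto simp: p(2) W_simps closed cls_in_W)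
qed

end

section \<open>Base change\<close>

context augmented_dg_algebra
begin

abbreviation C where "C \<equiv> base_change scaleA Q \<epsilon> W"
abbreviation B where "B \<equiv> base_change_rels scaleA Q \<epsilon> W"
abbreviation (input) Av where "Av \<equiv> \<lparr>vcar = UNIV, vadd = (+), vsmul = scaleA\<rparr> :: ('k, 'a) vs"
definition UC where "UC = fvs.span {triple a \<omega> b | a \<omega> b. \<omega> \<in> vcar W}"

lemma B_eq: "B = fvs.span (trilin_rels Av W Av
        \<union> {triple (a * \<epsilon> q) \<omega> b - triple a (lact W q \<omega>) b | a q \<omega> b.
             q \<in> vcar Q \<and> \<omega> \<in> vcar W}
        \<union> {triple a (ract W \<omega> q) b - triple a \<omega> (\<epsilon> q * b) | a q \<omega> b.
             q \<in> vcar Q \<and> \<omega> \<in> vcar W})"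
  by (simp only: base_change_rels_def Let_def)

lemma B_subspace: "fvs.subspace B"
  unfolding B_eq by (rule fvs.subspace_span)

lemma B_rels:
  "\<omega> \<in> vcar W \<Longrightarrow> triple (a + a') \<omega> b - triple a \<omega> b - triple a' \<omega> b \<in> B"
  "\<omega> \<in> vcar W \<Longrightarrow> \<omega>' \<in> vcar W \<Longrightarrow> triple a (vadd W \<omega> \<omega>') b - triple a \<omega> b - triple a \<omega>' b \<in> B"
  "\<omega> \<in> vcar W \<Longrightarrow> triple a \<omega> (b + b') - triple a \<omega> b - triple a \<omega> b' \<in> B"
  "\<omega> \<in> vcar W \<Longrightarrow> triple (scaleA c a) \<omega> b - fscale c (triple a \<omega> b) \<in> B"
  "\<omega> \<in> vcar W \<Longrightarrow> triple a (vsmul W c \<omega>) b - fscale c (triple a \<omega> b) \<in> B"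
  "\<omega> \<in> vcar W \<Longrightarrow> triple a \<omega> (scaleA c b) - fscale c (triple a \<omega> b) \<in> B"
  "\<omega> \<in> vcar W \<Longrightarrow> q \<in> vcar Q \<Longrightarrow> triple (a * \<epsilon> q) \<omega> b - triple a (lact W q \<omega>) b \<in> B"
  "\<omega> \<in> vcar W \<Longrightarrow> q \<in> vcar Q \<Longrightarrow> triple a (ract W \<omega> q) b - triple a \<omega> (\<epsilon> q * b) \<in> B"
proof -
  have sub: "p \<in> trilin_rels Av W Av \<Longrightarrow> p \<in> B" for p
    unfolding B_eq by (rule fvs.span_base, rule UnI1, rule UnI1)
  assume w: "\<omega> \<in> vcar W"
  show "triple (a + a') \<omega> b - triple a \<omega> b - triple a' \<omega> b \<in> B"
    using sub[OF trilin_relsI(1)[of a Av a' \<omega> W b Av]] w by simp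
  show "triple a \<omega> (b + b') - triple a \<omega> b - triple a \<omega> b' \<in> B"
    using sub[OF trilin_relsI(3)[of a Av \<omega> W b Av b']] w by simp
  show "triple (scaleA c a) \<omega> b - fscale c (triple a \<omega> b) \<in> B"
    using sub[OF trilin_relsI(4)[of a Av \<omega> W b Av c]] w by simp
  show "triple a (vsmul W c \<omega>) b - fscale c (triple a \<omega> b) \<in> B"
    using sub[OF trilin_relsI(5)[of a Av \<omega> W b Av c]] w by simp
  show "triple a \<omega> (scaleA c b) - fscale c (triple a \<omega> b) \<in> B"
    using sub[OF trilin_relsI(6)[of a Av \<omega> W b Av c]] w by simp
  show "triple a (vadd W \<omega> \<omega>') b - triple a \<omega> b - triple a \<omega>' b \<in> B" if "\<omega>' \<in> vcar W"
    using sub[OF trilin_relsI(2)[of a Av \<omega> W \<omega>' b Av]] w that by simp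
  assume q: "q \<in> vcar Q"
  show "triple (a * \<epsilon> q) \<omega> b - triple a (lact W q \<omega>) b \<in> B"
    unfolding B_eq by (rule fvs.span_base) (use q w in blast)
  show "triple a (ract W \<omega> q) b - triple a \<omega> (\<epsilon> q * b) \<in> B"
    unfolding B_eq by (rule fvs.span_base) (use q w in blast)
qed

lemma B_invariant:
  assumes S: "vector_space s" and h: "module_hom fscale s h" and T: "module.subspace s T" and p: "p \<in> B"
    and "\<And>a a' \<omega> b. \<omega> \<in> vcar W \<Longrightarrow> h (triple (a + a') \<omega> b - triple a \<omega> b - triple a' \<omega> b) \<in> T"
    and "\<And>a \<omega> \<omega>' b. \<omega> \<in> vcar W \<Longrightarrow> \<omega>' \<in> vcar W \<Longrightarrow> h (triple a (vadd W \<omega> \<omega>') b - triple a \<omega> b - triple a \<omega>' b) \<in> T"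
    and "\<And>a \<omega> b b'. \<omega> \<in> vcar W \<Longrightarrow> h (triple a \<omega> (b + b') - triple a \<omega> b - triple a \<omega> b') \<in> T"
    and "\<And>c a \<omega> b. \<omega> \<in> vcar W \<Longrightarrow> h (triple (scaleA c a) \<omega> b - fscale c (triple a \<omega> b)) \<in> T"
    and "\<And>c a \<omega> b. \<omega> \<in> vcar W \<Longrightarrow> h (triple a (vsmul W c \<omega>) b - fscale c (triple a \<omega> b)) \<in> T"
    and "\<And>c a \<omega> b. \<omega> \<in> vcar W \<Longrightarrow> h (triple a \<omega> (scaleA c b) - fscale c (triple a \<omega> b)) \<in> T"
    and "\<And>a q \<omega> b. q \<in> vcar Q \<Longrightarrow> \<omega> \<in> vcar W \<Longrightarrow> h (triple (a * \<epsilon> q) \<omega> b - triple a (lact W q \<omega>) b) \<in> T"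
    and "\<And>a q \<omega> b. q \<in> vcar Q \<Longrightarrow> \<omega> \<in> vcar W \<Longrightarrow> h (triple a (ract W \<omega> q) b - triple a \<omega> (\<epsilon> q * b)) \<in> T"
  shows "h p \<in> T"
  by (rule vector_space.hom_span_subset[OF S h _ T p[unfolded B_eq]])
    (unfold trilin_rels_def, auto simp: assms(5-))

definition bdiff where "bdiff = (\<lambda>(a, \<omega>, b). triple a (vdiff W \<omega>) b)"

lemma B_zero: "\<omega> \<in> vcar W \<Longrightarrow> triple 0 \<omega> b \<in> B" "\<omega> \<in> vcar W \<Longrightarrow> triple a \<omega> 0 \<in> B"
  using B_rels(4)[of \<omega> 0 0 b] B_rels(6)[of \<omega> a 0 0] by simp_all

text \<open>
  The differential of a balancing relation is a balancing relation plus a term in which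
  \<open>\<epsilon> (vdiff Q q) = 0\<close> appears.
\<close>

lemma bdiff_B:
  assumes "p \<in> B" shows "lin bdiff p \<in> B"
proof (rule B_invariant[OF fvs.vector_space_axioms lin_hom B_subspace assms], goal_cases)
  case (2 a \<omega> \<omega>' b)
  then show ?case using B_rels(2)[of "vdiff W \<omega>" "vdiff W \<omega>'" a b]
    by (simp add: lin_diff lin_bas bdiff_def W_diff_linear W_closed)
next
  case (5 c a \<omega> b)
  then show ?case using B_rels(5)[of "vdiff W \<omega>" a c b]
    by (simp add: lin_diff lin_scale lin_bas bdiff_def W_diff_linear W_closed)
next
  case (7 a q \<omega> b)
  note cl = 7 W_closed closed
  have r1: "triple (a * \<epsilon> q) (vdiff W \<omega>) b - triple a (lact W (ainv Q q) (vdiff W \<omega>)) b \<in> B"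
    using B_rels(7)[of "vdiff W \<omega>" "ainv Q q" a b] cl by (simp add: aug_inv)
  have r2: "triple 0 \<omega> b - triple a (lact W (vdiff Q q) \<omega>) b \<in> B"
    using B_rels(7)[of \<omega> "vdiff Q q" a b] cl by (simp add: aug_diff)
  have r3: "triple a (vadd W (lact W (vdiff Q q) \<omega>) (lact W (ainv Q q) (vdiff W \<omega>))) b
     - triple a (lact W (vdiff Q q) \<omega>) b - triple a (lact W (ainv Q q) (vdiff W \<omega>)) b \<in> B"
    by (rule B_rels(2)) (use cl in auto)
  have "(triple (a * \<epsilon> q) (vdiff W \<omega>) b - triple a (lact W (ainv Q q) (vdiff W \<omega>)) b)
     + (triple 0 \<omega> b - triple a (lact W (vdiff Q q) \<omega>) b) - triple 0 \<omega> b
     - (triple a (vadd W (lact W (vdiff Q q) \<omega>) (lact W (ainv Q q) (vdiff W \<omega>))) b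
     - triple a (lact W (vdiff Q q) \<omega>) b - triple a (lact W (ainv Q q) (vdiff W \<omega>)) b) \<in> B"
    by (rule fvs.subspace_diff[OF B_subspace fvs.subspace_diff[OF B_subspace
            fvs.subspace_add[OF B_subspace r1 r2] B_zero(1)[OF 7(2)]] r3])
  then show ?case
    by (simp add: lin_diff lin_bas bdiff_def W_diff_lact 7)
next
  case (8 a q \<omega> b)
  note cl = 8 W_closed closed
  obtain \<omega>' where w: "\<omega>' \<in> vcar W" "vdiff W (ract W \<omega> q) = vadd W (ract W (vdiff W \<omega>) q) (ract W \<omega>' (vdiff Q q))"
    using W_diff_ract[OF 8(2,1)] by blast
  have r1: "triple a (ract W (vdiff W \<omega>) q) b - triple a (vdiff W \<omega>) (\<epsilon> q * b) \<in> B"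
    using B_rels(8)[of "vdiff W \<omega>" q a b] cl by simp
  have r2: "triple a (ract W \<omega>' (vdiff Q q)) b - triple a \<omega>' 0 \<in> B"
    using B_rels(8)[of \<omega>' "vdiff Q q" a b] cl w by (simp add: aug_diff)
  have r3: "triple a (vadd W (ract W (vdiff W \<omega>) q) (ract W \<omega>' (vdiff Q q))) b
     - triple a (ract W (vdiff W \<omega>) q) b - triple a (ract W \<omega>' (vdiff Q q)) b \<in> B"
    by (rule B_rels(2)) (use cl w in auto)
  have "(triple a (ract W (vdiff W \<omega>) q) b - triple a (vdiff W \<omega>) (\<epsilon> q * b))
     + (triple a (ract W \<omega>' (vdiff Q q)) b - triple a \<omega>' 0) + triple a \<omega>' 0
     + (triple a (vadd W (ract W (vdiff W \<omega>) q) (ract W \<omega>' (vdiff Q q))) b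
     - triple a (ract W (vdiff W \<omega>) q) b - triple a (ract W \<omega>' (vdiff Q q)) b) \<in> B"
    by (rule fvs.subspace_add[OF B_subspace fvs.subspace_add[OF B_subspace
            fvs.subspace_add[OF B_subspace r1 r2] B_zero(2)[OF w(1)]] r3])
  then show ?case
    by (simp add: lin_diff lin_bas bdiff_def w(2))
qed (simp_all add: lin_diff lin_scale lin_bas bdiff_def B_rels W_closed)

lemma bact_B:
  assumes "p \<in> B"
  shows "lin (\<lambda>(a, \<omega>, b). triple (a' * a) \<omega> b) p \<in> B"
    and "lin (\<lambda>(a, \<omega>, b). triple a \<omega> (b * b')) p \<in> B"
proof -
  show "lin (\<lambda>(a, \<omega>, b). triple (a' * a) \<omega> b) p \<in> B"
    by (rule B_invariant[OF fvs.vector_space_axioms lin_hom B_subspace assms])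
      (simp_all add: lin_diff lin_scale lin_bas B_rels distrib_left A.scale_mult_right flip: mult.assoc)
  show "lin (\<lambda>(a, \<omega>, b). triple a \<omega> (b * b')) p \<in> B"
    by (rule B_invariant[OF fvs.vector_space_axioms lin_hom B_subspace assms])
      (simp_all add: lin_diff lin_scale lin_bas B_rels distrib_right A.scale_mult_left mult.assoc)
qed

lemma vcar_C: "vcar C = cls B ` UC"
  by (simp add: base_change_def Let_def record_defs UC_def)

lemma hcomp_C: "hcomp C n = cls B ` fvs.span {triple a \<omega> b | a \<omega> b. \<omega> \<in> hcomp W n}"
  by (simp add: base_change_def Let_def record_defs)

lemma vadd_C: "vadd C (cls B p) (cls B q) = cls B (p + q)"
  by (simp add: base_change_def Let_def record_defs fvs.qlift2_plus[OF B_subspace])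

lemma vsmul_C: "vsmul C c (cls B p) = cls B (fscale c p)"
  by (simp add: base_change_def Let_def record_defs fvs.qlift_scale[OF B_subspace])

lemma vdiff_C: "vdiff C (cls B p) = cls B (lin bdiff p)"
proof -
  have "vdiff C = qlift B (lin bdiff)" by (simp add: base_change_def Let_def record_defs bdiff_def)
  then show ?thesis using fvs.qlift_cls[OF B_subspace lin_add bdiff_B] by simp
qed

lemma lact_C: "lact C a' (cls B p) = cls B (lin (\<lambda>(a, \<omega>, b). triple (a' * a) \<omega> b) p)"
proof -
  have "lact C a' = qlift B (lin (\<lambda>(a, \<omega>, b). triple (a' * a) \<omega> b))"
    by (simp add: base_change_def Let_def record_defs)
  then show ?thesis by (simp only:) (rule fvs.qlift_cls[OF B_subspace], auto simp: lin_add bact_B)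
qed

lemma ract_C: "ract C (cls B p) b' = cls B (lin (\<lambda>(a, \<omega>, b). triple a \<omega> (b * b')) p)"
proof -
  have "ract C x b' = qlift B (lin (\<lambda>(a, \<omega>, b). triple a \<omega> (b * b'))) x" for x
    by (simp add: base_change_def Let_def record_defs)
  then show ?thesis by (simp only:) (rule fvs.qlift_cls[OF B_subspace], auto simp: lin_add bact_B)
qed

lemmas C_simps = vadd_C vsmul_C vdiff_C lact_C ract_C

lemma triple_in_UC: "\<omega> \<in> vcar W \<Longrightarrow> triple a \<omega> b \<in> UC"
  unfolding UC_def by (rule fvs.span_base) blast

lemma UC_subspace: "fvs.subspace UC"
  unfolding UC_def by (rule fvs.subspace_span)

lemma UC_maps:
  assumes p: "p \<in> UC" and "\<And>a \<omega> b. \<omega> \<in> vcar W \<Longrightarrow> f (a, \<omega>, b) \<in> UC"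
  shows "lin f p \<in> UC"
  by (rule fvs.hom_span_subset[OF lin_hom _ UC_subspace p[unfolded UC_def]])
    (use assms(2) in \<open>auto simp: lin_bas\<close>)

lemma cls_in_C: "p \<in> UC \<Longrightarrow> cls B p \<in> vcar C"
  by (simp add: vcar_C)

lemma C_cases: "x \<in> vcar C \<Longrightarrow> (\<And>p. p \<in> UC \<Longrightarrow> x = cls B p \<Longrightarrow> thesis) \<Longrightarrow> thesis"
  by (auto simp: vcar_C)

lemma C_closed:
  "x \<in> vcar C \<Longrightarrow> y \<in> vcar C \<Longrightarrow> vadd C x y \<in> vcar C"
  "x \<in> vcar C \<Longrightarrow> vsmul C c x \<in> vcar C"
  "x \<in> vcar C \<Longrightarrow> lact C a x \<in> vcar C"
  "x \<in> vcar C \<Longrightarrow> ract C x a \<in> vcar C"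
proof -
  show "x \<in> vcar C \<Longrightarrow> y \<in> vcar C \<Longrightarrow> vadd C x y \<in> vcar C"
    by (elim C_cases) (simp add: C_simps cls_in_C fvs.subspace_add[OF UC_subspace])
  show "x \<in> vcar C \<Longrightarrow> vsmul C c x \<in> vcar C"
    by (elim C_cases) (simp add: C_simps cls_in_C fvs.subspace_scale[OF UC_subspace])
  show "x \<in> vcar C \<Longrightarrow> lact C a x \<in> vcar C" "x \<in> vcar C \<Longrightarrow> ract C x a \<in> vcar C"
    by (elim C_cases; simp add: C_simps cls_in_C UC_maps triple_in_UC)+
qed

lemma triple_in_C: "\<omega> \<in> vcar W \<Longrightarrow> cls B (triple a \<omega> b) \<in> vcar C"
  by (intro cls_in_C triple_in_UC)

lemma cls_B_rels:
  "\<omega> \<in> vcar W \<Longrightarrow> \<omega>' \<in> vcar W \<Longrightarrow>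
    cls B (triple a (vadd W \<omega> \<omega>') b) = vadd C (cls B (triple a \<omega> b)) (cls B (triple a \<omega>' b))"
  "\<omega> \<in> vcar W \<Longrightarrow> cls B (triple a (vsmul W c \<omega>) b) = vsmul C c (cls B (triple a \<omega> b))"
  "q \<in> vcar Q \<Longrightarrow> \<omega> \<in> vcar W \<Longrightarrow> cls B (triple a (lact W q \<omega>) b) = cls B (triple (a * \<epsilon> q) \<omega> b)"
  "q \<in> vcar Q \<Longrightarrow> \<omega> \<in> vcar W \<Longrightarrow> cls B (triple a (ract W \<omega> q) b) = cls B (triple a \<omega> (\<epsilon> q * b))"
  using B_rels(2)[of \<omega> \<omega>' a b] B_rels(5)[of \<omega> a c b] fvs.subspace_neg[OF B_subspace B_rels(7)[of \<omega> q a b]]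
    B_rels(8)[of \<omega> q a b]
  by (simp_all add: C_simps fvs.cls_eq_iff[OF B_subspace] diff_diff_eq)

text \<open>
  The image \<open>1 \<otimes> dy \<otimes> 1\<close> of the universal derivation in the base change.
\<close>

definition gen :: "'q \<Rightarrow> _" where
  "gen y = cls B (triple 1 (cls K (triple (aone Q) y (aone Q))) 1)"

lemma omega_in_W: "x \<in> vcar Q \<Longrightarrow> y \<in> vcar Q \<Longrightarrow> z \<in> vcar Q \<Longrightarrow> cls K (triple x y z) \<in> vcar W"
  by (intro cls_in_W triple_in_UW)

lemma gen_in_C: "y \<in> vcar Q \<Longrightarrow> gen y \<in> vcar C"
  by (simp add: gen_def triple_in_C omega_in_W closed)

lemma triple_gen:
  assumes "x \<in> vcar Q" "y \<in> vcar Q" "z \<in> vcar Q"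
  shows "cls B (triple a (cls K (triple x y z)) b) = lact C (a * \<epsilon> x) (ract C (gen y) (\<epsilon> z * b))"
proof -
  let ?w = "cls K (triple (aone Q) y (aone Q))"
  have w: "?w \<in> vcar W" using assms by (simp add: omega_in_W closed)
  have "cls K (triple x y z) = lact W x (ract W ?w z)"
    using assms by (simp add: W_simps lin_bas closed one_left one_right)
  then have "cls B (triple a (cls K (triple x y z)) b) = cls B (triple (a * \<epsilon> x) ?w (\<epsilon> z * b))"
    using assms w by (simp add: cls_B_rels W_closed)
  also have "\<dots> = lact C (a * \<epsilon> x) (ract C (gen y) (\<epsilon> z * b))"
    by (simp add: gen_def C_simps lin_bas)
  finally show ?thesis .
qed

lemma gen_linear:
  "x \<in> vcar Q \<Longrightarrow> y \<in> vcar Q \<Longrightarrow> gen (vadd Q x y) = vadd C (gen x) (gen y)"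
  "x \<in> vcar Q \<Longrightarrow> gen (vsmul Q c x) = vsmul C c (gen x)"
proof -
  assume x: "x \<in> vcar Q"
  have "triple (aone Q) (vsmul Q c x) (aone Q) - fscale c (triple (aone Q) x (aone Q)) \<in> K"
    using trilin_relsI(5)[of _ Q _ Q _ Q, OF one_closed x one_closed] trilin_rels_subset_K by blast
  then have "cls K (triple (aone Q) (vsmul Q c x) (aone Q)) = vsmul W c (cls K (triple (aone Q) x (aone Q)))"
    unfolding vsmul_W fvs.cls_eq_iff[OF K_subspace] .
  then show "gen (vsmul Q c x) = vsmul C c (gen x)"
    using x by (simp add: gen_def cls_B_rels omega_in_W closed)
  assume y: "y \<in> vcar Q"
  have "triple (aone Q) (vadd Q x y) (aone Q) - triple (aone Q) x (aone Q) - triple (aone Q) y (aone Q) \<in> K"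
    using trilin_relsI(2)[of _ Q _ Q _ _ Q, OF one_closed x y one_closed] trilin_rels_subset_K by blast
  then have "cls K (triple (aone Q) (vadd Q x y) (aone Q))
      = vadd W (cls K (triple (aone Q) x (aone Q))) (cls K (triple (aone Q) y (aone Q)))"
    unfolding vadd_W fvs.cls_eq_iff[OF K_subspace] diff_diff_eq .
  then show "gen (vadd Q x y) = vadd C (gen x) (gen y)"
    using x y by (simp add: gen_def cls_B_rels omega_in_W closed)
qed

lemma gen_mult:
  assumes "x \<in> vcar Q" "y \<in> vcar Q"
  shows "gen (amult Q x y) = vadd C (ract C (gen x) (\<epsilon> y)) (lact C (\<epsilon> x) (gen y))"
proof -
  let ?o = "aone Q"
  have "triple ?o (amult Q x y) ?o - triple ?o x (amult Q y ?o) - triple (amult Q ?o x) y ?o \<in> K"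
    by (rule leibniz_in_K) (use assms closed in auto)
  then have "cls K (triple ?o (amult Q x y) ?o) = vadd W (cls K (triple ?o x y)) (cls K (triple x y ?o))"
    using assms by (simp add: W_simps fvs.cls_eq_iff[OF K_subspace] one_left one_right diff_diff_eq)
  moreover have "lact C 1 (ract C (gen x) (\<epsilon> y)) = ract C (gen x) (\<epsilon> y)"
    "ract C (gen y) 1 = gen y"
    by (simp_all add: gen_def C_simps lin_bas)
  ultimately show ?thesis
    using assms unfolding gen_def[of "amult Q x y"]
    by (simp add: cls_B_rels omega_in_W closed triple_gen aug_one)
qed

lemma C_diff:
  assumes "x \<in> vcar C"
  shows "vdiff C x \<in> vcar C"
    "y \<in> vcar C \<Longrightarrow> vdiff C (vadd C x y) = vadd C (vdiff C x) (vdiff C y)"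
    "vdiff C (vsmul C c x) = vsmul C c (vdiff C x)"
    "vdiff C (lact C a x) = lact C a (vdiff C x)"
    "vdiff C (ract C x a) = ract C (vdiff C x) a"
proof -
  obtain p where p: "p \<in> UC" "x = cls B p" using assms by (elim C_cases)
  show "vdiff C x \<in> vcar C"
    using p by (simp add: C_simps cls_in_C UC_maps bdiff_def triple_in_UC W_closed)
  show "vdiff C (vadd C x y) = vadd C (vdiff C x) (vdiff C y)" if "y \<in> vcar C"
    using that p by (auto elim!: C_cases simp: C_simps lin_add)
  show "vdiff C (vsmul C c x) = vsmul C c (vdiff C x)"
    using p by (simp add: C_simps lin_scale)
  have comm: "lin f (lin bdiff q) = lin bdiff (lin f q)"
    if "\<And>a \<omega> b. lin bdiff (f (a, \<omega>, b)) = f (a, vdiff W \<omega>, b)" for f q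
    by (rule fvs.hom_eq_on_basis[OF hom_compose[OF lin_hom lin_hom] hom_compose[OF lin_hom lin_hom]])
      (clarsimp simp: lin_bas bdiff_def that[unfolded bdiff_def])
  have "lin (\<lambda>(a', \<omega>, b). triple (a * a') \<omega> b) (lin bdiff p) = lin bdiff (lin (\<lambda>(a', \<omega>, b). triple (a * a') \<omega> b) p)"
    by (rule comm) (simp add: lin_bas bdiff_def)
  then show "vdiff C (lact C a x) = lact C a (vdiff C x)"
    by (simp only: p(2) C_simps)
  have "lin (\<lambda>(a', \<omega>, b). triple a' \<omega> (b * a)) (lin bdiff p) = lin bdiff (lin (\<lambda>(a', \<omega>, b). triple a' \<omega> (b * a)) p)"
    by (rule comm) (simp add: lin_bas bdiff_def)
  then show "vdiff C (ract C x a) = ract C (vdiff C x) a"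
    by (simp only: p(2) C_simps)
qed

end

section \<open>Bimodule maps and derivations\<close>

locale coefficient_bimodule = augmented_dg_algebra Q scaleA \<epsilon> + unital_bimodule scaleA scaleM l r
  for Q :: "('k::field, 'q) dga" and scaleA :: "'k \<Rightarrow> 'a::{ring,monoid_mult} \<Rightarrow> 'a"
    and \<epsilon> :: "'q \<Rightarrow> 'a" and scaleM :: "'k \<Rightarrow> 'm::ab_group_add \<Rightarrow> 'm"
    and l :: "'a \<Rightarrow> 'm \<Rightarrow> 'm" and r :: "'m \<Rightarrow> 'a \<Rightarrow> 'm"

context unital_bimodule
begin

lemma l_zero [simp]: "l 0 x = 0" "l a 0 = 0" and r_zero [simp]: "r 0 a = 0" "r x 0 = 0"
  using l_add(1)[of 0 0 x] l_add(2)[of a 0 0] r_add(1)[of 0 0 a] r_add(2)[of x 0 0] by simp_all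

lemma l_minus: "l a (- x) = - l a x" and r_minus: "r (- x) a = - r x a"
  using l_add(2)[of a x "- x"] r_add(1)[of x "- x" a]
  by (simp_all add: eq_neg_iff_add_eq_0 add.commute)

lemma l_diff: "l a (x - y) = l a x - l a y" and r_diff: "r (x - y) a = r x a - r y a"
  by (simp_all only: diff_conv_add_uminus l_add r_add l_minus r_minus)

end

context coefficient_bimodule
begin

definition bimod_map :: "(_ \<Rightarrow> 'm) \<Rightarrow> bool" where
  "bimod_map f \<longleftrightarrow> (\<forall>x\<in>vcar C. \<forall>y\<in>vcar C. f (vadd C x y) = f x + f y) \<and>
     (\<forall>c. \<forall>x\<in>vcar C. f (vsmul C c x) = scaleM c (f x)) \<and>
     (\<forall>a. \<forall>x\<in>vcar C. f (lact C a x) = l a (f x)) \<and>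
     (\<forall>a. \<forall>x\<in>vcar C. f (ract C x a) = r (f x) a)"

definition derivation :: "('q \<Rightarrow> 'm) \<Rightarrow> bool" where
  "derivation D \<longleftrightarrow> (\<forall>x\<in>vcar Q. \<forall>y\<in>vcar Q. D (vadd Q x y) = D x + D y) \<and>
     (\<forall>c. \<forall>x\<in>vcar Q. D (vsmul Q c x) = scaleM c (D x)) \<and>
     (\<forall>x\<in>vcar Q. \<forall>y\<in>vcar Q. D (amult Q x y) = r (D x) (\<epsilon> y) + l (\<epsilon> x) (D y))"

lemma bimod_mapD:
  assumes "bimod_map f" "x \<in> vcar C"
  shows "y \<in> vcar C \<Longrightarrow> f (vadd C x y) = f x + f y" "f (vsmul C c x) = scaleM c (f x)"
    "f (lact C a x) = l a (f x)" "f (ract C x a) = r (f x) a"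
  using assms unfolding bimod_map_def by blast+

lemma bimod_map_gen:
  assumes "bimod_map f" "x \<in> vcar Q" "y \<in> vcar Q" "z \<in> vcar Q"
  shows "f (cls B (triple a (cls K (triple x y z)) b)) = l (a * \<epsilon> x) (r (f (gen y)) (\<epsilon> z * b))"
  using assms by (simp add: triple_gen bimod_mapD[OF assms(1)] C_closed gen_in_C)

lemma bimod_map_derivation:
  assumes "bimod_map f"
  shows "derivation (\<lambda>y. f (gen y))"
  unfolding derivation_def
  by (simp add: gen_linear gen_mult gen_in_C C_closed bimod_mapD[OF assms])

text \<open>
  Of the three terms of the differential of \<open>1 dy 1\<close>, those with a differential of the unit
  are killed by the augmentation.
\<close>

lemma bimod_map_diff_gen:
  assumes f: "bimod_map f" and y: "y \<in> vcar Q"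
  shows "f (vdiff C (gen y)) = f (gen (vdiff Q y))"
proof -
  let ?o = "aone Q"
  let ?w1 = "cls K (triple (vdiff Q ?o) y ?o)" and ?w2 = "cls K (triple (ainv Q ?o) (vdiff Q y) ?o)"
    and ?w3 = "cls K (triple (ainv Q ?o) (ainv Q y) (vdiff Q ?o))"
  note cl = y closed
  have w: "?w1 \<in> vcar W" "?w2 \<in> vcar W" "?w3 \<in> vcar W" using cl by (simp_all add: omega_in_W)
  have "vdiff C (gen y) = cls B (triple 1 (vadd W (vadd W ?w1 ?w2) ?w3) 1)"
    by (simp add: gen_def C_simps lin_bas bdiff_def W_simps kdiff_def)
  also have "\<dots> = vadd C (vadd C (cls B (triple 1 ?w1 1)) (cls B (triple 1 ?w2 1))) (cls B (triple 1 ?w3 1))"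
    using w by (simp add: cls_B_rels W_closed)
  finally have "f (vdiff C (gen y)) = f (cls B (triple 1 ?w1 1)) + f (cls B (triple 1 ?w2 1)) + f (cls B (triple 1 ?w3 1))"
    using w by (simp only: bimod_mapD[OF f] C_closed triple_in_C)
  then show ?thesis
    using cl by (simp add: bimod_map_gen[OF f] aug_diff aug_inv aug_one l_one r_one)
qed

text \<open>
  The elements \<open>gen y\<close> generate the base change as a bimodule.
\<close>

lemma bimod_map_zero:
  assumes f: "bimod_map f" and D: "\<And>y. y \<in> vcar Q \<Longrightarrow> f (gen y) = 0" and X: "X \<in> vcar C"
  shows "f X = 0"
proof -
  have one: "f (cls B (triple a (cls K q) b)) = 0" if "q \<in> UW" for a q b
  proof -
    let ?S = "{q \<in> UW. f (cls B (triple a (cls K q) b)) = 0}"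
    let ?g = "\<lambda>q. cls B (triple a (cls K q) b)"
    have add: "f (?g (p + q)) = f (?g p) + f (?g q)" if "p \<in> UW" "q \<in> UW" for p q
      using that by (simp add: vadd_W[symmetric] cls_B_rels cls_in_W bimod_mapD[OF f] triple_in_C)
    have scl: "f (?g (fscale c p)) = scaleM c (f (?g p))" if "p \<in> UW" for c p
      using that by (simp add: vsmul_W[symmetric] cls_B_rels cls_in_W bimod_mapD[OF f] triple_in_C)
    have "fvs.subspace ?S"
      unfolding fvs.subspace_def
      using UW_subspace add scl scl[of 0 0] fvs.subspace_0[OF UW_subspace]
      by (auto simp: fvs.subspace_add[OF UW_subspace] fvs.subspace_scale[OF UW_subspace])
    moreover have "{triple x y z | x y z. x \<in> vcar Q \<and> y \<in> vcar Q \<and> z \<in> vcar Q} \<subseteq> ?S"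
      by (auto simp: triple_in_UW bimod_map_gen[OF f] D)
    ultimately have "UW \<subseteq> ?S" unfolding UW_def by (rule fvs.span_minimal[rotated])
    then show ?thesis using that by blast
  qed
  let ?S = "{p \<in> UC. f (cls B p) = 0}"
  have add: "f (cls B (p + q)) = f (cls B p) + f (cls B q)" if "p \<in> UC" "q \<in> UC" for p q
    using that by (simp add: vadd_C[symmetric] cls_in_C bimod_mapD[OF f])
  have scl: "f (cls B (fscale c p)) = scaleM c (f (cls B p))" if "p \<in> UC" for c p
    using that by (simp add: vsmul_C[symmetric] cls_in_C bimod_mapD[OF f])
  have "fvs.subspace ?S"
    unfolding fvs.subspace_def
    using UC_subspace add scl scl[of 0 0] fvs.subspace_0[OF UC_subspace]
    by (auto simp: fvs.subspace_add[OF UC_subspace] fvs.subspace_scale[OF UC_subspace])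
  moreover have "{triple a \<omega> b | a \<omega> b. \<omega> \<in> vcar W} \<subseteq> ?S"
    using one by (auto simp: triple_in_UC cls_in_W elim!: W_cases)
  ultimately have "UC \<subseteq> ?S" unfolding UC_def by (rule fvs.span_minimal[rotated])
  then show ?thesis using X by (auto elim!: C_cases)
qed

section \<open>From derivations to bimodule maps\<close>

lemma lext_hom_kills:
  assumes "\<And>x. x \<in> S \<Longrightarrow> lext scaleM g x = 0" "p \<in> fvs.span S"
  shows "lext scaleM g p = 0"
proof -
  have "lext scaleM g p \<in> {0}"
    by (rule M.hom_span_subset[OF M.lext_hom _ M.subspace_single_0 assms(2)]) (use assms(1) in auto)
  then show ?thesis by simp
qed

context
  fixes D :: "'q \<Rightarrow> 'm"
  assumes D: "derivation D"
begin

lemma derivation_simps: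
  assumes "x \<in> vcar Q"
  shows "y \<in> vcar Q \<Longrightarrow> D (vadd Q x y) = D x + D y" "D (vsmul Q c x) = scaleM c (D x)"
    "y \<in> vcar Q \<Longrightarrow> D (amult Q x y) = r (D x) (\<epsilon> y) + l (\<epsilon> x) (D y)"
  using D assms unfolding derivation_def by blast+

definition kform :: "'q \<times> 'q \<times> 'q \<Rightarrow> 'm" where
  "kform = (\<lambda>(x, y, z). l (\<epsilon> x) (r (D y) (\<epsilon> z)))"

text \<open>
  The universal property of the Kaehler differentials: the form \<open>x dy z \<mapsto> \<epsilon>(x) D(y) \<epsilon>(z)\<close>
  respects the Leibniz relation since \<open>D\<close> is a derivation.
\<close>

lemma kform_K: "p \<in> K \<Longrightarrow> lext scaleM kform p = 0"
proof (rule lext_hom_kills[OF _ ])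
  show "p \<in> K \<Longrightarrow> p \<in> fvs.span (trilin_rels Q Q Q
     \<union> {triple x (amult Q y y') z - triple x y (amult Q y' z) - triple (amult Q x y) y' z
        | x y y' z. x \<in> vcar Q \<and> y \<in> vcar Q \<and> y' \<in> vcar Q \<and> z \<in> vcar Q})"
    by (simp add: kaehler_rels_def)
  fix q assume "q \<in> trilin_rels Q Q Q
     \<union> {triple x (amult Q y y') z - triple x y (amult Q y' z) - triple (amult Q x y) y' z
        | x y y' z. x \<in> vcar Q \<and> y \<in> vcar Q \<and> y' \<in> vcar Q \<and> z \<in> vcar Q}"
  then show "lext scaleM kform q = 0"
    unfolding trilin_rels_def
    by (elim UnE CollectE exE conjE)
      (simp_all add: M.lext_diff M.lext_scale M.lext_bas kform_def aug_add aug_smul aug_mult derivation_simps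
        l_add r_add l_scale r_scale l_mult r_mult l_r)
qed

definition kval :: "_ \<Rightarrow> 'm" where
  "kval \<omega> = lext scaleM kform (SOME p. p \<in> \<omega>)"

lemma kval_cls: "kval (cls K p) = lext scaleM kform p"
  unfolding kval_def by (rule value_on_coset[OF kform_K fvs.subspace_0[OF K_subspace] M.lext_diff])

lemma kval_linear:
  "\<omega> \<in> vcar W \<Longrightarrow> \<omega>' \<in> vcar W \<Longrightarrow> kval (vadd W \<omega> \<omega>') = kval \<omega> + kval \<omega>'"
  "\<omega> \<in> vcar W \<Longrightarrow> kval (vsmul W c \<omega>) = scaleM c (kval \<omega>)"
  by (auto elim!: W_cases simp: W_simps kval_cls M.lext_add M.lext_scale)

lemma l_hom: "module_hom scaleM scaleM (l a)" and r_hom: "module_hom scaleM scaleM (\<lambda>x. r x a)"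
  by unfold_locales (simp_all add: l_add l_scale r_add r_scale)

lemma kval_act:
  assumes w: "\<omega> \<in> vcar W" and q: "q \<in> vcar Q"
  shows "kval (lact W q \<omega>) = l (\<epsilon> q) (kval \<omega>)" "kval (ract W \<omega> q) = r (kval \<omega>) (\<epsilon> q)"
proof -
  obtain p where p: "p \<in> UW" "\<omega> = cls K p" using w by (elim W_cases)
  have diff: "lext scaleM kform (f p) - h (lext scaleM kform p) = 0"
    if "module_hom fscale fscale f" "module_hom scaleM scaleM h"
      "\<And>x y z. x \<in> vcar Q \<Longrightarrow> y \<in> vcar Q \<Longrightarrow> z \<in> vcar Q \<Longrightarrow>
        lext scaleM kform (f (triple x y z)) = h (kform (x, y, z))" for f h
  proof -
    have hm: "module_hom fscale scaleM (\<lambda>p. lext scaleM kform (f p) - h (lext scaleM kform p))"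
      by unfold_locales
        (simp_all add: module_hom.add[OF that(1)] module_hom.scale[OF that(1)] module_hom.add[OF that(2)]
          module_hom.scale[OF that(2)] M.lext_add M.lext_scale M.scale_right_diff_distrib)
    have "lext scaleM kform (f p) - h (lext scaleM kform p) \<in> {0}"
      by (rule M.hom_span_subset[OF hm _ M.subspace_single_0 p(1)[unfolded UW_def]])
        (auto simp: that(3) M.lext_bas)
    then show ?thesis by simp
  qed
  show "kval (lact W q \<omega>) = l (\<epsilon> q) (kval \<omega>)"
    using diff[OF lin_hom l_hom, of "\<lambda>(x, y, z). triple (amult Q q x) y z" "\<epsilon> q"] q
    by (simp add: p(2) W_simps kval_cls lin_bas M.lext_bas kform_def aug_mult l_mult)
  show "kval (ract W \<omega> q) = r (kval \<omega>) (\<epsilon> q)"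
    using diff[OF lin_hom r_hom, of "\<lambda>(x, y, z). triple x y (amult Q z q)" "\<epsilon> q"] q
    by (simp add: p(2) W_simps kval_cls lin_bas M.lext_bas kform_def aug_mult r_mult l_r)
qed

definition bform :: "_ \<Rightarrow> 'm" where
  "bform = (\<lambda>(a, \<omega>, b). l a (r (kval \<omega>) b))"

lemma bform_B: "p \<in> B \<Longrightarrow> lext scaleM bform p = 0"
proof -
  assume "p \<in> B"
  have "lext scaleM bform p \<in> {0}"
    by (rule B_invariant[OF M.vector_space_axioms M.lext_hom M.subspace_single_0 \<open>p \<in> B\<close>])
      (simp_all add: M.lext_diff M.lext_scale M.lext_bas bform_def kval_linear kval_act
        l_add r_add l_scale r_scale l_mult r_mult l_r)
  then show ?thesis by simp
qed

definition bmap :: "_ \<Rightarrow> 'm" where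
  "bmap X = (if X \<in> vcar C then lext scaleM bform (SOME p. p \<in> X) else 0)"

lemma bmap_cls: "p \<in> UC \<Longrightarrow> bmap (cls B p) = lext scaleM bform p"
  using value_on_coset[OF bform_B fvs.subspace_0[OF B_subspace] M.lext_diff]
  by (simp add: bmap_def cls_in_C)

lemma bmap_gen: "y \<in> vcar Q \<Longrightarrow> bmap (gen y) = D y"
  by (simp add: gen_def bmap_cls triple_in_UC omega_in_W closed M.lext_bas bform_def kval_cls kform_def
      aug_one l_one r_one)

lemma bmap_act:
  assumes "p \<in> UC"
  shows "lext scaleM bform (lin (\<lambda>(a, \<omega>, b). triple (a' * a) \<omega> b) p) = l a' (lext scaleM bform p)"
    "lext scaleM bform (lin (\<lambda>(a, \<omega>, b). triple a \<omega> (b * b')) p) = r (lext scaleM bform p) b'"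
  by (rule M.hom_eq_on_basis[OF hom_compose[OF lin_hom M.lext_hom] hom_compose[OF M.lext_hom l_hom]]
      M.hom_eq_on_basis[OF hom_compose[OF lin_hom M.lext_hom] hom_compose[OF M.lext_hom r_hom]];
      clarsimp simp: lin_bas M.lext_bas bform_def l_mult r_mult l_r)+

lemma bmap_bimod_hom:
  assumes deg: "\<And>j y. j \<noteq> k \<Longrightarrow> y \<in> hcomp Q j \<Longrightarrow> D y = 0"
  shows "bmap \<in> bimod_hom C scaleM l r k"
  unfolding bimod_hom_def
proof (intro CollectI conjI allI ballI impI)
  show "bmap x = 0" if "x \<notin> vcar C" for x using that by (simp add: bmap_def)
  show "bmap (vadd C x y) = bmap x + bmap y" if "x \<in> vcar C" "y \<in> vcar C" for x y
    using that by (auto elim!: C_cases simp: C_simps bmap_cls fvs.subspace_add[OF UC_subspace] M.lext_add)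
  show "bmap (vsmul C c x) = scaleM c (bmap x)" if "x \<in> vcar C" for x c
    using that by (auto elim!: C_cases simp: C_simps bmap_cls fvs.subspace_scale[OF UC_subspace] M.lext_scale)
  show "bmap (lact C a x) = l a (bmap x)" if "x \<in> vcar C" for x a
    using that by (auto elim!: C_cases simp: C_simps bmap_cls UC_maps triple_in_UC bmap_act)
  show "bmap (ract C x a) = r (bmap x) a" if "x \<in> vcar C" for x a
    using that by (auto elim!: C_cases simp: C_simps bmap_cls UC_maps triple_in_UC bmap_act)
  fix j X assume j: "j \<noteq> k" "X \<in> hcomp C j"
  have K0: "kval \<omega> = 0" if "\<omega> \<in> hcomp W j" for \<omega>
  proof -
    obtain p where p: "\<omega> = cls K p" "p \<in> fvs.span {triple x y z | x y z i j' k.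
          x \<in> hcomp Q i \<and> y \<in> hcomp Q j' \<and> z \<in> hcomp Q k \<and> i + j' + k = j}"
      using \<open>\<omega> \<in> hcomp W j\<close> unfolding hcomp_W by blast
    have "kform (x, y, z) = 0" if "x \<in> hcomp Q i" "y \<in> hcomp Q j'" "z \<in> hcomp Q k'" "i + j' + k' = j"
      for x y z i j' k'
    proof (cases "i = 0 \<and> k' = 0")
      case True
      then have "D y = 0" using deg[of j' y] that j(1) by simp
      then show ?thesis by (simp add: kform_def)
    next
      case False
      then have "\<epsilon> x = 0 \<or> \<epsilon> z = 0" using aug_hcomp that by blast
      then show ?thesis by (auto simp: kform_def)
    qed
    then have "lext scaleM kform p = 0"
      by (intro lext_hom_kills[OF _ p(2)]) (auto simp: M.lext_bas)
    then show ?thesis by (simp add: p(1) kval_cls)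
  qed
  obtain p where p: "X = cls B p" "p \<in> fvs.span {triple a \<omega> b | a \<omega> b. \<omega> \<in> hcomp W j}"
    using j(2) unfolding hcomp_C by blast
  have "lext scaleM bform p = 0"
    by (rule lext_hom_kills[OF _ p(2)]) (auto simp: M.lext_bas bform_def K0)
  moreover have "bmap X = lext scaleM bform p \<or> bmap X = 0"
    using value_on_coset[OF bform_B fvs.subspace_0[OF B_subspace] M.lext_diff, of p]
    by (simp add: bmap_def p(1))
  ultimately show "bmap X = 0" by auto
qed

end

lemma derivation_extends:
  assumes "derivation D" "\<And>j y. j \<noteq> k \<Longrightarrow> y \<in> hcomp Q j \<Longrightarrow> D y = 0"
  obtains f where "f \<in> bimod_hom C scaleM l r k" "\<And>y. y \<in> vcar Q \<Longrightarrow> f (gen y) = D y"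
  by (rule that[OF bmap_bimod_hom[OF assms(1)] bmap_gen[OF assms(1)]]) (use assms(2) in blast)

lemma bimod_hom_map: "f \<in> bimod_hom C scaleM l r k \<Longrightarrow> bimod_map f"
  by (simp add: bimod_hom_def bimod_map_def)

lemma gen_hcomp: "y \<in> hcomp Q j \<Longrightarrow> gen y \<in> hcomp C j"
proof -
  assume y: "y \<in> hcomp Q j"
  have "cls K (triple (aone Q) y (aone Q)) \<in> hcomp W j"
    unfolding hcomp_W using y one_hcomp
    by (intro imageI fvs.span_base) force
  then show ?thesis unfolding hcomp_C gen_def by (intro imageI fvs.span_base) blast
qed

lemma bimod_hom_degree:
  "f \<in> bimod_hom C scaleM l r k \<Longrightarrow> j \<noteq> k \<Longrightarrow> y \<in> hcomp Q j \<Longrightarrow> f (gen y) = 0"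
  using gen_hcomp by (auto simp: bimod_hom_def)

end

section \<open>The coboundary on functions of words\<close>

context unital_bimodule
begin

lemma scale_pm_commute: "scaleM c (pm n x) = pm n (scaleM c x)"
  by (simp add: pm_def)

lemma l_pm: "l a (pm n x) = pm n (l a x)" and r_pm: "r (pm n x) a = pm n (r x a)"
  by (simp_all add: pm_def l_minus r_minus)

text \<open>
  The three parts of the coboundary come from the bar differential and from the two cuts of a
  word after its first and before its last letter. A derivation applied to another cut vanishes,
  since then neither factor has a nonzero augmentation; a cork acts as zero.
\<close>

fun left_part :: "('a option list \<Rightarrow> 'm) \<Rightarrow> 'a option list \<Rightarrow> 'm" where
  "left_part g [] = 0"
| "left_part g (None # w) = 0"
| "left_part g (Some a # w) = l a (g w)"

fun right_part :: "('a option list \<Rightarrow> 'm) \<Rightarrow> 'a option list \<Rightarrow> 'm" where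
  "right_part g [] = 0"
| "right_part g [None] = 0"
| "right_part g [Some a] = r (g []) a"
| "right_part g (x # y # w) = pm (ldeg x) (right_part (\<lambda>v. g (x # v)) (y # w))"

definition word_coboundary :: "('a option list \<Rightarrow> 'm) \<Rightarrow> 'a option list \<Rightarrow> 'm" where
  "word_coboundary g w = bar_sum w g - left_part g w + right_part g w"

lemma head_sum_affine:
  "head_sum (\<lambda>v. scaleM k (f v) + g v) x w = scaleM k (head_sum f x w) + head_sum g x w"
  by (induction f x w rule: head_sum.induct) auto

lemma bar_sum_affine:
  "bar_sum w (\<lambda>v. scaleM k (f v) + g v) = scaleM k (bar_sum w f) + bar_sum w g"
  by (induction w arbitrary: f g)
    (simp_all add: head_sum_affine pm_add scale_pm_commute M.scale_right_distrib add.assoc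
      add.left_commute)

lemma left_part_affine:
  "left_part (\<lambda>v. scaleM k (f v) + g v) w = scaleM k (left_part f w) + left_part g w"
  by (induction f w rule: left_part.induct) (auto simp: l_add l_scale)

lemma right_part_affine:
  "right_part (\<lambda>v. scaleM k (f v) + g v) w = scaleM k (right_part f w) + right_part g w"
  by (induction f w arbitrary: g rule: right_part.induct)
    (auto simp: r_add r_scale pm_add scale_pm_commute M.scale_right_distrib)

lemma word_coboundary_affine:
  "word_coboundary (\<lambda>v. scaleM k (f v) + g v) w = scaleM k (word_coboundary f w) + word_coboundary g w"
  by (simp add: word_coboundary_def bar_sum_affine left_part_affine right_part_affine
      M.scale_right_distrib M.scale_right_diff_distrib)

lemma bar_sum_lin: "bar_sum w (\<lambda>v. f v - g v) = bar_sum w f - bar_sum w g"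
    "bar_sum w (\<lambda>v. - f v) = - bar_sum w f"
  and left_part_lin: "left_part (\<lambda>v. f v + g v) w = left_part f w + left_part g w"
    "left_part (\<lambda>v. f v - g v) w = left_part f w - left_part g w"
  and right_part_lin: "right_part (\<lambda>v. f v + g v) w = right_part f w + right_part g w"
    "right_part (\<lambda>v. f v - g v) w = right_part f w - right_part g w"
    "right_part (\<lambda>v. - f v) w = - right_part f w"
  and word_coboundary_lin: "word_coboundary (\<lambda>v. f v + g v) w = word_coboundary f w + word_coboundary g w"
    "word_coboundary (\<lambda>v. f v - g v) w = word_coboundary f w - word_coboundary g w"
    "word_coboundary (\<lambda>v. scaleM c (f v)) w = scaleM c (word_coboundary f w)"
proof -
  have z: "bar_sum w (\<lambda>_. 0 :: 'm) = 0" "left_part (\<lambda>_. 0) w = 0" "right_part (\<lambda>_. 0) w = 0"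
    using left_part_affine[of 0 "\<lambda>_. 0" "\<lambda>_. 0" w] left_part_affine[of 1 "\<lambda>_. 0" "\<lambda>_. 0" w]
      right_part_affine[of 1 "\<lambda>_. 0" "\<lambda>_. 0" w] by simp_all
  then have zc: "word_coboundary (\<lambda>_. 0) w = 0" by (simp add: word_coboundary_def)
  show "bar_sum w (\<lambda>v. f v - g v) = bar_sum w f - bar_sum w g"
    using bar_sum_affine[of w "-1" g f] by simp
  show "bar_sum w (\<lambda>v. - f v) = - bar_sum w f"
    using bar_sum_affine[of w "-1" f "\<lambda>_. 0"] by (simp add: z)
  show "left_part (\<lambda>v. f v + g v) w = left_part f w + left_part g w"
    using left_part_affine[of 1 f g w] by simp
  show "left_part (\<lambda>v. f v - g v) w = left_part f w - left_part g w"
    using left_part_affine[of "-1" g f w] by simp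
  show "right_part (\<lambda>v. f v + g v) w = right_part f w + right_part g w"
    using right_part_affine[of 1 f g w] by simp
  show "right_part (\<lambda>v. f v - g v) w = right_part f w - right_part g w"
    using right_part_affine[of "-1" g f w] by simp
  show "right_part (\<lambda>v. - f v) w = - right_part f w"
    using right_part_affine[of "-1" f "\<lambda>_. 0" w] by (simp add: z)
  show "word_coboundary (\<lambda>v. f v + g v) w = word_coboundary f w + word_coboundary g w"
    using word_coboundary_affine[of 1 f g w] by simp
  show "word_coboundary (\<lambda>v. f v - g v) w = word_coboundary f w - word_coboundary g w"
    using word_coboundary_affine[of "-1" g f w] by simp
  show "word_coboundary (\<lambda>v. scaleM c (f v)) w = scaleM c (word_coboundary f w)"
    using word_coboundary_affine[of c f "\<lambda>_. 0" w] by (simp add: zc)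
qed

lemma right_part_pm: "right_part (\<lambda>v. pm n (f v)) w = pm n (right_part f w)"
  by (simp add: pm_def right_part_lin)

lemma bar_sum_pm: "bar_sum (w :: 'a option list) (\<lambda>v. pm n (f v :: 'm)) = pm n (bar_sum w f)"
  by (simp add: pm_def bar_sum_lin)

lemma right_part_zero: "right_part (\<lambda>_. 0) w = 0"
  using right_part_lin(2)[of "\<lambda>_. 0" "\<lambda>_. 0" w] by simp

lemma right_part_cong:
  "(\<And>v. w = [] \<or> length v < length w \<Longrightarrow> (1 < length w \<longrightarrow> v \<noteq> []) \<Longrightarrow> f v = g v) \<Longrightarrow> right_part f w = right_part g w"
proof (induction w arbitrary: f g)
  case (Cons x w)
  show ?case
  proof (cases w)
    case Nil
    then show ?thesis using Cons.prems[of "[]"] by (cases x) auto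
  next
    case (Cons y w')
    have "right_part (\<lambda>v. f (x # v)) w = right_part (\<lambda>v. g (x # v)) w"
      by (rule Cons.IH) (use Cons.prems Cons in auto)
    then show ?thesis using Cons by simp
  qed
qed simp

section \<open>The square of the coboundary\<close>

fun first_cork :: "('a option list \<Rightarrow> 'm) \<Rightarrow> 'a option list \<Rightarrow> 'm" where
  "first_cork g (None # w) = g w"
| "first_cork g w = 0"

fun last_cork :: "('a option list \<Rightarrow> 'm) \<Rightarrow> 'a option list \<Rightarrow> 'm" where
  "last_cork g [] = 0"
| "last_cork g [None] = g []"
| "last_cork g [Some a] = 0"
| "last_cork g (x # y # w) = last_cork (\<lambda>v. g (x # v)) (y # w)"

text \<open>
  The curvature. Replacing a cork by \<open>1\<close> and then multiplying this \<open>1\<close> into a neighbour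
  removes the cork; the contributions of the left and of the right neighbour cancel except at the
  two ends of the word.
\<close>

lemma bar_sum_bar_sum: "bar_sum w (\<lambda>v. bar_sum v g) = first_cork g w - last_cork g w"
proof (induction w arbitrary: g)
  case (Cons x w)
  have *: "bar_sum (x # w) (\<lambda>v. bar_sum v g) = head_sum (\<lambda>v. bar_sum v g) x w
      + pm (ldeg x) (bar_sum w (head_sum g x)) + (first_cork (\<lambda>v. g (x # v)) w - last_cork (\<lambda>v. g (x # v)) w)"
    by (simp add: bar_sum_add bar_sum_pm pm_add Cons.IH add.assoc)
  have lc: "last_cork g (x # w) = last_cork (\<lambda>v. g (x # v)) w" if "w \<noteq> []"
    using that by (cases w) auto
  show ?case
  proof (cases x)
    case None
    show ?thesis
    proof (cases w)
      case Nil
      then show ?thesis using None by simp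
    next
      case (Cons y w')
      have "head_sum g (Some 1) w + first_cork (\<lambda>v. g (None # v)) w = g w"
        by (cases y) (simp_all add: Cons)
      moreover have "w \<noteq> []" by (simp add: Cons)
      ultimately show ?thesis using * lc None by (simp add: head_sum_None algebra_simps)
    qed
  next
    case x: (Some a)
    show ?thesis
    proof (cases w)
      case Nil
      then show ?thesis using x by simp
    next
      case w: (Cons y w')
      show ?thesis
      proof (cases y)
        case None
        then show ?thesis using * lc x w by (simp add: bar_sum_lin)
      next
        case (Some b)
        have "head_sum g (Some (a * b)) w' = head_sum (head_sum g (Some a)) (Some b) w'"
        proof (cases w')
          case (Cons z w'')
          then show ?thesis by (cases z) (simp_all add: mult.assoc)
        qed simp
        then show ?thesis using * lc x w Some by simp
      qed
    qed
  qed
qed simp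

text \<open>
  A cork at the left end, replaced by \<open>1\<close>, acts on \<open>M\<close> from the left as the identity. This
  cancels the curvature term at that end, and the remaining terms cancel since \<open>M\<close> is a
  left module.
\<close>

lemma left_terms_cancel:
  "first_cork g w - bar_sum w (left_part g) - left_part (\<lambda>v. bar_sum v g) w + left_part (left_part g) w = 0"
proof (cases w)
  case (Cons x w')
  show ?thesis
  proof (cases x)
    case None
    then show ?thesis by (simp add: Cons l_one)
  next
    case (Some a)
    have "bar_sum w' (\<lambda>v. l a (g v)) = l a (bar_sum w' g)"
      by (rule bar_sum_hom[symmetric]) (rule l_add)
    moreover have "head_sum (left_part g) (Some a) w' = left_part (left_part g) (Some a # w')"
    proof (cases w')
      case (Cons y w'')
      then show ?thesis by (cases y) (simp_all add: l_mult)
    qed simp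
    ultimately show ?thesis by (simp add: Cons Some)
  qed
qed simp

lemma mixed_terms_cancel: "left_part (right_part g) w + right_part (left_part g) w = 0"
proof (cases w)
  case (Cons x w')
  show ?thesis
  proof (cases w')
    case Nil
    then show ?thesis by (cases x) (simp_all add: Cons)
  next
    case w': (Cons y w'')
    show ?thesis
    proof (cases x)
      case None
      then show ?thesis by (simp add: Cons w' right_part_zero)
    next
      case (Some a)
      have "right_part (\<lambda>v. l a (h v)) u = l a (right_part h u)" for h u
        by (induction h u rule: right_part.induct) (simp_all add: l_r l_pm)
      then show ?thesis by (simp add: Cons w' Some)
    qed
  qed
qed simp

lemma right_terms_cancel:
  "bar_sum w (right_part g) + right_part (\<lambda>v. bar_sum v g) w + right_part (right_part g) w = last_cork g w"
proof (induction w arbitrary: g)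
  case (Cons x w)
  show ?case
  proof (cases w)
    case Nil
    then show ?thesis by (cases x) (simp_all add: r_one)
  next
    case w: (Cons y w')
    let ?gx = "\<lambda>v. g (x # v)"
    have R: "right_part h (x # w) = pm (ldeg x) (right_part (\<lambda>v. h (x # v)) w)" for h
      by (simp add: w)
    have "bar_sum w (\<lambda>v. right_part g (x # v)) = bar_sum w (\<lambda>v. pm (ldeg x) (right_part ?gx v))"
    proof (rule bar_sum_cong)
      fix v :: "'a option list" assume "v \<noteq> []"
      then show "right_part g (x # v) = pm (ldeg x) (right_part ?gx v)" by (cases v) auto
    qed
    then have 1: "bar_sum (x # w) (right_part g) = head_sum (right_part g) x w + bar_sum w (right_part ?gx)"
      by (simp add: bar_sum_pm)
    have 2: "right_part (\<lambda>v. bar_sum v g) (x # w)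
        = pm (ldeg x) (right_part (head_sum g x) w) + right_part (\<lambda>v. bar_sum v ?gx) w"
      by (simp add: R right_part_lin right_part_pm pm_add)
    have 3: "right_part (right_part g) (x # w) = right_part (right_part ?gx) w
        + (case (x, w) of (Some a, [Some b]) \<Rightarrow> - r (r (g []) a) b | _ \<Rightarrow> 0)"
    proof (cases w')
      case Nil
      then show ?thesis by (cases x; cases y) (simp_all add: w)
    next
      case (Cons z w'')
      have "right_part (\<lambda>v. right_part g (x # v)) w = right_part (\<lambda>v. pm (ldeg x) (right_part ?gx v)) w"
      proof (rule right_part_cong)
        fix v :: "'a option list" assume "1 < length w \<longrightarrow> v \<noteq> []"
        then have "v \<noteq> []" by (simp add: w Cons)
        then show "right_part g (x # v) = pm (ldeg x) (right_part ?gx v)" by (cases v) auto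
      qed
      then show ?thesis using Cons by (simp add: R right_part_pm) (simp add: w split: option.split)
    qed
    have 4: "head_sum (right_part g) x w + pm (ldeg x) (right_part (head_sum g x) w)
        + (case (x, w) of (Some a, [Some b]) \<Rightarrow> - r (r (g []) a) b | _ \<Rightarrow> 0) = 0"
    proof (cases x)
      case None
      then show ?thesis by (simp add: w head_sum_None)
    next
      case x: (Some a)
      show ?thesis
      proof (cases w')
        case Nil
        then show ?thesis by (cases y) (simp_all add: w x r_mult)
      next
        case (Cons z w'')
        then show ?thesis by (cases y) (simp_all add: w x right_part_zero)
      qed
    qed
    have 5: "last_cork g (x # w) = last_cork ?gx w" by (simp add: w)
    have rearrange: "(a + b) + (p + d) + (e + c) = (a + p + c) + (b + d + e)" for a b c d e p :: 'm
      by (simp only: add_ac)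
    show ?thesis unfolding 1 2 3 5 by (subst rearrange) (simp only: 4 Cons.IH add_0)
  qed
qed simp

theorem word_coboundary_square: "word_coboundary (word_coboundary g) w = 0"
proof -
  have "word_coboundary (word_coboundary g) w
      = (first_cork g w - bar_sum w (left_part g) - left_part (\<lambda>v. bar_sum v g) w + left_part (left_part g) w)
        + (bar_sum w (right_part g) + right_part (\<lambda>v. bar_sum v g) w + right_part (right_part g) w - last_cork g w)
        - (left_part (right_part g) w + right_part (left_part g) w)"
    by (simp add: word_coboundary_def[abs_def] bar_sum_add bar_sum_lin left_part_lin right_part_lin
        bar_sum_bar_sum)
  then show ?thesis by (simp add: left_terms_cancel right_terms_cancel mixed_terms_cancel)
qed

section \<open>Multilinear cochains on words\<close>

definition word_multilinear :: "('a option list \<Rightarrow> 'm) \<Rightarrow> bool" where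
  "word_multilinear g \<longleftrightarrow> (\<forall>us k a b vs. g (us @ Some (scaleA k a + b) # vs)
     = scaleM k (g (us @ Some a # vs)) + g (us @ Some b # vs))"

text \<open>
  A word of degree \<open>Suc n\<close> belongs to trees of weight \<open>n\<close>. As the empty word has degree 0, cochains
  vanish on it.
\<close>

definition word_cochains :: "nat \<Rightarrow> ('a option list \<Rightarrow> 'm) set" where
  "word_cochains n = {g. word_multilinear g \<and> (\<forall>w. wdeg w \<noteq> Suc n \<longrightarrow> g w = 0)}"

lemma word_multilinearD: "word_multilinear g \<Longrightarrow>
    g (us @ Some (scaleA k a + b) # vs) = scaleM k (g (us @ Some a # vs)) + g (us @ Some b # vs)"
  by (simp add: word_multilinear_def)

lemma word_multilinearD0: "word_multilinear g \<Longrightarrow>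
    g (Some (scaleA k a + b) # vs) = scaleM k (g (Some a # vs)) + g (Some b # vs)"
  using word_multilinearD[of g "[]"] by simp

lemma word_multilinearD1: "word_multilinear g \<Longrightarrow>
    g (x # us @ Some (scaleA k a + b) # vs) = scaleM k (g (x # us @ Some a # vs)) + g (x # us @ Some b # vs)"
  using word_multilinearD[of g "x # us"] by simp

lemma word_multilinear_Cons: "word_multilinear g \<Longrightarrow> word_multilinear (\<lambda>v. g (x # v))"
  using word_multilinearD1 by (simp add: word_multilinear_def)

lemma word_multilinear_bar_sum:
  assumes "word_multilinear g" shows "word_multilinear (\<lambda>w. bar_sum w g)"
  unfolding word_multilinear_def
proof (intro allI)
  fix us k a b vs
  show "bar_sum (us @ Some (scaleA k a + b) # vs) g
     = scaleM k (bar_sum (us @ Some a # vs) g) + bar_sum (us @ Some b # vs) g"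
    using assms
  proof (induction us arbitrary: g)
    case Nil
    have "head_sum g (Some (scaleA k a + b)) vs
        = scaleM k (head_sum g (Some a) vs) + head_sum g (Some b) vs"
    proof (cases vs)
      case (Cons y vs')
      then show ?thesis using word_multilinearD0[OF Nil]
        by (cases y) (simp_all add: distrib_right A.scale_mult_left)
    qed simp
    moreover have "(\<lambda>v. g (Some (scaleA k a + b) # v)) = (\<lambda>v. scaleM k (g (Some a # v)) + g (Some b # v))"
      by (simp add: word_multilinearD0[OF Nil])
    ultimately show ?case by (simp add: bar_sum_affine M.scale_right_diff_distrib)
  next
    case (Cons x us)
    have "head_sum g x (us @ Some (scaleA k a + b) # vs)
        = scaleM k (head_sum g x (us @ Some a # vs)) + head_sum g x (us @ Some b # vs)"
    proof (cases x)
      case None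
      then show ?thesis using word_multilinearD1[OF Cons.prems] by simp
    next
      case x: (Some c)
      show ?thesis
      proof (cases us)
        case Nil
        then show ?thesis using word_multilinearD0[OF Cons.prems, of k "c * a" "c * b" vs]
          by (simp add: x distrib_left A.scale_mult_right)
      next
        case (Cons y us')
        then show ?thesis using word_multilinearD1[OF Cons.prems] by (cases y) (simp_all add: x)
      qed
    qed
    then show ?case
      using Cons.IH[OF word_multilinear_Cons[OF Cons.prems, of x]]
      by (simp add: M.scale_right_distrib pm_add scale_pm_commute)
  qed
qed

lemma word_multilinear_left_part:
  assumes "word_multilinear g" shows "word_multilinear (left_part g)"
  unfolding word_multilinear_def
proof (intro allI)
  fix us k a b vs
  show "left_part g (us @ Some (scaleA k a + b) # vs)
     = scaleM k (left_part g (us @ Some a # vs)) + left_part g (us @ Some b # vs)"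
  proof (cases us)
    case Nil
    then show ?thesis by (simp add: l_add l_scale)
  next
    case (Cons x us')
    then show ?thesis using word_multilinearD[OF assms] by (cases x) (simp_all add: l_add l_scale)
  qed
qed

lemma word_multilinear_right_part:
  assumes "word_multilinear g" shows "word_multilinear (right_part g)"
  unfolding word_multilinear_def
proof (intro allI)
  fix us k a b vs
  show "right_part g (us @ Some (scaleA k a + b) # vs)
     = scaleM k (right_part g (us @ Some a # vs)) + right_part g (us @ Some b # vs)"
    using assms
  proof (induction us arbitrary: g)
    case Nil
    show ?case
    proof (cases vs)
      case Nil
      then show ?thesis by (simp add: r_add r_scale)
    next
      case (Cons y vs')
      have "(\<lambda>v. g (Some (scaleA k a + b) # v)) = (\<lambda>v. scaleM k (g (Some a # v)) + g (Some b # v))"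
        by (simp add: word_multilinearD0[OF Nil.prems])
      then show ?thesis using Cons by (simp add: right_part_affine)
    qed
  next
    case (Cons x us)
    have "right_part g (x # us @ Some c # vs) = pm (ldeg x) (right_part (\<lambda>v. g (x # v)) (us @ Some c # vs))"
      for c by (cases us) auto
    then show ?case
      using Cons.IH[OF word_multilinear_Cons[OF Cons.prems, of x]]
      by (simp add: pm_add scale_pm_commute)
  qed
qed

lemma word_multilinear_affine:
  "word_multilinear f \<Longrightarrow> word_multilinear g \<Longrightarrow> word_multilinear (\<lambda>w. scaleM c (f w) + g w)"
  unfolding word_multilinear_def
  by (simp add: M.scale_right_distrib M.scale_left_commute add_ac)

lemma word_multilinear_coboundary:
  assumes "word_multilinear g" shows "word_multilinear (word_coboundary g)"
proof -
  have "word_multilinear (\<lambda>w. scaleM 1 (scaleM (-1) (left_part g w) + bar_sum w g) + right_part g w)"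
    by (intro word_multilinear_affine word_multilinear_left_part word_multilinear_bar_sum
        word_multilinear_right_part assms)
  then show ?thesis by (simp add: word_coboundary_def[abs_def])
qed

lemma right_part_degree:
  "(\<And>v. Suc (wdeg v) = wdeg w \<Longrightarrow> g v = 0) \<Longrightarrow> right_part g w = 0"
  by (induction g w rule: right_part.induct) auto

lemma word_coboundary_cochain:
  assumes "g \<in> word_cochains n" shows "word_coboundary g \<in> word_cochains (Suc n)"
proof -
  have g: "word_multilinear g" "wdeg v \<noteq> Suc n \<Longrightarrow> g v = 0" for v
    using assms by (auto simp: word_cochains_def)
  have "word_coboundary g w = 0" if "wdeg w \<noteq> Suc (Suc n)" for w
  proof -
    have "bar_sum w g = bar_sum w (\<lambda>_. 0)"
      by (rule bar_sum_cong) (use g(2) that in auto)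
    moreover have "left_part g w = 0"
      using g(2) that by (induction g w rule: left_part.induct) auto
    moreover have "right_part g w = 0"
      by (rule right_part_degree) (use g(2) that in auto)
    ultimately show ?thesis by (simp add: word_coboundary_def)
  qed
  then show ?thesis using word_multilinear_coboundary[OF g(1)] by (simp add: word_cochains_def)
qed

lemma word_cochains_affine:
  "f \<in> word_cochains n \<Longrightarrow> g \<in> word_cochains n \<Longrightarrow> (\<lambda>w. scaleM c (f w) + g w) \<in> word_cochains n"
  using word_multilinear_affine by (auto simp: word_cochains_def)

lemma word_cochains_zero: "(\<lambda>w. 0) \<in> word_cochains n"
  by (simp add: word_cochains_def word_multilinear_def)

lemma word_cochains_lin:
  assumes "f \<in> word_cochains n" "g \<in> word_cochains n"
  shows "(\<lambda>w. f w + g w) \<in> word_cochains n" "(\<lambda>w. f w - g w) \<in> word_cochains n"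
    "(\<lambda>w. scaleM c (f w)) \<in> word_cochains n"
  using word_cochains_affine[OF assms, of 1] word_cochains_affine[OF assms(2,1), of "-1"]
    word_cochains_affine[OF assms(1) word_cochains_zero, of c] by simp_all

section \<open>Contraction of the words with corks\<close>

fun corks :: "'a option list \<Rightarrow> nat" where
  "corks [] = 0"
| "corks (None # w) = Suc (corks w)"
| "corks (Some a # w) = corks w"

text \<open>
  The signed sum has a single term: \<open>1\<close> is inserted in front of the first cork. The product
  of this \<open>1\<close> with the letter to its left, or its action on \<open>M\<close>, gives back the word.
\<close>

fun insert_one :: "('a option list \<Rightarrow> 'm) \<Rightarrow> 'a option list \<Rightarrow> 'm" where
  "insert_one f [] = 0"
| "insert_one f (None # w) = - f (Some 1 # None # w)"
| "insert_one f (Some a # w) = - insert_one (\<lambda>v. f (Some a # v)) w"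

lemma insert_one_affine:
  "insert_one (\<lambda>v. scaleM k (f v) + g v) w = scaleM k (insert_one f w) + insert_one g w"
  by (induction f w arbitrary: g rule: insert_one.induct) auto

lemma insert_one_zero: "insert_one (\<lambda>_. 0) w = 0"
  using insert_one_affine[of 1 "\<lambda>_. 0" "\<lambda>_. 0" w] by simp

lemma insert_one_lin: "insert_one (\<lambda>v. f v + g v) w = insert_one f w + insert_one g w"
  "insert_one (\<lambda>v. f v - g v) w = insert_one f w - insert_one g w"
  "insert_one (\<lambda>v. - f v) w = - insert_one f w"
  using insert_one_affine[of 1 f g w] insert_one_affine[of "-1" g f w]
    insert_one_affine[of "-1" f "\<lambda>_. 0" w] by (simp_all add: insert_one_zero)

lemma insert_one_cong:
  "(\<And>v. v \<noteq> [] \<Longrightarrow> corks v = corks w \<Longrightarrow> wdeg v = Suc (wdeg w) \<Longrightarrow> f v = g v) \<Longrightarrow> insert_one f w = insert_one g w"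
  by (induction f w arbitrary: g rule: insert_one.induct) auto

lemma insert_one_no_cork: "corks w = 0 \<Longrightarrow> insert_one f w = 0"
  by (induction f w rule: insert_one.induct) auto

definition vanishes_below :: "nat \<Rightarrow> ('a option list \<Rightarrow> 'm) \<Rightarrow> bool" where
  "vanishes_below j f \<longleftrightarrow> (\<forall>w. corks w < j \<longrightarrow> f w = 0)"

lemma vanishes_below_Cons:
  "vanishes_below j f \<Longrightarrow> vanishes_below j (\<lambda>v. f (Some a # v))"
  "vanishes_below j f \<Longrightarrow> vanishes_below (j - 1) (\<lambda>v. f (None # v))"
  by (auto simp: vanishes_below_def)

lemma vanishes_below_insert_one: "vanishes_below j f \<Longrightarrow> vanishes_below j (insert_one f)"
  unfolding vanishes_below_def
  using insert_one_cong[of _ f "\<lambda>_. 0"] by (simp add: insert_one_zero)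

lemma vanishes_below_bar_sum:
  "vanishes_below j f \<Longrightarrow> corks w < j \<Longrightarrow> bar_sum w f = 0"
proof (induction w arbitrary: f j)
  case (Cons x w)
  have "head_sum f x w = 0"
    using Cons.prems unfolding vanishes_below_def by (induction f x w rule: head_sum.induct) auto
  moreover have "bar_sum w (\<lambda>v. f (x # v)) = 0"
  proof (cases x)
    case None
    then show ?thesis using Cons.IH[OF vanishes_below_Cons(2)[OF Cons.prems(1)]] Cons.prems(2) by simp
  next
    case (Some a)
    then show ?thesis using Cons.IH[OF vanishes_below_Cons(1)[OF Cons.prems(1)]] Cons.prems(2) by simp
  qed
  ultimately show ?case by simp
qed simp

lemma vanishes_below_right_part:
  "vanishes_below j f \<Longrightarrow> corks w < j \<Longrightarrow> right_part f w = 0"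
proof (induction w arbitrary: f j)
  case (Cons x w)
  show ?case
  proof (cases w)
    case Nil
    then show ?thesis using Cons.prems by (cases x) (auto simp: vanishes_below_def)
  next
    case (Cons y w')
    have "right_part (\<lambda>v. f (x # v)) w = 0"
    proof (cases x)
      case None
      then show ?thesis using Cons.IH[OF vanishes_below_Cons(2)[OF Cons.prems(1)]] Cons.prems(2) by simp
    next
      case (Some a)
      then show ?thesis using Cons.IH[OF vanishes_below_Cons(1)[OF Cons.prems(1)]] Cons.prems(2) by simp
    qed
    then show ?thesis by (simp add: Cons)
  qed
qed simp

lemma vanishes_below_coboundary: "vanishes_below j f \<Longrightarrow> vanishes_below j (word_coboundary f)"
proof -
  assume f: "vanishes_below j f"
  have "left_part f w = 0" if "corks w < j" for w
    using f that unfolding vanishes_below_def by (induction f w rule: left_part.induct) auto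
  then show ?thesis
    using vanishes_below_bar_sum[OF f] vanishes_below_right_part[OF f]
    by (simp add: word_coboundary_def vanishes_below_def)
qed

lemma homotopy_bar_sum:
  assumes "vanishes_below j f" "corks w = j" "0 < j"
  shows "bar_sum w (insert_one f) + insert_one (\<lambda>v. bar_sum v f) w
    = (case w of Some a # _ \<Rightarrow> f w | _ \<Rightarrow> 0)"
  using assms
proof (induction w arbitrary: f)
  case (Cons x w)
  show ?case
  proof (cases x)
    case None
    have "corks (Some 1 # w) < j" "corks (Some 1 # Some 1 # w) < j" using Cons.prems None by auto
    then have "insert_one f (Some 1 # w) = 0" "f (Some 1 # Some 1 # w) = 0"
      using vanishes_below_insert_one[OF Cons.prems(1)] Cons.prems(1) unfolding vanishes_below_def by blast+
    then show ?thesis by (simp add: None bar_sum_lin)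
  next
    case x: (Some a)
    let ?fa = "\<lambda>v. f (Some a # v)"
    have IH: "bar_sum w (insert_one ?fa) + insert_one (\<lambda>v. bar_sum v ?fa) w
        = (case w of Some a # _ \<Rightarrow> ?fa w | _ \<Rightarrow> 0)"
      by (rule Cons.IH[OF vanishes_below_Cons(1)]) (use Cons.prems x in auto)
    have *: "bar_sum (x # w) (insert_one f) + insert_one (\<lambda>v. bar_sum v f) (x # w)
      = (bar_sum w (insert_one ?fa) + insert_one (\<lambda>v. bar_sum v ?fa) w)
        + (head_sum (insert_one f) (Some a) w - insert_one (head_sum f (Some a)) w)"
      by (simp add: x bar_sum_lin insert_one_lin)
    show ?thesis
    proof (cases w)
      case Nil
      then show ?thesis using Cons.prems x by simp
    next
      case w: (Cons y w')
      show ?thesis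
      proof (cases y)
        case None
        then show ?thesis unfolding * IH by (simp add: x w insert_one_zero)
      next
        case (Some b)
        then show ?thesis unfolding * IH by (simp add: x w)
      qed
    qed
  qed
qed simp

lemma homotopy_left_part:
  assumes "0 < corks w"
  shows "left_part (insert_one f) w + insert_one (left_part f) w = (case w of None # _ \<Rightarrow> - f w | _ \<Rightarrow> 0)"
proof (cases w)
  case (Cons x w')
  have "insert_one (\<lambda>v. l a (h v)) u = l a (insert_one h u)" for a h u
    by (induction h u rule: insert_one.induct) (simp_all add: l_minus)
  then show ?thesis by (cases x) (simp_all add: Cons l_one)
qed simp

lemma homotopy_right_part: "right_part (insert_one f) w + insert_one (right_part f) w = 0"
proof (induction w arbitrary: f)
  case (Cons x w)
  show ?case
  proof (cases w)
    case Nil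
    then show ?thesis by (cases x) simp_all
  next
    case w: (Cons y w')
    show ?thesis
    proof (cases x)
      case None
      then show ?thesis by (simp add: w right_part_lin)
    next
      case (Some a)
      have "insert_one (\<lambda>v. right_part f (Some a # v)) w = insert_one (\<lambda>v. - right_part (\<lambda>v. f (Some a # v)) v) w"
      proof (rule insert_one_cong)
        fix v :: "'a option list" assume "v \<noteq> []"
        then show "right_part f (Some a # v) = - right_part (\<lambda>v. f (Some a # v)) v" by (cases v) auto
      qed
      then have "insert_one (right_part f) (x # w) = insert_one (right_part (\<lambda>v. f (Some a # v))) w"
        by (simp add: Some insert_one_lin)
      moreover have "right_part (insert_one f) (x # w) = right_part (insert_one (\<lambda>v. f (Some a # v))) w"
        by (simp add: Some w right_part_lin)
      ultimately show ?thesis using Cons.IH by simp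
    qed
  qed
qed simp

text \<open>
  The terms of the coboundary that do not touch the inserted \<open>1\<close> occur twice with opposite
  signs. Those that replace the first cork have fewer corks and are killed by \<open>f\<close>. What
  remains is the product of the inserted \<open>1\<close> with its left neighbour.
\<close>

lemma cork_contraction_homotopy:
  assumes "vanishes_below j f" "corks w = j" "0 < j"
  shows "word_coboundary (insert_one f) w + insert_one (word_coboundary f) w = f w"
proof -
  have "word_coboundary (insert_one f) w + insert_one (word_coboundary f) w
     = (bar_sum w (insert_one f) + insert_one (\<lambda>v. bar_sum v f) w)
       - (left_part (insert_one f) w + insert_one (left_part f) w)
       + (right_part (insert_one f) w + insert_one (right_part f) w)"
    by (simp add: word_coboundary_def[abs_def] insert_one_lin)
  also have "\<dots> = f w"
    using assms
    by (subst homotopy_bar_sum[OF assms], subst homotopy_left_part, simp, subst homotopy_right_part)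
      (auto split: list.split option.split)
  finally show ?thesis .
qed

lemma word_multilinear_insert_one:
  assumes "word_multilinear g" shows "word_multilinear (insert_one g)"
  unfolding word_multilinear_def
proof (intro allI)
  fix us k a b vs
  show "insert_one g (us @ Some (scaleA k a + b) # vs)
     = scaleM k (insert_one g (us @ Some a # vs)) + insert_one g (us @ Some b # vs)"
    using assms
  proof (induction us arbitrary: g)
    case Nil
    have "(\<lambda>v. g (Some (scaleA k a + b) # v)) = (\<lambda>v. scaleM k (g (Some a # v)) + g (Some b # v))"
      by (simp add: word_multilinearD0[OF Nil])
    then show ?case by (simp add: insert_one_affine)
  next
    case (Cons x us)
    show ?case
    proof (cases x)
      case None
      then show ?thesis using word_multilinearD[OF Cons.prems, of "Some 1 # None # us" k a b vs] by simp
    next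
      case (Some c)
      then show ?thesis using Cons.IH[OF word_multilinear_Cons[OF Cons.prems, of x]] by simp
    qed
  qed
qed

lemma insert_one_cochain:
  assumes "g \<in> word_cochains (Suc n)" shows "insert_one g \<in> word_cochains n"
proof -
  have "insert_one g w = 0" if "wdeg w \<noteq> Suc n" for w
    using insert_one_cong[of w g "\<lambda>_. 0"] assms that by (simp add: word_cochains_def insert_one_zero)
  then show ?thesis using assms word_multilinear_insert_one by (simp add: word_cochains_def)
qed

lemma corks_le_wdeg: "corks w \<le> wdeg w"
  by (induction w rule: corks.induct) auto

text \<open>
  If a cocycle vanishes on words with fewer than \<open>j\<close> corks, then subtracting the coboundary of its
  contraction makes it vanish on words with \<open>j\<close> corks too. As a cork has degree 2, this ends
  after finitely many steps in each degree.
\<close>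

theorem cork_free_kernel_exact:
  assumes "f \<in> word_cochains (Suc n)" "vanishes_below 1 f" "word_coboundary f = (\<lambda>_. 0)"
  shows "\<exists>g\<in>word_cochains n. vanishes_below 1 g \<and> word_coboundary g = f"
proof -
  have "\<exists>g\<in>word_cochains n. vanishes_below 1 g \<and> word_coboundary g = f"
    if "f \<in> word_cochains (Suc n)" "vanishes_below j f" "0 < j" "word_coboundary f = (\<lambda>_. 0)" for j f
    using that
  proof (induction "n + 3 - j" arbitrary: j f rule: less_induct)
    case less
    show ?case
    proof (cases "j < n + 3")
      case False
      have "f w = 0" for w
      proof (cases "wdeg w = Suc (Suc n)")
        case True
        then have "corks w < j" using corks_le_wdeg[of w] False by simp
        then show ?thesis using less.prems(2) by (simp add: vanishes_below_def)
      next
        case False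
        then show ?thesis using less.prems(1) by (simp add: word_cochains_def)
      qed
      then have "f = (\<lambda>_. 0)" by auto
      moreover have "word_coboundary (\<lambda>_. 0) = (\<lambda>_. 0)"
        using word_coboundary_lin(2)[of "\<lambda>_. 0" "\<lambda>_. 0"] by (simp add: fun_eq_iff)
      ultimately show ?thesis
        by (intro bexI[of _ "\<lambda>_. 0"]) (auto simp: word_cochains_zero vanishes_below_def)
    next
      case True
      let ?h = "insert_one f"
      define f' where "f' = (\<lambda>w. f w - word_coboundary ?h w)"
      have h: "?h \<in> word_cochains n" by (rule insert_one_cochain[OF less.prems(1)])
      have f': "f' \<in> word_cochains (Suc n)"
        unfolding f'_def by (rule word_cochains_lin(2)[OF less.prems(1) word_coboundary_cochain[OF h]])
      have "f' w = 0" if "corks w < Suc j" for w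
      proof (cases "corks w = j")
        case True
        then show ?thesis using cork_contraction_homotopy[OF less.prems(2) True less.prems(3)]
          by (simp add: f'_def less.prems(4) insert_one_zero)
      next
        case False
        then have "corks w < j" using that by simp
        then show ?thesis
          using less.prems(2) vanishes_below_coboundary[OF vanishes_below_insert_one[OF less.prems(2)]]
          by (simp add: f'_def vanishes_below_def)
      qed
      then have "vanishes_below (Suc j) f'" by (simp add: vanishes_below_def)
      moreover have "word_coboundary f' = (\<lambda>_. 0)"
        unfolding f'_def by (simp add: fun_eq_iff word_coboundary_lin word_coboundary_square less.prems(4))
      moreover have "n + 3 - Suc j < n + 3 - j" using True by simp
      ultimately obtain g where g: "g \<in> word_cochains n" "vanishes_below 1 g" "word_coboundary g = f'"
        using less.hyps[of "Suc j" f'] f' by blast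
      have "vanishes_below 1 ?h" by (simp add: vanishes_below_def insert_one_no_cork)
      then have "vanishes_below 1 (\<lambda>w. ?h w + g w)" using g(2) by (simp add: vanishes_below_def)
      moreover have "word_coboundary (\<lambda>w. ?h w + g w) = f"
        by (rule ext) (simp add: word_coboundary_lin g(3) f'_def)
      ultimately show ?thesis using word_cochains_lin(1)[OF h g(1)] by blast
    qed
  qed
  from this[of f 1] assms show ?thesis by simp
qed

end

section \<open>Right combs\<close>

text \<open>
  Each word has exactly one right comb, the tree in which every left subtree is a letter.
\<close>

fun is_letter :: "'b tree \<Rightarrow> bool" where
  "is_letter (Mu s t) = False"
| "is_letter _ = True"

fun right_comb :: "'b tree \<Rightarrow> bool" where
  "right_comb (Mu s t) = (is_letter s \<and> right_comb t)"
| "right_comb _ = True"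

fun comb :: "'b option list \<Rightarrow> 'b tree" where
  "comb [] = Bullet"
| "comb [x] = letter x"
| "comb (x # y # w) = Mu (letter x) (comb (y # w))"

lemma is_letter_letter: "is_letter s \<Longrightarrow> \<exists>x. s = letter x"
  by (cases s) (auto intro: exI[of _ "Some _"] exI[of _ None])

lemma is_letter_of_letter [simp]: "is_letter (letter x)" "right_comb (letter x)"
  by (cases x; simp)+

lemma right_comb_eq: "right_comb t \<Longrightarrow> t = comb (tree_word t)"
proof (induction t)
  case (Mu s t)
  obtain x where x: "s = letter x" using Mu.prems is_letter_letter by auto
  obtain y w where w: "tree_word t = y # w" using tree_word_nonempty[of t] by (cases "tree_word t") auto
  have t: "t = comb (y # w)" using Mu by (simp add: w)
  have "comb (tree_word (Mu s t)) = Mu (letter x) (comb (y # w))" by (simp add: x w)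
  also have "\<dots> = Mu s t" by (simp only: x t[symmetric])
  finally show ?case by (rule sym)
qed auto

lemma comb_right_comb: "w \<noteq> [] \<Longrightarrow> right_comb (comb w) \<and> tree_word (comb w) = w"
  by (induction w rule: comb.induct) auto

context unital_bimodule
begin

section \<open>Derivations from word cochains\<close>

text \<open>
  A linear extension of a function of words from corollas to all trees. It is supported on right combs,
  which meet every corolla once and are preserved by a change of labels, so that it is
  multilinear when \<open>g\<close> is.
\<close>

definition tree_value :: "('a option list \<Rightarrow> 'm) \<Rightarrow> 'a tree \<Rightarrow> 'm" where
  "tree_value g t = (if right_comb t then scaleM (tree_sign t) (g (tree_word t)) else 0)"

lemma tree_value_corolla:
  assumes "g [] = 0"
  shows "lext scaleM (tree_value g) (corolla w) = g w"
proof (cases "w = []")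
  case True
  then show ?thesis using assms by (simp add: M.lext_zero)
next
  case False
  have eq: "right_comb t \<longleftrightarrow> t = comb w" if "tree_word t = w" for t
    using comb_right_comb[OF False] right_comb_eq[of t] that by auto
  have "lext scaleM (tree_value g) (corolla w)
      = (\<Sum>t | tree_word t = w. scaleM (tree_sign t) (tree_value g t))"
    by (simp add: corolla_def M.lext_sum M.lext_single)
  also have "\<dots> = (\<Sum>t | tree_word t = w. if t = comb w then g w else 0)"
    by (rule sum.cong) (auto simp: tree_value_def eq tree_sign_square)
  also have "\<dots> = g w"
    using comb_right_comb[OF False] by (simp add: finite_trees_of_word)
  finally show ?thesis .
qed

lemma tree_context_word:
  "tree_context F \<Longrightarrow> \<exists>us vs. \<forall>x. tree_word (F x) = us @ Some x # vs"
proof (induction rule: tree_context.induct)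
  case leaf
  show ?case by (rule exI[of _ "[]"], rule exI[of _ "[]"]) simp
next
  case (left F t)
  then obtain us vs where "\<forall>x. tree_word (F x) = us @ Some x # vs" by blast
  then have "\<forall>x. tree_word (Mu (F x) t) = us @ Some x # (vs @ tree_word t)" by simp
  then show ?case by blast
next
  case (right F t)
  then obtain us vs where "\<forall>x. tree_word (F x) = us @ Some x # vs" by blast
  then have "\<forall>x. tree_word (Mu t (F x)) = (tree_word t @ us) @ Some x # vs" by simp
  then show ?case by blast
qed

lemma tree_context_is_letter: "tree_context F \<Longrightarrow> is_letter (F x) = is_letter (F y)"
  by (cases rule: tree_context.cases) auto

lemma tree_context_right_comb: "tree_context F \<Longrightarrow> right_comb (F x) = right_comb (F y)"
proof (induction rule: tree_context.induct)
  case (left F t)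
  then show ?case using tree_context_is_letter by (metis right_comb.simps(1))
qed auto

lemma tree_context_tree_sign: "tree_context F \<Longrightarrow> tree_sign (F x) = (tree_sign (F y) :: 'k)"
proof (induction rule: tree_context.induct)
  case (left F t)
  then show ?case using A.tree_context_weight[of F x y] by simp
qed auto

lemma affine_tree_value:
  assumes g: "word_multilinear g" and F: "tree_context F"
  shows "affine_mod scaleA scaleM {0} (\<lambda>x. tree_value g (F x))"
proof -
  obtain us vs where w: "\<And>x. tree_word (F x) = us @ Some x # vs" using tree_context_word[OF F] by blast
  define s where "s = (tree_sign (F 0) :: 'k)"
  define c where "c = right_comb (F 0)"
  have "tree_value g (F x) = (if c then scaleM s (g (us @ Some x # vs)) else 0)" for x
    using tree_context_tree_sign[OF F, of x 0] tree_context_right_comb[OF F, of x 0]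
    by (simp add: tree_value_def w s_def c_def)
  then show ?thesis
    by (simp add: affine_mod_def word_multilinearD[OF g] M.scale_right_distrib mult.commute)
qed

fun word_derivation :: "('a option list \<Rightarrow> 'm) \<Rightarrow> 'a tree list \<Rightarrow> 'm" where
  "word_derivation g [] = 0"
| "word_derivation g (t # w) = r (tree_value g t) (word_aug w) + l (A.leaf_value t) (word_derivation g w)"

lemma word_derivation_append:
  "word_derivation g (u @ v) = r (word_derivation g u) (word_aug v) + l (word_aug u) (word_derivation g v)"
  by (induction u) (simp_all add: A.word_aug_append r_mult l_mult l_r l_add r_add l_one add.assoc)

abbreviation deriv_ext :: "('a option list \<Rightarrow> 'm) \<Rightarrow> ('a tree list \<Rightarrow>\<^sub>0 'k) \<Rightarrow> 'm" where
  "deriv_ext g \<equiv> lext scaleM (word_derivation g)"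

text \<open>
  \<open>deriv_ext g\<close> is the derivation along the augmentation that extends \<open>tree_value g\<close>.
\<close>

lemma deriv_ext_wmult:
  "deriv_ext g (wmult p q) = r (deriv_ext g p) (A.aug q) + l (A.aug p) (deriv_ext g q)"
proof (induction p q rule: basis_induct2)
  case (single c d x y)
  show ?case
    by (simp add: wmult_simps wmult_bas M.lext_scale M.lext_bas A.lext_scale A.lext_bas
        word_derivation_append l_scale r_scale M.scale_right_distrib M.scale_left_commute mult.commute)
qed (simp_all add: wmult_simps M.lext_add A.lext_add l_add r_add add_ac)

lemma deriv_ext_emb: "deriv_ext g (emb p) = lext scaleM (tree_value g) p"
  by (induction p rule: basis_induct)
    (simp_all add: emb_simps M.lext_add M.lext_scale M.lext_bas r_one)

lemma deriv_ext_N: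
  assumes g: "word_multilinear g" and p: "p \<in> A.N"
  shows "deriv_ext g p = 0"
proof -
  have "deriv_ext g p \<in> {0}"
  proof (rule M.hom_span_subset[OF M.lext_hom _ M.subspace_single_0 p[unfolded word_ideal_def]], safe)
    fix us p vs assume p: "p \<in> multilin_rels scaleA"
    have "lext scaleM (tree_value g) p \<in> {0}"
      by (rule M.lext_multilin_rels[OF A.scale_vector_space M.subspace_single_0 affine_tree_value[OF g] p])
    moreover have "A.aug (emb p) = 0" by (intro A.aug_N A.emb_multilin_span fvs.span_base p)
    ultimately show "deriv_ext g (ftensor (us @ [p] @ vs)) = 0"
      by (simp only: ftensor_append ftensor_single deriv_ext_wmult deriv_ext_emb A.aug_wmult) simp
  qed
  then show ?thesis by simp
qed

lemma word_derivation_degree: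
  assumes "g \<in> word_cochains k"
  shows "word_degree w \<noteq> k \<Longrightarrow> word_derivation g w = 0"
proof (induction w)
  case (Cons t w)
  have "r (tree_value g t) (word_aug w) = 0"
  proof (cases "weight t = k")
    case True
    then have "word_aug w = (0 :: 'a)" using Cons.prems by (intro A.word_aug_degree) simp
    then show ?thesis by simp
  next
    case False
    then have "g (tree_word t) = 0" using assms by (simp add: word_cochains_def wdeg_tree_word)
    then show ?thesis by (simp add: tree_value_def)
  qed
  moreover have "l (A.leaf_value t) (word_derivation g w) = 0"
    using Cons by (cases t) simp_all
  ultimately show ?case by simp
qed simp

interpretation R: coefficient_bimodule "resolution scaleA" scaleA "resolution_aug scaleA" scaleM l r
  by (intro coefficient_bimodule.intro A.augmented_resolution unital_bimodule_axioms)

abbreviation Cot where "Cot \<equiv> base_change scaleA (resolution scaleA) (resolution_aug scaleA) (kaehler (resolution scaleA))"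

definition coset_derivation :: "('a option list \<Rightarrow> 'm) \<Rightarrow> ('a tree list \<Rightarrow>\<^sub>0 'k) set \<Rightarrow> 'm" where
  "coset_derivation g X = deriv_ext g (SOME p. p \<in> X)"

lemma coset_derivation_cls:
  assumes "word_multilinear g"
  shows "coset_derivation g (cls A.N p) = deriv_ext g p"
  unfolding coset_derivation_def
  by (rule value_on_coset[OF deriv_ext_N[OF assms] fvs.subspace_0[OF A.N_subspace] M.lext_diff])

lemma coset_derivation:
  assumes "word_multilinear g"
  shows "R.derivation (coset_derivation g)"
  unfolding R.derivation_def
  by (auto simp: A.vcar_R A.vadd_R A.vsmul_R A.amult_R A.resolution_aug_R coset_derivation_cls[OF assms]
      M.lext_add M.lext_scale deriv_ext_wmult)

lemma coset_derivation_degree: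
  assumes g: "g \<in> word_cochains k" and "j \<noteq> k" "X \<in> hcomp (resolution scaleA) j"
  shows "coset_derivation g X = 0"
proof -
  obtain p where p: "X = cls A.N p" "\<forall>w\<in>Poly_Mapping.keys p. word_degree w = j"
    using assms(3) by (auto simp: A.hcomp_R)
  have "deriv_ext g p = 0"
    unfolding lext_def by (rule sum.neutral) (use p(2) assms(2) word_derivation_degree[OF g] in auto)
  then show ?thesis using g by (simp add: p(1) coset_derivation_cls word_cochains_def)
qed

abbreviation corolla_gen :: "'a option list \<Rightarrow> ('a tree list \<Rightarrow>\<^sub>0 'k) set" where
  "corolla_gen w \<equiv> cls A.N (emb (corolla w))"

lemma corolla_gen_in_R: "corolla_gen w \<in> vcar (resolution scaleA)"
  by (simp add: A.vcar_R A.emb_in_U)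

lemma coset_derivation_corolla:
  assumes "word_multilinear g" "g [] = 0"
  shows "coset_derivation g (corolla_gen w) = g w"
  by (simp add: coset_derivation_cls assms deriv_ext_emb tree_value_corolla)

text \<open>
  The resolution is generated as an algebra by the corollas of words.
\<close>

lemma derivation_determined:
  assumes D: "R.derivation D" "R.derivation D'" and eq: "\<And>w. D (corolla_gen w) = D' (corolla_gen w)"
    and X: "X \<in> vcar (resolution scaleA)"
  shows "D X = D' X"
proof -
  let ?S = "{p \<in> A.U. D (cls A.N p) = D' (cls A.N p)}"
  have cl: "cls A.N p \<in> vcar (resolution scaleA)" if "p \<in> A.U" for p using that by (simp add: A.vcar_R)
  have add: "E (cls A.N (p + q)) = E (cls A.N p) + E (cls A.N q)"
    if "R.derivation E" "p \<in> A.U" "q \<in> A.U" for E p q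
    using R.derivation_simps(1)[OF that(1) cl[OF that(2)] cl[OF that(3)]] by (simp add: A.vadd_R)
  have scl: "E (cls A.N (fscale c p)) = scaleM c (E (cls A.N p))"
    if "R.derivation E" "p \<in> A.U" for E c p
    using R.derivation_simps(2)[OF that(1) cl[OF that(2)]] by (simp add: A.vsmul_R)
  have mul: "E (cls A.N (wmult p q)) = r (E (cls A.N p)) (A.aug q) + l (A.aug p) (E (cls A.N q))"
    if "R.derivation E" "p \<in> A.U" "q \<in> A.U" for E p q
    using R.derivation_simps(3)[OF that(1) cl[OF that(2)] cl[OF that(3)]] by (simp add: A.amult_R A.resolution_aug_R)
  have zero: "E (cls A.N 0) = 0" if "R.derivation E" for E
    using scl[OF that fvs.subspace_0[OF A.U_subspace], of 0] by simp
  have one: "E (cls A.N (bas [])) = 0" if "R.derivation E" for E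
    using mul[OF that A.one_in_U A.one_in_U] by (simp add: A.lext_bas r_one l_one)
  have S: "fvs.subspace ?S"
    unfolding fvs.subspace_def
    using add[OF D(1)] add[OF D(2)] scl[OF D(1)] scl[OF D(2)] zero[OF D(1)] zero[OF D(2)]
    by (auto simp: fvs.subspace_0[OF A.U_subspace] fvs.subspace_add[OF A.U_subspace]
        fvs.subspace_scale[OF A.U_subspace])
  have gen: "emb p \<in> ?S" if "p \<in> corolla_span" for p
    by (rule fvs.hom_span_subset[OF emb_hom _ S that]) (use eq A.emb_in_U in auto)
  have "ftensor ps \<in> ?S" if "set ps \<subseteq> corolla_span" for ps
    using that
  proof (induction ps)
    case Nil
    then show ?case using one[OF D(1)] one[OF D(2)] A.one_in_U by (simp add: ftensor_Nil)
  next
    case (Cons p ps)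
    then have "emb p \<in> ?S" "ftensor ps \<in> ?S" using gen by auto
    then show ?case using mul[OF D(1)] mul[OF D(2)] A.wmult_in_U by (simp add: ftensor_Cons)
  qed
  then have "{ftensor ps | ps. set ps \<subseteq> bar_gens} \<subseteq> ?S" unfolding bar_gens_eq by blast
  then have "A.U \<subseteq> ?S" by (rule ord_eq_le_trans[OF resolution_words_def fvs.span_minimal[OF _ S]])
  then show ?thesis using X by (auto simp: A.vcar_R)
qed

section \<open>The cochain of a bimodule map\<close>

text \<open>
  The restriction of the derivation belonging to \<open>f\<close> to the generators.
\<close>

definition cochain_of :: "(_ \<Rightarrow> 'm) \<Rightarrow> 'a option list \<Rightarrow> 'm" where
  "cochain_of f w = f (R.gen (corolla_gen w))"

lemma lin_in_subspace:
  "fvs.subspace S \<Longrightarrow> (\<And>t. t \<in> Poly_Mapping.keys c \<Longrightarrow> h t \<in> S) \<Longrightarrow> lin h c \<in> S"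
  unfolding lin_def by (intro fvs.subspace_sum fvs.subspace_scale) auto

text \<open>
  Words with the same pattern of corks have corollas that differ by their labels only.
\<close>

lemma corolla_multilinear:
  "corolla (us @ Some (scaleA k a + b) # vs) - fscale k (corolla (us @ Some a # vs))
    - (corolla (us @ Some b # vs)) \<in> A.multilin_span"
proof -
  let ?c = "corolla (block_shape (us @ Some a # vs)) :: _ \<Rightarrow>\<^sub>0 'k"
  let ?d = "\<lambda>x t. decorate t (somes us @ [x] @ somes vs)"
  have d: "corolla (us @ Some x # vs) = lin (\<lambda>t. bas (?d x t)) ?c" for x
    unfolding decorate_corolla[of "us @ Some x # vs", symmetric] by (simp add: block_shape_def)
  have "lin (\<lambda>t. bas (?d (scaleA k a + b) t) - fscale k (bas (?d a t)) - bas (?d b t)) ?c \<in> A.multilin_span"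
  proof (rule lin_in_subspace[OF fvs.subspace_span])
    fix t assume "t \<in> Poly_Mapping.keys ?c"
    moreover have "?c \<in> of_arity (length (somes (us @ Some a # vs)))" by (rule corolla_shape_of_arity)
    ultimately have "length (somes us) + 1 + length (somes vs) = arity t" by (auto simp: of_arity_def)
    then have "tree_context (\<lambda>x. ?d x t)" by (rule tree_context_decorate)
    from A.affine_tree_context[OF this]
    show "bas (?d (scaleA k a + b) t) - fscale k (bas (?d a t)) - bas (?d b t) \<in> A.multilin_span"
      unfolding affine_mod_def by blast
  qed
  then show ?thesis by (simp add: d lin_diff_fun lin_scale_fun)
qed

lemma cochain_of_multilinear:
  assumes "R.bimod_map f" shows "word_multilinear (cochain_of f)"
  unfolding word_multilinear_def
proof (intro allI)
  fix us k a b vs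
  let ?g = "\<lambda>x. corolla_gen (us @ Some x # vs)"
  have "emb (corolla (us @ Some (scaleA k a + b) # vs) - fscale k (corolla (us @ Some a # vs))
    - (corolla (us @ Some b # vs))) \<in> A.N"
    by (intro A.emb_multilin_span corolla_multilinear)
  then have "?g (scaleA k a + b) = vadd (resolution scaleA) (vsmul (resolution scaleA) k (?g a)) (?g b)"
    by (simp add: A.vadd_R A.vsmul_R fvs.cls_eq_iff[OF A.N_subspace] emb_simps diff_diff_eq)
  moreover have "R.derivation (\<lambda>y. f (R.gen y))" by (rule R.bimod_map_derivation[OF assms])
  ultimately show "cochain_of f (us @ Some (scaleA k a + b) # vs)
     = scaleM k (cochain_of f (us @ Some a # vs)) + cochain_of f (us @ Some b # vs)"
    using corolla_gen_in_R R.smul_closed by (simp add: cochain_of_def R.derivation_def)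
qed

lemma cochain_of_cochain:
  assumes f: "f \<in> bimod_hom Cot scaleM l r k" shows "cochain_of f \<in> word_cochains k"
proof -
  have "cochain_of f w = 0" if "wdeg w \<noteq> Suc k" for w
  proof -
    \<comment> \<open>The corolla of the empty word is zero, hence homogeneous of any degree.\<close>
    define j where "j = (if w = [] then Suc k else wdeg w - 1)"
    have "j \<noteq> k" using that by (cases w) (auto simp: j_def)
    have "word_degree v = j" if "v \<in> Poly_Mapping.keys (emb (corolla w) :: _ \<Rightarrow>\<^sub>0 'k)" for v
    proof -
      have "\<exists>t\<in>Poly_Mapping.keys (corolla w :: _ \<Rightarrow>\<^sub>0 'k). v = [t]"
      proof (rule ccontr)
        assume "\<not> ?thesis"
        then have "Poly_Mapping.lookup (emb (corolla w) :: _ \<Rightarrow>\<^sub>0 'k) v = 0"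
          unfolding emb_def lookup_lin by (intro sum.neutral) (auto simp: lookup_single when_def)
        then show False using that by (simp add: in_keys_iff)
      qed
      then obtain t where "v = [t]" "tree_word t = w" using keys_corolla by blast
      then show ?thesis using wdeg_tree_word[of t] by (auto simp: j_def)
    qed
    then have "corolla_gen w \<in> hcomp (resolution scaleA) j"
      by (auto simp: A.hcomp_R A.emb_in_U)
    then show ?thesis
      unfolding cochain_of_def using R.bimod_hom_degree[OF f \<open>j \<noteq> k\<close>] by blast
  qed
  then show ?thesis
    using cochain_of_multilinear[OF R.bimod_hom_map[OF f]] by (simp add: word_cochains_def)
qed

lemma cochain_of_surj:
  assumes g: "g \<in> word_cochains k"
  obtains f where "f \<in> bimod_hom Cot scaleM l r k" "cochain_of f = g"
proof -
  have m: "word_multilinear g" and g0: "g [] = 0" using g by (auto simp: word_cochains_def)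
  show thesis
  proof (rule R.derivation_extends[OF coset_derivation[OF m]])
    fix f
    assume f: "f \<in> bimod_hom Cot scaleM l r k"
      "\<And>y. y \<in> vcar (resolution scaleA) \<Longrightarrow> f (R.gen y) = coset_derivation g y"
    have "cochain_of f = g"
      by (rule ext) (simp add: cochain_of_def f(2) corolla_gen_in_R coset_derivation_corolla m g0)
    then show thesis using f(1) that by blast
  next
    show "coset_derivation g y = 0" if "j \<noteq> k" "y \<in> hcomp (resolution scaleA) j" for j y
      by (rule coset_derivation_degree[OF g that])
  qed
qed

lemma cochain_of_inj:
  assumes f: "R.bimod_map f" and "\<And>w. cochain_of f w = 0" and X: "X \<in> vcar Cot"
  shows "f X = 0"
proof (rule R.bimod_map_zero[OF f _ X])
  fix y assume y: "y \<in> vcar (resolution scaleA)"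
  have z: "R.derivation (\<lambda>_. 0)" by (simp add: R.derivation_def)
  show "f (R.gen y) = 0"
    using derivation_determined[OF R.bimod_map_derivation[OF f] z _ y] assms(2)
    by (simp add: cochain_of_def)
qed

section \<open>The coboundary of a bimodule map\<close>

definition word_value :: "'a option list \<Rightarrow> 'a" where
  "word_value v = (case v of [Some a] \<Rightarrow> a | _ \<Rightarrow> 0)"

lemma aug_emb_corolla: "A.aug (emb (corolla v)) = word_value v"
proof (cases "length v = 1")
  case True
  then obtain x where "v = [x]" by (auto simp: length_Suc_conv)
  then show ?thesis by (cases x) (simp_all add: corolla_letter A.lext_bas word_value_def)
next
  case False
  have "A.aug (emb (corolla v)) = lext scaleA A.leaf_value (corolla v)"
    by (simp add: A.lext_emb)
  also have "\<dots> = 0"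
    unfolding lext_def
  proof (rule sum.neutral, safe)
    fix t assume "t \<in> Poly_Mapping.keys (corolla v :: _ \<Rightarrow>\<^sub>0 'k)"
    then have "tree_word t = v" by (rule keys_corolla)
    then have "A.leaf_value t = 0" using False by (cases t) auto
    then show "scaleA (Poly_Mapping.lookup (corolla v) t) (A.leaf_value t) = 0" by simp
  qed
  also have "0 = word_value v" using False by (auto simp: word_value_def split: list.split option.split)
  finally show ?thesis .
qed

lemma split_sum_left:
  assumes "g [] = 0"
  shows "split_sum (\<lambda>u v. - pm (wdeg u) (l (word_value u) (g v))) w = left_part g w"
proof (cases w)
  case (Cons x w')
  show ?thesis
  proof (cases w')
    case Nil
    then show ?thesis using assms by (cases x) (simp_all add: Cons)
  next
    case w': (Cons y w'')
    have "split_sum (\<lambda>u v. - pm (wdeg (x # u)) (l (word_value (x # u)) (g v))) w' = split_sum (\<lambda>u v. 0) w'"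
    proof (rule split_sum_cong)
      fix u v :: "'a option list" assume "u \<noteq> []"
      then have "word_value (x # u) = 0" by (cases u) (auto simp: word_value_def split: option.split)
      then show "- pm (wdeg (x # u)) (l (word_value (x # u)) (g v)) = 0" by simp
    qed
    then show ?thesis by (cases x) (simp_all add: Cons w' word_value_def)
  qed
qed simp

lemma split_sum_right:
  "w \<noteq> [] \<Longrightarrow> split_sum (\<lambda>u v. pm (wdeg u) (r (g u) (word_value v))) w + r (g []) (word_value w) = right_part g w"
proof (induction w arbitrary: g)
  case (Cons x w)
  show ?case
  proof (cases w)
    case Nil
    then show ?thesis by (cases x) (simp_all add: word_value_def)
  next
    case w: (Cons y w')
    have 0: "word_value (x # w) = 0" by (simp add: w word_value_def split: option.split)
    have "split_sum (\<lambda>u v. pm (wdeg (x # u)) (r (g (x # u)) (word_value v))) w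
        = pm (ldeg x) (split_sum (\<lambda>u v. pm (wdeg u) (r (g (x # u)) (word_value v))) w)"
      by (subst split_sum_hom[of "pm (ldeg x)"]) (simp_all add: pm_add pm_plus)
    then have "split_sum (\<lambda>u v. pm (wdeg u) (r (g u) (word_value v))) (x # w)
        = pm (ldeg x) (split_sum (\<lambda>u v. pm (wdeg u) (r (g (x # u)) (word_value v))) w + r (g [x]) (word_value w))"
      by (simp add: w pm_add add.commute)
    then show ?thesis using Cons.IH[of "\<lambda>v. g (x # v)"] 0 by (simp add: w)
  qed
qed simp

text \<open>
  The bar part of the differential gives the faces. In the cobar part only those cuts survive
  for which one of the two factors is a single letter of \<open>A\<close>.
\<close>

lemma deriv_ext_diff:
  assumes g: "g [] = 0"
  shows "deriv_ext g (wdiff (emb (corolla w))) = word_coboundary g w"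
proof -
  have "deriv_ext g (emb (bar_sum w corolla)) = bar_sum w g"
    using bar_sum_hom[of "lext scaleM (tree_value g)" w "corolla"]
    by (simp add: deriv_ext_emb M.lext_add tree_value_corolla g)
  moreover have "deriv_ext g (lin cobar_diff (corolla w)) = left_part g w - right_part g w"
  proof -
    have "deriv_ext g (- pm n p) = - pm n (deriv_ext g p)" for n p
      by (simp add: pm_def M.lext_neg)
    moreover have "deriv_ext g (split_sum \<phi> w) = split_sum (\<lambda>u v. deriv_ext g (\<phi> u v)) w" for \<phi>
      by (rule split_sum_hom) (simp_all add: M.lext_zero M.lext_add)
    ultimately have "deriv_ext g (lin cobar_diff (corolla w))
        = split_sum (\<lambda>u v. - pm (wdeg u) (r (g u) (word_value v) + l (word_value u) (g v))) w"
      by (simp add: cobar_diff_corolla M.lext_add M.lext_zero M.lext_bas deriv_ext_wmult deriv_ext_emb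
          tree_value_corolla g aug_emb_corolla)
    also have "\<dots> = split_sum (\<lambda>u v. - pm (wdeg u) (l (word_value u) (g v))
        + - pm (wdeg u) (r (g u) (word_value v))) w"
      by (rule split_sum_cong) (simp add: pm_add)
    also have "\<dots> = left_part g w + split_sum (\<lambda>u v. - pm (wdeg u) (r (g u) (word_value v))) w"
      by (simp only: split_sum_add split_sum_left[of g, OF g])
    also have "split_sum (\<lambda>u v. - pm (wdeg u) (r (g u) (word_value v))) w
        = - split_sum (\<lambda>u v. pm (wdeg u) (r (g u) (word_value v))) w"
      by (rule split_sum_hom[symmetric]) simp_all
    also have "split_sum (\<lambda>u v. pm (wdeg u) (r (g u) (word_value v))) w = right_part g w"
      using split_sum_right[of w g] g by (cases "w = []") simp_all
    finally show ?thesis by simp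
  qed
  ultimately show ?thesis
    by (simp add: wdiff_emb bar_diff_corolla M.lext_diff word_coboundary_def)
qed

lemma bimod_hom_diff_map:
  assumes "R.bimod_map f" shows "R.bimod_map (bimod_hom_diff Cot scaleM k f)"
proof -
  define c where "c = (- ((-1) ^ k) :: 'k)"
  have "bimod_hom_diff Cot scaleM k f = (\<lambda>x. if x \<in> vcar Cot then scaleM c (f (vdiff Cot x)) else 0)"
    by (simp add: fun_eq_iff bimod_hom_diff_def c_def)
  then have e: "bimod_hom_diff Cot scaleM k f x = scaleM c (f (vdiff Cot x))" if "x \<in> vcar Cot" for x
    using that by simp
  note fD = R.bimod_mapD[OF assms R.C_diff(1)]
  show ?thesis
    unfolding R.bimod_map_def
  proof (intro conjI ballI allI)
    fix x assume x: "x \<in> vcar Cot"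
    show "bimod_hom_diff Cot scaleM k f (vadd Cot x y)
        = bimod_hom_diff Cot scaleM k f x + bimod_hom_diff Cot scaleM k f y" if y: "y \<in> vcar Cot" for y
      by (simp only: e[OF x] e[OF y] e[OF R.C_closed(1)[OF x y]] R.C_diff(2)[OF x y]
          fD(1)[OF x R.C_diff(1)[OF y]] M.scale_right_distrib)
    show "bimod_hom_diff Cot scaleM k f (vsmul Cot d x) = scaleM d (bimod_hom_diff Cot scaleM k f x)" for d
      by (simp only: e[OF x] e[OF R.C_closed(2)[OF x]] R.C_diff(3)[OF x] fD(2)[OF x] M.scale_scale
          mult.commute)
    show "bimod_hom_diff Cot scaleM k f (lact Cot a x) = l a (bimod_hom_diff Cot scaleM k f x)" for a
      by (simp only: e[OF x] e[OF R.C_closed(3)[OF x]] R.C_diff(4)[OF x] fD(3)[OF x] l_scale(2))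
    show "bimod_hom_diff Cot scaleM k f (ract Cot x a) = r (bimod_hom_diff Cot scaleM k f x) a" for a
      by (simp only: e[OF x] e[OF R.C_closed(4)[OF x]] R.C_diff(5)[OF x] fD(4)[OF x] r_scale(1))
  qed
qed

lemma cochain_of_diff:
  assumes f: "f \<in> bimod_hom Cot scaleM l r k"
  shows "cochain_of (bimod_hom_diff Cot scaleM k f) w
    = scaleM (- ((-1) ^ k)) (word_coboundary (cochain_of f) w)"
proof -
  let ?g = "cochain_of f"
  have m: "word_multilinear ?g" and g0: "?g [] = 0"
    using cochain_of_cochain[OF f] by (auto simp: word_cochains_def)
  note bm = R.bimod_hom_map[OF f]
  have y: "corolla_gen w \<in> vcar (resolution scaleA)" by (rule corolla_gen_in_R)
  have D: "f (R.gen X) = coset_derivation ?g X" if "X \<in> vcar (resolution scaleA)" for X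
    by (rule derivation_determined[OF R.bimod_map_derivation[OF bm] coset_derivation[OF m] _ that])
      (simp add: coset_derivation_corolla m g0, simp add: cochain_of_def)
  have "f (vdiff Cot (R.gen (corolla_gen w))) = f (R.gen (vdiff (resolution scaleA) (corolla_gen w)))"
    by (rule R.bimod_map_diff_gen[OF bm y])
  also have "\<dots> = coset_derivation ?g (cls A.N (wdiff (emb (corolla w))))"
    using D[OF R.diff_closed[OF y]] by (simp add: A.vdiff_R)
  also have "\<dots> = word_coboundary ?g w"
    by (simp add: coset_derivation_cls m deriv_ext_diff g0)
  finally show ?thesis
    by (simp add: cochain_of_def[of "bimod_hom_diff _ _ _ _"] bimod_hom_diff_def R.gen_in_C y)
qed

section \<open>Restriction to words without corks\<close>

definition restrict :: "('a option list \<Rightarrow> 'm) \<Rightarrow> 'a list \<Rightarrow> 'm" where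
  "restrict g as = g (map Some as)"

text \<open>
  Extension by zero to words with corks. It is not a cochain map, but a section of
  \<open>restrict\<close> in each degree.
\<close>

definition extend :: "('a list \<Rightarrow> 'm) \<Rightarrow> 'a option list \<Rightarrow> 'm" where
  "extend c w = (if None \<in> set w then 0 else c (map the w))"

abbreviation HC where "HC \<equiv> hochschild_cochains scaleA scaleM"
abbreviation HD where "HD \<equiv> hochschild_diff scaleM l r"

lemma restrict_extend: "restrict (extend c) = c"
  by (rule ext) (auto simp: restrict_def extend_def comp_def)

lemma wdeg_map_Some [simp]: "wdeg (map Some as) = length as"
  by (induction as) auto

lemma wdeg_no_None: "None \<notin> set w \<Longrightarrow> wdeg w = length w"
proof (induction w)
  case (Cons x w)
  then show ?case by (cases x) auto
qed simp

lemma restrict_cochain: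
  assumes "g \<in> word_cochains n" shows "restrict g \<in> HC (Suc n)"
proof -
  have g: "word_multilinear g" "wdeg v \<noteq> Suc n \<Longrightarrow> g v = 0" for v
    using assms by (auto simp: word_cochains_def)
  have add: "g (us @ Some (a + b) # vs) = g (us @ Some a # vs) + g (us @ Some b # vs)" for us a b vs
    using word_multilinearD[OF g(1), of us 1 a b vs] by simp
  have "g (us @ Some 0 # vs) = 0" for us vs using add[of us 0 0 vs] by simp
  then have scl: "g (us @ Some (scaleA c a) # vs) = scaleM c (g (us @ Some a # vs))" for us c a vs
    using word_multilinearD[OF g(1), of us c a 0 vs] by simp
  show ?thesis
    by (auto simp: hochschild_cochains_def restrict_def add scl g(2))
qed

lemma extend_cochain:
  assumes "c \<in> HC (Suc n)" shows "extend c \<in> word_cochains n"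
proof -
  have c: "length as \<noteq> Suc n \<Longrightarrow> c as = 0"
    "length us + 1 + length vs = Suc n \<Longrightarrow> c (us @ [a + b] @ vs) = c (us @ [a] @ vs) + c (us @ [b] @ vs)"
    "length us + 1 + length vs = Suc n \<Longrightarrow> c (us @ [scaleA k a] @ vs) = scaleM k (c (us @ [a] @ vs))"
    for as us vs a b k
    using assms unfolding hochschild_cochains_def by blast+
  have "c (us @ (scaleA k a + b) # vs) = scaleM k (c (us @ a # vs)) + c (us @ b # vs)" for us k a b vs
    using c(2)[of us vs "scaleA k a" b] c(3)[of us vs k a] c(1)[of "us @ _ # vs"]
    by (cases "length us + 1 + length vs = Suc n") simp_all
  then have "word_multilinear (extend c)"
    by (auto simp: word_multilinear_def extend_def)
  moreover have "extend c w = 0" if "wdeg w \<noteq> Suc n" for w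
    using that c(1)[of "map the w"] by (auto simp: extend_def wdeg_no_None)
  ultimately show ?thesis by (simp add: word_cochains_def)
qed

lemma restrict_bar_sum:
  "bar_sum (map Some as) g = (\<Sum>i<length as - 1.
     pm i (g (map Some (take i as @ [as ! i * as ! Suc i] @ drop (i + 2) as))))"
proof (induction as arbitrary: g)
  case (Cons a as)
  show ?case
  proof (cases as)
    case (Cons b as')
    let ?t = "\<lambda>i. pm i (g (map Some (take i (a # as) @ [(a # as) ! i * (a # as) ! Suc i] @ drop (i + 2) (a # as))))"
    have "(\<Sum>i<length (a # as) - 1. ?t i) = ?t 0 + (\<Sum>i<length as - 1. ?t (Suc i))"
      by (simp only: Cons list.size diff_Suc_1 add_Suc_right sum.lessThan_Suc_shift add_0_right)
    also have "(\<Sum>i<length as - 1. ?t (Suc i)) = - bar_sum (map Some as) (\<lambda>v. g (Some a # v))"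
      by (simp add: Cons.IH sum_negf)
    also have "?t 0 = head_sum g (Some a) (map Some as)" by (simp add: Cons)
    finally show ?thesis by simp
  qed simp
qed simp

lemma restrict_right_part:
  "as \<noteq> [] \<Longrightarrow> right_part g (map Some as) = pm (length as - 1) (r (g (map Some (butlast as))) (last as))"
proof (induction as arbitrary: g)
  case (Cons a as)
  then show ?case by (cases as) simp_all
qed simp

text \<open>
  The \<open>i\<close>-th face carries the sign \<open>(-1)^i\<close> counted from 0, the Hochschild coboundary
  \<open>(-1)^(i+1)\<close>; the outer terms have the same discrepancy.
\<close>

lemma restrict_coboundary:
  assumes g: "g \<in> word_cochains n"
  shows "restrict (word_coboundary g) = - HD (Suc n) (restrict g)"
proof
  fix as
  show "restrict (word_coboundary g) as = (- HD (Suc n) (restrict g)) as"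
  proof (cases "length as = Suc (Suc n)")
    case False
    then show ?thesis
      using word_coboundary_cochain[OF g] by (simp add: restrict_def hochschild_diff_def word_cochains_def)
  next
    case True
    then obtain a as' where as: "as = a # as'" by (cases as) auto
    have "left_part g (map Some as) = l (hd as) (g (map Some (tl as)))" by (simp add: as)
    moreover have "as \<noteq> []" by (simp add: as)
    ultimately show ?thesis
      using True
      by (simp add: restrict_def word_coboundary_def hochschild_diff_def restrict_bar_sum
          restrict_right_part M.scale_pm sum_negf del: power_Suc)
  qed
qed

lemma vanishes_below_of_restrict_zero:
  assumes "restrict g = (\<lambda>_. 0)" shows "vanishes_below 1 g"
proof -
  have "\<exists>as. w = map Some as" if "corks w = 0" for w :: "'a option list"
    using that
  proof (induction w rule: corks.induct)
    case (3 a w)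
    then obtain as where "w = map Some as" by auto
    then have "Some a # w = map Some (a # as)" by simp
    then show ?case by (rule exI)
  qed auto
  then show ?thesis using assms by (auto simp: vanishes_below_def restrict_def fun_eq_iff)
qed

lemma restrict_zero_of_vanishes_below: "vanishes_below 1 g \<Longrightarrow> restrict g as = 0"
proof -
  have "corks (map Some as) = 0" by (induction as) auto
  then show "vanishes_below 1 g \<Longrightarrow> restrict g as = 0" by (simp add: vanishes_below_def restrict_def)
qed

section \<open>Comparison of cohomologies\<close>

abbreviation fun_scale :: "'k \<Rightarrow> ('z \<Rightarrow> 'm) \<Rightarrow> 'z \<Rightarrow> 'm" where
  "fun_scale \<equiv> \<lambda>c f x. scaleM c (f x)"

lemma fun_vector_space: "vector_space (fun_scale :: 'k \<Rightarrow> ('z \<Rightarrow> 'm) \<Rightarrow> _)"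
  by unfold_locales (auto simp: fun_eq_iff M.scale_right_distrib M.scale_left_distrib)

lemma fun_subspaceI:
  assumes "(\<lambda>_. 0) \<in> S" "\<And>f g. f \<in> S \<Longrightarrow> g \<in> S \<Longrightarrow> (\<lambda>x. f x + g x) \<in> S"
    "\<And>c f. f \<in> S \<Longrightarrow> (\<lambda>x. scaleM c (f x)) \<in> S"
  shows "module.subspace (fun_scale :: 'k \<Rightarrow> ('z \<Rightarrow> 'm) \<Rightarrow> _) S"
proof -
  interpret F: vector_space "fun_scale :: 'k \<Rightarrow> ('z \<Rightarrow> 'm) \<Rightarrow> _" by (rule fun_vector_space)
  show ?thesis
    unfolding F.subspace_def using assms by (auto simp: plus_fun_def zero_fun_def)
qed

lemma bimod_hom_lin:
  assumes "f \<in> bimod_hom B scaleM l r k" "g \<in> bimod_hom B scaleM l r k"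
  shows "(\<lambda>x. f x + g x) \<in> bimod_hom B scaleM l r k" "(\<lambda>x. scaleM c (f x)) \<in> bimod_hom B scaleM l r k"
  using assms unfolding bimod_hom_def
  by (auto simp: M.scale_right_distrib M.scale_left_commute l_add r_add l_scale r_scale add_ac)

lemma bimod_hom_zero: "(\<lambda>_. 0) \<in> bimod_hom B scaleM l r k"
  by (simp add: bimod_hom_def)

lemma bimod_hom_diff_lin:
  "bimod_hom_diff B scaleM k (\<lambda>x. f x + g x) = (\<lambda>x. bimod_hom_diff B scaleM k f x + bimod_hom_diff B scaleM k g x)"
  "bimod_hom_diff B scaleM k (\<lambda>x. scaleM c (f x)) = (\<lambda>x. scaleM c (bimod_hom_diff B scaleM k f x))"
  "bimod_hom_diff B scaleM k (\<lambda>x. 0) = (\<lambda>x. 0)"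
  by (auto simp: fun_eq_iff bimod_hom_diff_def M.scale_right_distrib M.scale_left_commute mult.commute)

lemma HC_lin:
  assumes "f \<in> HC n" "g \<in> HC n"
  shows "(\<lambda>x. f x + g x) \<in> HC n" "(\<lambda>x. scaleM c (f x)) \<in> HC n"
  using assms unfolding hochschild_cochains_def
  by (auto simp: M.scale_right_distrib mult.commute add_ac)

lemma HC_zero: "(\<lambda>_. 0) \<in> HC n"
  by (simp add: hochschild_cochains_def)

lemma HD_lin:
  "HD n (\<lambda>x. f x + g x) = (\<lambda>x. HD n f x + HD n g x)"
  "HD n (\<lambda>x. scaleM c (f x)) = (\<lambda>x. scaleM c (HD n f x))"
  "HD n (\<lambda>x. 0) = (\<lambda>x. 0)"
proof -
  show "HD n (\<lambda>x. f x + g x) = (\<lambda>x. HD n f x + HD n g x)"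
  proof
    fix as show "HD n (\<lambda>x. f x + g x) as = HD n f as + HD n g as"
      by (cases "length as = Suc n")
        (simp_all only: hochschild_diff_def simp_thms if_True if_False l_add r_add M.scale_right_distrib
          sum.distrib add_ac add_0_right)
  qed
  show "HD n (\<lambda>x. scaleM c (f x)) = (\<lambda>x. scaleM c (HD n f x))"
  proof
    fix as show "HD n (\<lambda>x. scaleM c (f x)) as = scaleM c (HD n f as)"
      by (cases "length as = Suc n")
        (simp_all only: hochschild_diff_def simp_thms if_True if_False l_scale r_scale M.scale_right_distrib
          M.scale_sum_right M.scale_left_commute[of _ c] M.scale_zero_right)
  qed
  show "HD n (\<lambda>x. 0) = (\<lambda>x. 0)"
    by (simp add: fun_eq_iff hochschild_diff_def)
qed

text \<open>
  The sign of the coboundary on bimodule maps is its own inverse.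
\<close>

lemma scaleM_sign [simp]: "scaleM (- ((-1) ^ k)) (scaleM (- ((-1) ^ k)) x) = x"
proof -
  have "(-1) ^ k * (-1) ^ k = (1::'k)" by (simp flip: power_add)
  then show ?thesis by simp
qed

text \<open>
  The isomorphism sends the class of a bimodule map to the class of its cochain, restricted to
  words without corks. Surjectivity and injectivity are the two uses of the exactness of the
  kernel of this restriction.
\<close>

lemma AQ_cohomology_isomorphic_hochschild:
  "vs_isomorphic (AQ_cohomology scaleA scaleM l r (Suc j)) (hochschild_cohomology scaleA scaleM l r (Suc (Suc j)))"
proof -
  let ?BH = "bimod_hom Cot scaleM l r" and ?BD = "bimod_hom_diff Cot scaleM"
  let ?k = "Suc j"
  let ?U = "{f \<in> ?BH ?k. ?BD ?k f = 0}" and ?N = "?BD j ` ?BH j"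
  let ?U' = "{f \<in> HC (Suc ?k). HD (Suc ?k) f = 0}" and ?N' = "HD ?k ` HC ?k"
  let ?\<rho> = "\<lambda>f. restrict (cochain_of f)"
  have sN: "module.subspace fun_scale ?N"
  proof (rule fun_subspaceI)
    show "(\<lambda>_. 0) \<in> ?N"
      by (rule image_eqI[OF _ bimod_hom_zero]) (simp add: bimod_hom_diff_lin)
    fix f g c assume "f \<in> ?N"
    then obtain f' where f': "f = ?BD j f'" "f' \<in> ?BH j" by auto
    show "(\<lambda>x. scaleM c (f x)) \<in> ?N"
      by (rule image_eqI[OF _ bimod_hom_lin(2)[OF f'(2) f'(2)]]) (simp add: bimod_hom_diff_lin f'(1))
    assume "g \<in> ?N"
    then obtain g' where g': "g = ?BD j g'" "g' \<in> ?BH j" by auto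
    show "(\<lambda>x. f x + g x) \<in> ?N"
      by (rule image_eqI[OF _ bimod_hom_lin(1)[OF f'(2) g'(2)]]) (simp add: bimod_hom_diff_lin f'(1) g'(1))
  qed
  have sN': "module.subspace fun_scale ?N'"
  proof (rule fun_subspaceI)
    show "(\<lambda>_. 0) \<in> ?N'" by (rule image_eqI[OF _ HC_zero]) (simp add: HD_lin)
    fix f g c assume "f \<in> ?N'"
    then obtain f' where f': "f = HD ?k f'" "f' \<in> HC ?k" by auto
    show "(\<lambda>x. scaleM c (f x)) \<in> ?N'"
      by (rule image_eqI[OF _ HC_lin(2)[OF f'(2) f'(2)]]) (simp add: HD_lin f'(1))
    assume "g \<in> ?N'"
    then obtain g' where g': "g = HD ?k g'" "g' \<in> HC ?k" by auto
    show "(\<lambda>x. f x + g x) \<in> ?N'"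
      by (rule image_eqI[OF _ HC_lin(1)[OF f'(2) g'(2)]]) (simp add: HD_lin f'(1) g'(1))
  qed
  have sU: "module.subspace fun_scale ?U"
    by (rule fun_subspaceI)
      (auto simp: bimod_hom_zero bimod_hom_lin bimod_hom_diff_lin zero_fun_def)
  have cocycle: "word_coboundary (cochain_of f) = (\<lambda>_. 0)" if "f \<in> ?U" for f
  proof
    fix w
    have f: "f \<in> ?BH ?k" using that by simp
    have "cochain_of (?BD ?k f) w = 0" using that by (simp add: cochain_of_def)
    then have "scaleM (- ((-1) ^ ?k)) (word_coboundary (cochain_of f) w) = 0"
      unfolding cochain_of_diff[OF f] .
    then have "scaleM (- ((-1) ^ ?k)) (scaleM (- ((-1) ^ ?k)) (word_coboundary (cochain_of f) w)) = 0"
      by (simp only: M.scale_zero_right)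
    then show "word_coboundary (cochain_of f) w = 0" by (simp only: scaleM_sign)
  qed
  have into: "?\<rho> f \<in> ?U'" if "f \<in> ?U" for f
  proof -
    have c: "cochain_of f \<in> word_cochains ?k" using that cochain_of_cochain by blast
    have "- HD (Suc ?k) (?\<rho> f) = 0"
      using restrict_coboundary[OF c] cocycle[OF that] by (simp add: restrict_def fun_eq_iff)
    then show ?thesis using restrict_cochain[OF c] by simp
  qed
  have "vs_isomorphic (quotient_vs fun_scale ?U ?N) (quotient_vs fun_scale ?U' ?N')"
  proof (rule vector_space.quotient_iso[OF fun_vector_space fun_vector_space sN sN' sU])
    show "?\<rho> (f + g) = ?\<rho> f + ?\<rho> g" for f g
      by (simp add: fun_eq_iff restrict_def cochain_of_def)
    show "?\<rho> (\<lambda>x. scaleM c (f x)) = (\<lambda>x. scaleM c (?\<rho> f x))" for f c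
      by (simp add: fun_eq_iff restrict_def cochain_of_def)
    show "?\<rho> f \<in> ?U'" if "f \<in> ?U" for f by (rule into[OF that])
    show "\<exists>f\<in>?U. ?\<rho> f - h \<in> ?N'" if h: "h \<in> ?U'" for h
    proof -
      \<comment> \<open>The coboundary of the extension vanishes without corks, so it can be corrected to a cocycle.\<close>
      let ?g = "extend h"
      have g: "?g \<in> word_cochains ?k" using h extend_cochain by blast
      have "restrict (word_coboundary ?g) = - HD (Suc ?k) h"
        using restrict_coboundary[OF g] by (simp only: restrict_extend)
      also have "\<dots> = 0" using h by simp
      finally have "restrict (word_coboundary ?g) = (\<lambda>_. 0)" by (simp only: zero_fun_def)
      then obtain g' where g': "g' \<in> word_cochains ?k" "vanishes_below 1 g'"
        "word_coboundary g' = word_coboundary ?g"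
        using cork_free_kernel_exact[OF word_coboundary_cochain[OF g] vanishes_below_of_restrict_zero]
          word_coboundary_square by blast
      let ?e = "\<lambda>w. ?g w - g' w"
      have g0: "?e \<in> word_cochains ?k" by (rule word_cochains_lin(2)[OF g g'(1)])
      obtain f where f: "f \<in> ?BH ?k" "cochain_of f = ?e" using cochain_of_surj[OF g0] by blast
      have "cochain_of (?BD ?k f) w = 0" for w
        by (simp add: cochain_of_diff[OF f(1)] f(2) word_coboundary_lin g'(3))
      then have "?BD ?k f X = 0" for X
        using cochain_of_inj[OF bimod_hom_diff_map[OF R.bimod_hom_map[OF f(1)]]]
        by (cases "X \<in> vcar Cot") (auto simp: bimod_hom_diff_def)
      then have "f \<in> ?U" using f(1) by (auto simp: fun_eq_iff)
      moreover have "?\<rho> f as = h as" for as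
        using restrict_zero_of_vanishes_below[OF g'(2), of as] fun_cong[OF restrict_extend[of h], of as]
        by (simp add: f(2) restrict_def)
      then have "?\<rho> f - h = 0" by (simp add: fun_eq_iff)
      moreover have "0 \<in> ?N'"
        by (rule image_eqI[OF _ HC_zero]) (simp only: HD_lin(3), simp only: zero_fun_def)
      ultimately show ?thesis by auto
    qed
    show "?\<rho> f \<in> ?N' \<longleftrightarrow> f \<in> ?N" if fU: "f \<in> ?U" for f
    proof
      assume "f \<in> ?N"
      then obtain f' where f': "f' \<in> ?BH j" "f = ?BD j f'" by auto
      have c: "cochain_of f' \<in> word_cochains j" by (rule cochain_of_cochain[OF f'(1)])
      have "?\<rho> f = (\<lambda>as. scaleM ((-1) ^ j) (HD ?k (?\<rho> f') as))"
        using fun_cong[OF restrict_coboundary[OF c]]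
        by (simp add: fun_eq_iff f'(2) restrict_def cochain_of_diff[OF f'(1)])
      also have "\<dots> = HD ?k (\<lambda>as. scaleM ((-1) ^ j) (?\<rho> f' as))" by (simp add: HD_lin)
      finally show "?\<rho> f \<in> ?N'"
        using HC_lin(2)[OF restrict_cochain[OF c] restrict_cochain[OF c]] by blast
    next
      assume "?\<rho> f \<in> ?N'"
      then obtain c where c: "c \<in> HC ?k" "?\<rho> f = HD ?k c" by auto
      \<comment> \<open>Adding the coboundary of an extended primitive moves the cocycle into the kernel; the sign is that of \<open>restrict_coboundary\<close>.\<close>
      let ?e = "extend c" and ?g = "cochain_of f"
      have g0: "?e \<in> word_cochains j" by (rule extend_cochain[OF c(1)])
      have g: "?g \<in> word_cochains ?k" using fU cochain_of_cochain by blast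
      let ?h = "\<lambda>w. ?g w + word_coboundary ?e w"
      have h: "?h \<in> word_cochains ?k" by (rule word_cochains_lin(1)[OF g word_coboundary_cochain[OF g0]])
      have "restrict ?h = (\<lambda>_. 0)"
        using fun_cong[OF restrict_coboundary[OF g0]] fun_cong[OF c(2)]
        by (simp add: fun_eq_iff restrict_def[of ?h] restrict_extend) (simp add: restrict_def)
      moreover have "word_coboundary ?h = (\<lambda>_. 0)"
        using cocycle[OF fU] by (simp add: fun_eq_iff word_coboundary_lin word_coboundary_square)
      ultimately obtain g2 where g2: "g2 \<in> word_cochains j" "word_coboundary g2 = ?h"
        using cork_free_kernel_exact[OF h vanishes_below_of_restrict_zero] by blast
      let ?g3 = "\<lambda>w. scaleM (- ((-1) ^ j)) (g2 w - ?e w)"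
      have "?g3 \<in> word_cochains j"
        by (rule word_cochains_lin(3)[OF word_cochains_lin(2)[OF g2(1) g0] g0])
      then obtain f' where f': "f' \<in> ?BH j" "cochain_of f' = ?g3" using cochain_of_surj by blast
      have eq: "cochain_of (?BD j f') w = ?g w" for w
        unfolding cochain_of_diff[OF f'(1)] f'(2)
        by (simp only: word_coboundary_lin scaleM_sign g2(2)) simp
      let ?d = "\<lambda>X. f X - ?BD j f' X"
      have b1: "R.bimod_map f" using fU R.bimod_hom_map by blast
      have b2: "R.bimod_map (?BD j f')" by (rule bimod_hom_diff_map[OF R.bimod_hom_map[OF f'(1)]])
      have "R.bimod_map ?d"
        unfolding R.bimod_map_def
        by (simp add: R.bimod_mapD[OF b1] R.bimod_mapD[OF b2] M.scale_right_diff_distrib l_diff r_diff)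
      moreover have "cochain_of ?d w = 0" for w
        using eq[of w] by (simp add: cochain_of_def)
      ultimately have "?d X = 0" if "X \<in> vcar Cot" for X using cochain_of_inj that by blast
      moreover have "f X = 0" "?BD j f' X = 0" if "X \<notin> vcar Cot" for X
        using fU that by (auto simp: bimod_hom_def bimod_hom_diff_def)
      ultimately have "f = ?BD j f'" by (metis (no_types, lifting) eq_iff_diff_eq_0 ext)
      then show "f \<in> ?N" using f'(1) by blast
    qed
  qed
  then show ?thesis
    by (simp add: AQ_cohomology_def hochschild_cohomology_def cohomology_def cotangent_complex_def)
qed

end

theorem corollary6p6p7:
  fixes scaleA :: "'k::field_char_0 \<Rightarrow> 'a::{ring,monoid_mult} \<Rightarrow> 'a"
    and scaleM :: "'k \<Rightarrow> 'm::ab_group_add \<Rightarrow> 'm"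
    and l :: "'a \<Rightarrow> 'm \<Rightarrow> 'm" and r :: "'m \<Rightarrow> 'a \<Rightarrow> 'm"
    and k :: nat
  assumes "unital_algebra scaleA"
    and "unital_bimodule scaleA scaleM l r"
    and "k \<ge> 1"
  shows "vs_isomorphic (AQ_cohomology scaleA scaleM l r k)
           (hochschild_cohomology scaleA scaleM l r (k + 1))"
proof -
  obtain j where k: "k = Suc j" using assms(3) by (cases k) auto
  show ?thesis unfolding k using unital_bimodule.AQ_cohomology_isomorphic_hochschild[OF assms(2)] by simp
qed

end
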